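(* The following problem can be solved in polynomial time: given a separable permutation $\sigma$ and an arbitrary permutation $\tau$, compute a longest common pattern of $\sigma$ and $\tau$.
   Context: A permutation $\pi=\pi_1\cdots\pi_k$ is a pattern of $\sigma=\sigma_1\cdots\sigma_n$ if there are indices $i_1<\dots<i_k$ with $\sigma_{i_\ell}<\sigma_{i_m}$ whenever $\pi_\ell<\pi_m$. A longest common pattern of $\sigma$ and $\tau$ is a permutation of maximum length that is a pattern of both $\sigma$ and $\tau$. A permutation is separable if it involves neither $3\,1\,4\,2$ nor $2\,4\,1\,3$ as a pattern. *)

theory Defs
  imports Main
begin

definition is_perm :: "nat list \<Rightarrow> bool" where
  "is_perm xs \<longleftrightarrow> distinct xs \<and> set xs = {1..length xs}"

definition is_pattern :: "nat list \<Rightarrow> nat list \<Rightarrow> bool" where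
  "is_pattern p s \<longleftrightarrow>
     (\<exists>i :: nat \<Rightarrow> nat.
        (\<forall>l m. l < m \<and> m < length p \<longrightarrow> i l < i m) \<and>
        (\<forall>l < length p. i l < length s) \<and>
        (\<forall>l < length p. \<forall>m < length p. p ! l < p ! m \<longrightarrow> s ! (i l) < s ! (i m)))"

definition is_lcp :: "nat list \<Rightarrow> nat list \<Rightarrow> nat list \<Rightarrow> bool" where
  "is_lcp p s t \<longleftrightarrow>
     is_perm p \<and> is_pattern p s \<and> is_pattern p t \<and>
     (\<forall>q. is_perm q \<and> is_pattern q s \<and> is_pattern q t \<longrightarrow> length q \<le> length p)"

definition separable :: "nat list \<Rightarrow> bool" where
  "separable s \<longleftrightarrow> is_perm s \<and> \<not> is_pattern [3,1,4,2] s \<and> \<not> is_pattern [2,4,1,3] s"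

datatype move = MoveL | MoveR | Stay

text \<open>A TM has states {0..<Q} (0 = start, 1 = halt), tape symbols {0..<K}
  (0 = blank) and transition function delta.\<close>
record tm =
  tm_states :: nat
  tm_symbols :: nat
  tm_delta :: "nat \<Rightarrow> nat \<Rightarrow> nat \<times> nat \<times> move"

definition wf_tm :: "tm \<Rightarrow> bool" where
  "wf_tm M \<longleftrightarrow> 2 \<le> tm_states M \<and> 4 \<le> tm_symbols M \<and>
     (\<forall>q < tm_states M. \<forall>a < tm_symbols M.
        fst (tm_delta M q a) < tm_states M \<and> fst (snd (tm_delta M q a)) < tm_symbols M)"

text \<open>Configuration: state, tape left of head (reversed), symbol under head,
  tape right of head; unlisted cells are blank.\<close>
type_synonym config = "nat \<times> nat list \<times> nat \<times> nat list"

fun move_head :: "move \<Rightarrow> nat list \<Rightarrow> nat \<Rightarrow> nat list \<Rightarrow> nat list \<times> nat \<times> nat list" where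
  "move_head Stay ls h rs = (ls, h, rs)"
| "move_head MoveL [] h rs = ([], 0, h # rs)"
| "move_head MoveL (l # ls) h rs = (ls, l, h # rs)"
| "move_head MoveR ls h [] = (h # ls, 0, [])"
| "move_head MoveR ls h (r # rs) = (h # ls, r, rs)"

fun tm_step :: "tm \<Rightarrow> config \<Rightarrow> config" where
  "tm_step M (q, ls, h, rs) =
     (if q = 1 then (q, ls, h, rs)
      else (case tm_delta M q h of (q', a, d) \<Rightarrow> (q', move_head d ls a rs)))"

definition tm_run :: "tm \<Rightarrow> nat \<Rightarrow> config \<Rightarrow> config" where
  "tm_run M t c = (tm_step M ^^ t) c"

definition tm_init :: "nat list \<Rightarrow> config" where
  "tm_init w = (case w of [] \<Rightarrow> (0, [], 0, []) | a # w' \<Rightarrow> (0, [], a, w'))"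

definition cfg_state :: "config \<Rightarrow> nat" where
  "cfg_state c = fst c"

definition cfg_output :: "config \<Rightarrow> nat list" where
  "cfg_output c = (case c of (q, ls, h, rs) \<Rightarrow> takeWhile (\<lambda>a. a \<noteq> 0) (h # rs))"

definition enc_list :: "nat list \<Rightarrow> nat list" where
  "enc_list xs = concat (map (\<lambda>v. replicate v 1 @ [2]) xs)"

definition enc_pair :: "nat list \<Rightarrow> nat list \<Rightarrow> nat list" where
  "enc_pair s t = enc_list s @ [3] @ enc_list t"

end

(*
  The dynamic program maps a pair of boxes, one in the plot of s and one in the plot of t, to a long
  common pattern of the points inside. A box pair is improved by cutting both boxes into four
  quadrants and concatenating the words stored for two opposite quadrants (a direct or a skew sum).
  Every stored word is a common pattern. Conversely, a permutation avoiding 3142 and 2413 with at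
  least two letters is a direct or a skew sum, so by induction r rounds find every separable common
  pattern of length at most r, and all patterns of the separable permutation s are separable. Since
  no splitting of s itself is ever computed, s and t play symmetric roles.

  For the machine model, four stacks are stored as four tracks of the single tape with all tops in
  the head cell, so a push or pop shifts one track. Values are binary trees in prefix notation, a
  prefix-free code: a program for f rewrites the code on top of stack 0 and leaves everything below
  it alone, which makes such programs composable. Polynomial time is then closed under composition,
  pairing, case distinction, and folds whose intermediate results have polynomial size.
*)
theory Submission
  imports Defs
begin

section \<open>Stack programs on a single-tape machine\<close>

text \<open>The obstacle is that time must be bounded on a concrete single-tape machine, while the
  algorithm is a HOL function. The bridge is the predicate \<open>polytime\<close> on HOL functions
  between \<open>encodable\<close> types; its closure rules are syntactic enough that the algorithm
  is shown polynomial by following its definition. Degrees are never tracked, so linear sweeps for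
  every push and tables with eight coordinates per key are affordable. The one rule with a delicate
  side condition is that for folds: a polynomial step may double its accumulator, so intermediate
  sizes must be bounded in advance. For the table this bound comes from correctness: a stored word
  is a common pattern, hence has at most \<open>length s\<close> letters, all taken from
  \<open>s\<close>. Soundness therefore serves both the result and the running time. Completeness is
  an induction on the number of letters, not on the size of boxes; this is why whole tables are
  recomputed in rounds instead of being filled in an order of boxes. Numbers are unary in the input
  and in all trees, so a bound polynomial in values is a bound polynomial in sizes.\<close>

datatype com =
  SKIP
| Op nat nat
| Seq com com
| IF "(nat \<Rightarrow> nat) \<Rightarrow> bool" com com
| WHILE "(nat \<Rightarrow> nat) \<Rightarrow> bool" com

type_synonym stacks = "nat \<Rightarrow> nat list"

text \<open>The value 0 for an empty stack is the blank track entry, so the tests of a program see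
  exactly the column stored in cell 0 (\<open>tape_of_0\<close>).\<close>

definition tops :: "stacks \<Rightarrow> nat \<Rightarrow> nat" where
  "tops s = (\<lambda>i. case s i of [] \<Rightarrow> 0 | a # _ \<Rightarrow> a)"

text \<open>The number is a cost. The extra 1 or 2 of the compound commands are steps of
  \<open>cstep\<close>: evaluating a test, and passing from \<open>Seq SKIP c2\<close> to
  \<open>c2\<close>. An \<open>Op\<close> is charged 1 although it sweeps a whole track;
  \<open>exec_reach\<close> multiplies by the length of a sweep.\<close>

inductive exec :: "com \<Rightarrow> stacks \<Rightarrow> nat \<Rightarrow> stacks \<Rightarrow> bool" where
  exec_SKIP: "exec SKIP s 0 s"
| exec_push: "i < 4 \<Longrightarrow> a \<in> {1,2,3} \<Longrightarrow> exec (Op i a) s 1 (s(i := a # s i))"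
| exec_pop: "i < 4 \<Longrightarrow> exec (Op i 5) s 1 (s(i := tl (s i)))"
| exec_Seq: "exec c1 s n s1 \<Longrightarrow> exec c2 s1 m s2 \<Longrightarrow> exec (Seq c1 c2) s (n + m + 1) s2"
| exec_IF1: "P (tops s) \<Longrightarrow> exec c1 s n s1 \<Longrightarrow> exec (IF P c1 c2) s (n + 1) s1"
| exec_IF2: "\<not> P (tops s) \<Longrightarrow> exec c2 s n s1 \<Longrightarrow> exec (IF P c1 c2) s (n + 1) s1"
| exec_WHILE1: "P (tops s) \<Longrightarrow> exec c s n s1 \<Longrightarrow> exec (WHILE P c) s1 m s2 \<Longrightarrow>
    exec (WHILE P c) s (n + m + 2) s2"
| exec_WHILE2: "\<not> P (tops s) \<Longrightarrow> exec (WHILE P c) s 1 s"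

text \<open>Internal states \<open>q\<close> of an operation on track \<open>i\<close>: 1 to 3 push that symbol, carrying the displaced
  one to the right; 4 walks back to cell 0, recognised by the blank on its left; 5 walks right to the
  end of the track and then 6 to 9 pop, carrying \<open>q - 6\<close> to the left; 0 is done. So \<open>Op i a\<close> pushes
  \<open>a\<close> and \<open>Op i 5\<close> pops.\<close>

definition trans :: "nat \<Rightarrow> nat \<Rightarrow> (nat \<Rightarrow> nat) \<Rightarrow> nat \<times> (nat \<Rightarrow> nat) \<times> move" where
  "trans i q f =
    (if q \<le> 3 then (if f i = 0 then (4, f(i := q), MoveL) else (f i, f(i := q), MoveR))
     else if q = 4 then (if f = (\<lambda>_. 0) then (0, f, MoveR) else (4, f, MoveL))
     else if q = 5 then (if f i = 0 then (6, f, MoveL) else (5, f, MoveR))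
     else (if f = (\<lambda>_. 0) then (0, f, MoveR) else (6 + f i, f(i := q - 6), MoveL)))"

text \<open>The program that remains to be executed is the control state, so this small-step
  semantics already is a transition function: it reads one column and returns the new program, the
  new column and a head move.\<close>

fun cstep :: "com \<Rightarrow> (nat \<Rightarrow> nat) \<Rightarrow> com \<times> (nat \<Rightarrow> nat) \<times> move" where
  "cstep SKIP f = (SKIP, f, Stay)"
| "cstep (Op i q) f = (case trans i q f of (q', f', m) \<Rightarrow> (if q' = 0 then SKIP else Op i q', f', m))"
| "cstep (Seq c1 c2) f = (if c1 = SKIP then (c2, f, Stay)
     else (case cstep c1 f of (c', f', m) \<Rightarrow> (Seq c' c2, f', m)))"
| "cstep (IF P c1 c2) f = (if P f then c1 else c2, f, Stay)"
| "cstep (WHILE P c) f = (if P f then Seq c (WHILE P c) else SKIP, f, Stay)"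

fun wfc :: "com \<Rightarrow> bool" where
  "wfc SKIP = True"
| "wfc (Op i q) = (i < 4 \<and> q < 10)"
| "wfc (Seq c1 c2) = (wfc c1 \<and> wfc c2)"
| "wfc (IF P c1 c2) = (wfc c1 \<and> wfc c2)"
| "wfc (WHILE P c) = wfc c"

text \<open>A finite superset of the programs reachable from \<open>c\<close> by
  \<open>cstep\<close>, and thus the future state set of the machine.\<close>

fun residuals :: "com \<Rightarrow> com set" where
  "residuals SKIP = {SKIP}"
| "residuals (Op i q) = insert SKIP (Op i ` {..<10})"
| "residuals (Seq c1 c2) = (\<lambda>c. Seq c c2) ` residuals c1 \<union> residuals c2"
| "residuals (IF P c1 c2) = insert (IF P c1 c2) (residuals c1 \<union> residuals c2)"
| "residuals (WHILE P c) = {SKIP, WHILE P c} \<union> (\<lambda>d. Seq d (WHILE P c)) ` residuals c"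

lemma finite_residuals: "finite (residuals c)"
  by (induction c) auto

lemma self_in_residuals: "wfc c \<Longrightarrow> c \<in> residuals c"
  by (induction c) auto

lemma SKIP_in_residuals: "SKIP \<in> residuals c"
  by (induction c) auto

definition valid_sym :: "(nat \<Rightarrow> nat) \<Rightarrow> bool" where
  "valid_sym f \<longleftrightarrow> (\<forall>i<4. f i < 4) \<and> (\<forall>i\<ge>4. f i = 0)"

lemma trans_closed:
  assumes "valid_sym f" "i < 4" "q < 10" "trans i q f = (q', f', m)"
  shows "q' < 10" "valid_sym f'"
proof -
  have "f i < 4" using assms(1,2) by (auto simp: valid_sym_def)
  then show "q' < 10" "valid_sym f'"
    using assms by (auto simp: trans_def valid_sym_def split: if_splits)
qed

lemma cstep_closed:
  assumes "wfc c" "d \<in> residuals c" "valid_sym f" "cstep d f = (d', f', m)"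
  shows "d' \<in> residuals c \<and> valid_sym f'"
  using assms
proof (induction c arbitrary: d d' f' m)
  case (Op i q)
  then show ?case using trans_closed[OF \<open>valid_sym f\<close>, of i]
    by (auto split: prod.splits if_splits)
next
  case (Seq c1 c2)
  from Seq.prems(2) consider d1 where "d = Seq d1 c2" "d1 \<in> residuals c1" | "d \<in> residuals c2"
    by auto
  then show ?case
  proof cases
    case 1
    then show ?thesis using Seq.IH(1)[of d1] Seq.prems self_in_residuals[of c2]
      by (auto split: if_splits prod.splits)
  next
    case 2
    then show ?thesis using Seq.IH(2)[of d] Seq.prems by auto
  qed
next
  case (IF P c1 c2)
  from IF.prems(2) consider "d = IF P c1 c2" | "d \<in> residuals c1" | "d \<in> residuals c2" by auto
  then show ?case
  proof cases
    case 1
    then show ?thesis using IF.prems self_in_residuals[of c1] self_in_residuals[of c2] by auto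
  next
    case 2
    then show ?thesis using IF.IH(1)[of d] IF.prems by auto
  next
    case 3
    then show ?thesis using IF.IH(2)[of d] IF.prems by auto
  qed
next
  case (WHILE P c)
  from WHILE.prems(2) consider d1 where "d = Seq d1 (WHILE P c)" "d1 \<in> residuals c"
    | "d = SKIP" | "d = WHILE P c"
    by auto
  then show ?case
  proof cases
    case 1
    then show ?thesis using WHILE.IH[of d1] WHILE.prems
      by (auto split: if_splits prod.splits)
  next
    case 2
    then show ?thesis using WHILE.prems by auto
  next
    case 3
    then show ?thesis using WHILE.prems self_in_residuals[of c] by (auto split: if_splits)
  qed
qed auto

section \<open>Simulation of stack programs on a two-way infinite tape\<close>

type_synonym tape = "int \<Rightarrow> nat \<Rightarrow> nat"

fun offset :: "move \<Rightarrow> int" where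
  "offset MoveL = - 1"
| "offset MoveR = 1"
| "offset Stay = 0"

definition astep :: "com \<times> int \<times> tape \<Rightarrow> com \<times> int \<times> tape" where
  "astep = (\<lambda>(c, p, T). case cstep c (T p) of (c', f, m) \<Rightarrow> (c', p + offset m, T(p := f)))"

lemma astep_SKIP [simp]: "astep (SKIP, p, T) = (SKIP, p, T)"
  by (simp add: astep_def)

lemma astep_pow_SKIP [simp]: "(astep ^^ k) (SKIP, p, T) = (SKIP, p, T)"
  by (induction k) auto

definition reach :: "nat \<Rightarrow> com \<times> int \<times> tape \<Rightarrow> com \<times> int \<times> tape \<Rightarrow> bool" where
  "reach n x y \<longleftrightarrow> (\<exists>k\<le>n. (astep ^^ k) x = y)"

lemma reach_refl: "reach n x x"
  unfolding reach_def by (intro exI[of _ 0]) auto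

lemma reach_trans: "reach n x y \<Longrightarrow> reach m y z \<Longrightarrow> reach (n + m) x z"
proof -
  assume "reach n x y" "reach m y z"
  then obtain k l where k: "k \<le> n" "(astep ^^ k) x = y" and l: "l \<le> m" "(astep ^^ l) y = z"
    unfolding reach_def by blast
  then have "(astep ^^ (l + k)) x = z" by (simp add: funpow_add)
  then show ?thesis using k(1) l(1) unfolding reach_def by (intro exI[of _ "l + k"]) auto
qed

lemma reach_mono: "reach n x y \<Longrightarrow> n \<le> m \<Longrightarrow> reach m x y"
  unfolding reach_def using order_trans by blast

lemma reach_step: "astep x = y \<Longrightarrow> reach 1 x y"
  unfolding reach_def by (intro exI[of _ 1]) auto

lemma reach_Seq:
  assumes "reach n (c1, p, T) (SKIP, p', T')"
  shows "reach (n + 1) (Seq c1 c2, p, T) (c2, p', T')"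
proof -
  have "(astep ^^ k) (c1, p, T) = (SKIP, p', T') \<Longrightarrow>
      reach (k + 1) (Seq c1 c2, p, T) (c2, p', T')" for k
  proof (induction k arbitrary: c1 p T)
    case 0
    then have "reach 1 (Seq c1 c2, p, T) (c2, p', T')"
      by (intro reach_step) (auto simp: astep_def)
    then show ?case by simp
  next
    case (Suc k)
    show ?case
    proof (cases "c1 = SKIP")
      case True
      \<comment> \<open>\<open>SKIP\<close> is absorbing, so the counted steps may include idle ones
        after the first component has finished.\<close>
      then have "p' = p" "T' = T" using Suc.prems by (auto simp del: funpow.simps)
      then have "reach 1 (Seq c1 c2, p, T) (c2, p', T')"
        using True by (intro reach_step) (auto simp: astep_def)
      then show ?thesis by (rule reach_mono) simp
    next
      case False
      obtain c' f m where st: "cstep c1 (T p) = (c', f, m)" by (metis prod_cases3)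
      have "(astep ^^ k) (c', p + offset m, T(p := f)) = (SKIP, p', T')"
        using Suc.prems st by (simp add: funpow_Suc_right astep_def del: funpow.simps)
      then have "reach (k + 1) (Seq c' c2, p + offset m, T(p := f)) (c2, p', T')"
        by (rule Suc.IH)
      moreover have "reach 1 (Seq c1 c2, p, T) (Seq c' c2, p + offset m, T(p := f))"
        using st False by (intro reach_step) (auto simp: astep_def)
      ultimately show ?thesis using reach_trans by fastforce
    qed
  qed
  moreover obtain k where "k \<le> n" "(astep ^^ k) (c1, p, T) = (SKIP, p', T')"
    using assms unfolding reach_def by blast
  ultimately show ?thesis using reach_mono[of "k + 1" _ _ "n + 1"] by simp
qed

definition tape_of :: "stacks \<Rightarrow> tape" where
  "tape_of s = (\<lambda>j i. if 0 \<le> j \<and> nat j < length (s i) then s i ! nat j else 0)"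

definition pos_stacks :: "stacks \<Rightarrow> bool" where
  "pos_stacks s \<longleftrightarrow> (\<forall>i. 0 \<notin> set (s i))"

lemma tape_of_0: "tape_of s 0 = tops s"
  by (auto simp: tape_of_def tops_def fun_eq_iff split: list.splits)

lemma tape_of_neg: "tape_of s (- 1) = (\<lambda>_. 0)"
  by (auto simp: tape_of_def)

lemma tape_of_eq_0_iff:
  "pos_stacks s \<Longrightarrow> 0 \<le> j \<Longrightarrow> tape_of s j i = 0 \<longleftrightarrow> length (s i) \<le> nat j"
  unfolding tape_of_def pos_stacks_def by (metis in_set_conv_nth linorder_not_le)

text \<open>Pushing shifts the track by one cell. The state holds the symbol to be written and the
  displaced one becomes the next state, so the induction hypothesis is applied one cell further with
  \<open>b\<close> in place of \<open>a\<close>. The last write already moves left, whence the final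
  position.\<close>

lemma reach_push_right:
  assumes "i < 4" "a \<in> {1,2,3}" "0 \<notin> set xs" "set xs \<subseteq> {1,2,3}"
    and "\<And>k. k < length xs \<Longrightarrow> T (p + int k) i = xs ! k" and "T (p + int (length xs)) i = 0"
  shows "reach (length xs + 1) (Op i a, p, T)
    (Op i 4, p + int (length xs) - 1,
      \<lambda>j. if p \<le> j \<and> j \<le> p + int (length xs) then (T j)(i := (a # xs) ! nat (j - p)) else T j)"
  using assms
proof (induction xs arbitrary: a p T)
  case Nil
  then show ?case
    by (intro reach_step[THEN reach_mono]) (auto simp: astep_def trans_def fun_eq_iff)
next
  case (Cons b xs)
  let ?T = "T(p := (T p)(i := a))"
  have b: "T p i = b" "b \<in> {1,2,3}" using Cons.prems(5)[of 0] Cons.prems(4) by auto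
  have 1: "reach 1 (Op i a, p, T) (Op i b, p + 1, ?T)"
    using b Cons.prems(2) by (intro reach_step) (auto simp: astep_def trans_def)
  have "reach (length xs + 1) (Op i b, p + 1, ?T)
    (Op i 4, p + 1 + int (length xs) - 1,
      \<lambda>j. if p + 1 \<le> j \<and> j \<le> p + 1 + int (length xs)
        then (?T j)(i := (b # xs) ! nat (j - (p + 1))) else ?T j)" (is "reach _ _ (_, _, ?T2)")
  proof (rule Cons.IH)
    fix k assume "k < length xs"
    then show "?T (p + 1 + int k) i = xs ! k"
      using Cons.prems(5)[of "Suc k"] by (auto simp: algebra_simps)
  next
    show "?T (p + 1 + int (length xs)) i = 0"
      using Cons.prems(6) by (auto simp: algebra_simps)
  qed (use b Cons.prems in auto)
  moreover have "?T2 = (\<lambda>j. if p \<le> j \<and> j \<le> p + int (length (b # xs))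
      then (T j)(i := (a # b # xs) ! nat (j - p)) else T j)"
  proof
    fix j
    consider "j = p" | "p < j" | "j < p" by linarith
    then show "?T2 j = (if p \<le> j \<and> j \<le> p + int (length (b # xs))
      then (T j)(i := (a # b # xs) ! nat (j - p)) else T j)"
    proof cases
      case 2
      then have "nat (j - p) = Suc (nat (j - (p + 1)))" by linarith
      then show ?thesis using 2 by auto
    qed auto
  qed
  ultimately have "reach (1 + (length xs + 1)) (Op i a, p, T) (Op i 4, p + 1 + int (length xs) - 1,
      \<lambda>j. if p \<le> j \<and> j \<le> p + int (length (b # xs))
      then (T j)(i := (a # b # xs) ! nat (j - p)) else T j)"
    using reach_trans[OF 1] by simp
  then show ?case by (simp add: algebra_simps)
qed

text \<open>The start of the tape needs no marker: each cell on the way back is nonblank in some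
  track, so the first blank column met is cell -1. For \<open>n = 0\<close> the head already stands
  there.\<close>

lemma reach_return:
  assumes "\<And>j. 0 \<le> j \<Longrightarrow> j < int n \<Longrightarrow> T j \<noteq> (\<lambda>_. 0)" "T (- 1) = (\<lambda>_. 0)"
  shows "reach (n + 1) (Op i 4, int n - 1, T) (SKIP, 0, T)"
  using assms(1)
proof (induction n)
  case 0
  then show ?case using assms(2)
    by (intro reach_step[THEN reach_mono]) (auto simp: astep_def trans_def)
next
  case (Suc n)
  have "reach 1 (Op i 4, int n, T) (Op i 4, int n - 1, T)"
    using Suc.prems[of "int n"] by (intro reach_step) (auto simp: astep_def trans_def)
  moreover have "reach (n + 1) (Op i 4, int n - 1, T) (SKIP, 0, T)"
    using Suc by auto
  ultimately show ?case using reach_trans by fastforce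
qed

definition valid_stacks :: "stacks \<Rightarrow> bool" where
  "valid_stacks s \<longleftrightarrow> (\<forall>i. set (s i) \<subseteq> {1,2,3}) \<and> (\<forall>i\<ge>4. s i = [])"

lemma valid_pos_stacks: "valid_stacks s \<Longrightarrow> pos_stacks s"
  by (fastforce simp: valid_stacks_def pos_stacks_def)

lemma valid_sym_tape_of: "valid_stacks s \<Longrightarrow> valid_sym (tape_of s j)"
proof -
  assume v: "valid_stacks s"
  have "tape_of s j i < 4" for i
  proof (cases "0 \<le> j \<and> nat j < length (s i)")
    case True
    then have "s i ! nat j \<in> {1,2,3}" using v nth_mem unfolding valid_stacks_def by blast
    then show ?thesis using True by (auto simp: tape_of_def)
  qed (auto simp: tape_of_def)
  then show ?thesis using v by (auto simp: valid_sym_def valid_stacks_def tape_of_def)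
qed

lemma reach_push:
  assumes v: "valid_stacks s" and i: "i < 4" and a: "a \<in> {1,2,3}"
  shows "reach (2 * length (s i) + 2) (Op i a, 0, tape_of s) (SKIP, 0, tape_of (s(i := a # s i)))"
proof -
  let ?n = "length (s i)"
  have 1: "reach (?n + 1) (Op i a, 0, tape_of s)
    (Op i 4, 0 + int ?n - 1,
      \<lambda>j. if 0 \<le> j \<and> j \<le> 0 + int ?n then (tape_of s j)(i := (a # s i) ! nat (j - 0)) else tape_of s j)"
    (is "reach _ _ (_, _, ?T)")
    by (rule reach_push_right) (use assms valid_pos_stacks[OF v] in \<open>auto simp: valid_stacks_def pos_stacks_def tape_of_def\<close>)
  have 2: "?T = tape_of (s(i := a # s i))"
    by (auto simp: fun_eq_iff tape_of_def)
  have 3: "reach (?n + 1) (Op i 4, int ?n - 1, tape_of (s(i := a # s i))) (SKIP, 0, tape_of (s(i := a # s i)))"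
  proof (rule reach_return)
    fix j :: int assume j: "0 \<le> j" "j < int ?n"
    have "pos_stacks (s(i := a # s i))" using valid_pos_stacks[OF v] a by (auto simp: pos_stacks_def)
    then have "tape_of (s(i := a # s i)) j i \<noteq> 0" using j by (subst tape_of_eq_0_iff) auto
    then show "tape_of (s(i := a # s i)) j \<noteq> (\<lambda>_. 0)" by auto
  qed (simp add: tape_of_neg)
  have "reach (?n + 1 + (?n + 1)) (Op i a, 0, tape_of s) (SKIP, 0, tape_of (s(i := a # s i)))"
    by (rule reach_trans[OF 1]) (unfold 2, use 3 in simp)
  then show ?thesis by (simp add: mult_2)
qed

lemma reach_pop_right:
  assumes "\<And>j. 0 \<le> j \<Longrightarrow> j < int n \<Longrightarrow> T (p + j) i \<noteq> 0" "T (p + int n) i = 0"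
  shows "reach (n + 1) (Op i 5, p, T) (Op i 6, p + int n - 1, T)"
  using assms
proof (induction n arbitrary: p)
  case 0
  then show ?case
    by (intro reach_step[THEN reach_mono]) (auto simp: astep_def trans_def)
next
  case (Suc n)
  have "reach 1 (Op i 5, p, T) (Op i 5, p + 1, T)"
    using Suc.prems(1)[of 0] by (intro reach_step) (auto simp: astep_def trans_def)
  moreover have "reach (n + 1) (Op i 5, p + 1, T) (Op i 6, p + 1 + int n - 1, T)"
  proof (rule Suc.IH)
    fix j assume "0 \<le> j" "j < int n"
    then show "T (p + 1 + j) i \<noteq> 0" using Suc.prems(1)[of "j + 1"] by (auto simp: algebra_simps)
  qed (use Suc.prems in \<open>auto simp: algebra_simps\<close>)
  ultimately show ?case using reach_trans by (fastforce simp: algebra_simps)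
qed

text \<open>Deleting the top shifts the track in the other direction, so the work is done from right
  to left with the carried symbol \<open>a\<close> in the state \<open>6 + a\<close>. A pop starts
  with \<open>a = 0\<close>, the blank for the last cell; the induction needs arbitrary
  \<open>a\<close>.\<close>

lemma reach_pop_left:
  assumes "\<And>j. 0 \<le> j \<Longrightarrow> j < int n \<Longrightarrow> T j i \<noteq> 0" "T (- 1) = (\<lambda>_. 0)"
  shows "reach (n + 1) (Op i (6 + a), int n - 1, T)
    (SKIP, 0, \<lambda>j. if 0 \<le> j \<and> j < int n
       then (T j)(i := if j = int n - 1 then a else T (j + 1) i) else T j)"
  using assms
proof (induction n arbitrary: T a)
  case 0
  then show ?case
    by (intro reach_step[THEN reach_mono]) (auto simp: astep_def trans_def fun_eq_iff)
next
  case (Suc n)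
  let ?b = "T (int n) i"
  let ?T = "T(int n := (T (int n))(i := a))"
  have nz: "?b \<noteq> 0" using Suc.prems(1)[of "int n"] by auto
  then have nz': "T (int n) \<noteq> (\<lambda>_. 0)" by metis
  have 1: "reach 1 (Op i (6 + a), int n, T) (Op i (6 + ?b), int n - 1, ?T)"
    using nz nz' by (intro reach_step) (auto simp: astep_def trans_def)
  have 2: "reach (n + 1) (Op i (6 + ?b), int n - 1, ?T)
    (SKIP, 0, \<lambda>j. if 0 \<le> j \<and> j < int n
       then (?T j)(i := if j = int n - 1 then ?b else ?T (j + 1) i) else ?T j)"
    using Suc.prems by (intro Suc.IH) auto
  have 3: "(\<lambda>j. if 0 \<le> j \<and> j < int n
       then (?T j)(i := if j = int n - 1 then ?b else ?T (j + 1) i) else ?T j) =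
     (\<lambda>j. if 0 \<le> j \<and> j < int (Suc n)
       then (T j)(i := if j = int (Suc n) - 1 then a else T (j + 1) i) else T j)"
    by (auto simp: fun_eq_iff)
  show ?case using reach_trans[OF 1 2] unfolding 3 by simp
qed

lemma reach_pop:
  assumes v: "valid_stacks s" and i: "i < 4"
  shows "reach (2 * length (s i) + 2) (Op i 5, 0, tape_of s) (SKIP, 0, tape_of (s(i := tl (s i))))"
proof -
  let ?n = "length (s i)"
  note nz = tape_of_eq_0_iff[OF valid_pos_stacks[OF v]]
  have 1: "reach (?n + 1) (Op i 5, 0, tape_of s) (Op i 6, 0 + int ?n - 1, tape_of s)"
    by (rule reach_pop_right) (auto simp: nz)
  have 2: "reach (?n + 1) (Op i (6 + 0), int ?n - 1, tape_of s)
    (SKIP, 0, \<lambda>j. if 0 \<le> j \<and> j < int ?n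
       then (tape_of s j)(i := if j = int ?n - 1 then 0 else tape_of s (j + 1) i) else tape_of s j)"
    by (rule reach_pop_left) (auto simp: nz tape_of_neg)
  have 3: "(\<lambda>j. if 0 \<le> j \<and> j < int ?n
       then (tape_of s j)(i := if j = int ?n - 1 then 0 else tape_of s (j + 1) i) else tape_of s j) =
       tape_of (s(i := tl (s i)))"
    by (auto simp: fun_eq_iff tape_of_def nth_tl nat_add_distrib)
  have "reach (?n + 1 + (?n + 1)) (Op i 5, 0, tape_of s) (SKIP, 0, tape_of (s(i := tl (s i))))"
    by (rule reach_trans[OF 1]) (use 2[unfolded 3] in simp)
  then show ?thesis by (simp add: mult_2)
qed

lemma exec_valid: "exec c s n s' \<Longrightarrow> valid_stacks s \<Longrightarrow> valid_stacks s'"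
proof (induction rule: exec.induct)
  case (exec_pop i s)
  have "set (tl (s i)) \<subseteq> set (s i)" by (cases "s i") auto
  then show ?case using exec_pop unfolding valid_stacks_def by (auto split: if_splits)
qed (auto simp: valid_stacks_def)

lemma exec_length: "exec c s n s' \<Longrightarrow> length (s' i) \<le> length (s i) + n"
  by (induction rule: exec.induct) auto

text \<open>\<open>M\<close> bounds all stacks throughout the run: each unit of cost adds at most
  one symbol, so current height plus remaining cost never exceeds \<open>M\<close>. Hence every
  sweep, right and back, takes at most \<open>2 * M + 2\<close> steps.\<close>

lemma exec_reach:
  assumes "exec c s n s'" "valid_stacks s" "\<And>i. length (s i) + n \<le> M"
  shows "reach (n * (2 * M + 2)) (c, 0, tape_of s) (SKIP, 0, tape_of s')"
  using assms
proof (induction rule: exec.induct)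
  case (exec_SKIP s)
  then show ?case by (simp add: reach_refl)
next
  case (exec_push i a s)
  have "2 * length (s i) + 2 \<le> 1 * (2 * M + 2)" using exec_push.prems(2)[of i] by simp
  then show ?case using reach_mono[OF reach_push] exec_push by blast
next
  case (exec_pop i s)
  have "2 * length (s i) + 2 \<le> 1 * (2 * M + 2)" using exec_pop.prems(2)[of i] by simp
  then show ?case using reach_mono[OF reach_pop] exec_pop by blast
next
  case (exec_Seq c1 s n s1 c2 m s2)
  have le: "length (s i) + n \<le> M" for i using exec_Seq.prems(2)[of i] by simp
  have 1: "reach (n * (2 * M + 2)) (c1, 0, tape_of s) (SKIP, 0, tape_of s1)"
    using exec_Seq.prems(1) le by (intro exec_Seq.IH)
  have "length (s1 i) + m \<le> M" for i
    using exec_Seq.prems(2)[of i] exec_length[OF exec_Seq.hyps(1), of i] by simp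
  then have 2: "reach (m * (2 * M + 2)) (c2, 0, tape_of s1) (SKIP, 0, tape_of s2)"
    using exec_valid[OF exec_Seq.hyps(1)] exec_Seq.prems(1) by (intro exec_Seq.IH)
  show ?case
    by (rule reach_mono[OF reach_trans[OF reach_Seq[OF 1] 2]]) (simp add: algebra_simps)
next
  case (exec_IF1 P s c1 n s1 c2)
  have 1: "reach (n * (2 * M + 2)) (c1, 0, tape_of s) (SKIP, 0, tape_of s1)"
    using exec_IF1.prems(1) exec_IF1.prems(2) by (intro exec_IF1.IH) (auto intro: Suc_leD)
  have "reach 1 (IF P c1 c2, 0, tape_of s) (c1, 0, tape_of s)"
    using exec_IF1.hyps by (intro reach_step) (auto simp: astep_def tape_of_0)
  from reach_mono[OF reach_trans[OF this 1]] show ?case by simp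
next
  case (exec_IF2 P s c2 n s1 c1)
  have 1: "reach (n * (2 * M + 2)) (c2, 0, tape_of s) (SKIP, 0, tape_of s1)"
    using exec_IF2.prems(1) exec_IF2.prems(2) by (intro exec_IF2.IH) (auto intro: Suc_leD)
  have "reach 1 (IF P c1 c2, 0, tape_of s) (c2, 0, tape_of s)"
    using exec_IF2.hyps by (intro reach_step) (auto simp: astep_def tape_of_0)
  from reach_mono[OF reach_trans[OF this 1]] show ?case by simp
next
  case (exec_WHILE1 P s c n s1 m s2)
  have le: "length (s i) + n \<le> M" for i using exec_WHILE1.prems(2)[of i] by simp
  have 1: "reach (n * (2 * M + 2)) (c, 0, tape_of s) (SKIP, 0, tape_of s1)"
    using exec_WHILE1.prems(1) le by (intro exec_WHILE1.IH)
  have "length (s1 i) + m \<le> M" for i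
    using exec_WHILE1.prems(2)[of i] exec_length[OF exec_WHILE1.hyps(2), of i] by simp
  then have 2: "reach (m * (2 * M + 2)) (WHILE P c, 0, tape_of s1) (SKIP, 0, tape_of s2)"
    using exec_valid[OF exec_WHILE1.hyps(2)] exec_WHILE1.prems(1) by (intro exec_WHILE1.IH)
  have "reach 1 (WHILE P c, 0, tape_of s) (Seq c (WHILE P c), 0, tape_of s)"
    using exec_WHILE1.hyps by (intro reach_step) (auto simp: astep_def tape_of_0)
  from reach_mono[OF reach_trans[OF this reach_trans[OF reach_Seq[OF 1] 2]]]
  show ?case by (simp add: algebra_simps)
next
  case (exec_WHILE2 P s c)
  then have "reach 1 (WHILE P c, 0, tape_of s) (SKIP, 0, tape_of s)"
    by (intro reach_step) (auto simp: astep_def tape_of_0)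
  from reach_mono[OF this] show ?case by simp
qed

text \<open>A tape symbol is a number below 256 whose four base-4 digits are the track entries. Hence
  blank is the all-empty column, and input symbols are columns with only track 0 in use.\<close>

definition enc_sym :: "(nat \<Rightarrow> nat) \<Rightarrow> nat" where
  "enc_sym f = f 0 + 4 * (f 1 + 4 * (f 2 + 4 * f 3))"

definition dec_sym :: "nat \<Rightarrow> nat \<Rightarrow> nat" where
  "dec_sym n = (\<lambda>i. if i < 4 then n div 4 ^ i mod 4 else 0)"

lemma valid_sym_dec: "valid_sym (dec_sym n)"
  by (auto simp: valid_sym_def dec_sym_def)

lemma enc_sym_less: "valid_sym f \<Longrightarrow> enc_sym f < 256"
proof -
  assume "valid_sym f"
  then have "f 0 < 4" "f 1 < 4" "f 2 < 4" "f 3 < 4" by (auto simp: valid_sym_def)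
  then show ?thesis by (simp add: enc_sym_def)
qed

lemma dec_enc_sym: "valid_sym f \<Longrightarrow> dec_sym (enc_sym f) = f"
proof
  fix i :: nat assume v: "valid_sym f"
  have digit: "(a + 4 * b) mod 4 = a" "(a + 4 * b) div 4 = b" if "a < 4" for a b :: nat
    using that by simp_all
  have f: "f 0 < 4" "f 1 < 4" "f 2 < 4" "f 3 < 4" using v by (auto simp: valid_sym_def)
  have "n div 4 ^ Suc k = n div 4 div 4 ^ k" for n k :: nat by (simp only: power_Suc div_mult2_eq)
  then have *: "enc_sym f div 4 ^ 0 = enc_sym f" "enc_sym f div 4 ^ 1 = enc_sym f div 4"
    "enc_sym f div 4 ^ 2 = enc_sym f div 4 div 4" "enc_sym f div 4 ^ 3 = enc_sym f div 4 div 4 div 4"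
    by (simp_all only: numeral_2_eq_2 numeral_3_eq_3 One_nat_def power_0 div_by_Suc_0)
  consider "i = 0" | "i = 1" | "i = 2" | "i = 3" | "i \<ge> 4" by linarith
  then show "dec_sym (enc_sym f) i = f i"
  proof cases
    case 5
    then show ?thesis using v by (simp add: dec_sym_def valid_sym_def)
  qed (use f digit(1)[of "f 3" 0] in
      \<open>simp_all only: dec_sym_def *, simp_all only: enc_sym_def digit, simp_all\<close>)
qed

definition nth0 :: "nat list \<Rightarrow> nat \<Rightarrow> nat" where
  "nth0 xs n = (if n < length xs then xs ! n else 0)"

text \<open>A configuration records no absolute head position, so cells are addressed by their
  offset \<open>k\<close> from the head.\<close>

definition cell :: "nat list \<Rightarrow> nat \<Rightarrow> nat list \<Rightarrow> int \<Rightarrow> nat" where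
  "cell ls h rs k = (if k = 0 then h else if k > 0 then nth0 rs (nat k - 1) else nth0 ls (nat (- k) - 1))"

lemma nth0_Nil [simp]: "nth0 [] n = 0"
  by (simp add: nth0_def)

lemma nth0_Cons: "nth0 (x # xs) n = (if n = 0 then x else nth0 xs (n - 1))"
  by (auto simp: nth0_def nth_Cons')

lemma cell_move_head:
  assumes "move_head m ls a rs = (ls', h', rs')"
  shows "cell ls' h' rs' k = cell ls a rs (k + offset m)"
proof (cases m)
  case MoveL
  then show ?thesis
    using assms by (cases ls) (auto simp: cell_def nth0_Cons nat_diff_distrib nat_add_distrib
        intro!: arg_cong[of _ _ "nth0 _"])
next
  case MoveR
  then show ?thesis
    using assms by (cases rs) (auto simp: cell_def nth0_Cons nat_diff_distrib nat_add_distrib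
        intro!: arg_cong[of _ _ "nth0 _"])
next
  case Stay
  then show ?thesis using assms by auto
qed

lemma takeWhile_nth0:
  assumes "0 \<notin> set w" "\<And>k. nth0 xs k = nth0 w k"
  shows "takeWhile (\<lambda>a. a \<noteq> 0) xs = w"
  using assms
proof (induction w arbitrary: xs)
  case Nil
  then show ?case using Nil(2)[of 0] by (cases xs) (auto simp: nth0_Cons)
next
  case (Cons a w)
  have a: "nth0 xs 0 = a" using Cons.prems(2)[of 0] by (simp add: nth0_Cons)
  moreover have "a \<noteq> 0" using Cons.prems(1) by auto
  ultimately obtain xs' where xs: "xs = a # xs'" by (cases xs) (auto simp: nth0_Cons)
  have "nth0 xs' k = nth0 w k" for k using Cons.prems(2)[of "Suc k"] by (simp add: xs nth0_Cons)
  then show ?case using Cons.IH[of xs'] Cons.prems(1) by (auto simp: xs)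
qed

definition main_stack :: "nat list \<Rightarrow> stacks" where
  "main_stack w = (\<lambda>_. [])(0 := w)"

text \<open>A machine state is the index of the residual program in \<open>xs\<close>. The absolute
  position \<open>p\<close> exists only on the side of the abstract tape.\<close>

definition represents ::
    "com list \<Rightarrow> config \<Rightarrow> com \<times> int \<times> tape \<Rightarrow> bool" where
  "represents xs = (\<lambda>(q, ls, h, rs) (c, p, T). q < length xs \<and> xs ! q = c \<and>
     (\<forall>j. valid_sym (T j)) \<and> (\<forall>k. cell ls h rs k = enc_sym (T (p + k))))"

text \<open>States are positions in a list that begins with \<open>c\<close> and
  \<open>SKIP\<close>, which makes 0 the start and 1 the halting state; these two programs must
  differ for the list to be distinct. The time bound is \<open>exec_reach\<close> with
  \<open>M = length w + n\<close>.\<close>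

theorem compile:
  assumes wf: "wfc c" and ne: "c \<noteq> SKIP"
  obtains M where "wf_tm M"
    "\<And>w n w'. exec c (main_stack w) n (main_stack w') \<Longrightarrow> set w \<subseteq> {1,2,3} \<Longrightarrow>
       \<exists>T \<le> n * (2 * (length w + n) + 2). cfg_state (tm_run M T (tm_init w)) = 1 \<and>
         cfg_output (tm_run M T (tm_init w)) = w'"
proof -
  obtain ys where ys: "set ys = residuals c - {c, SKIP}" "distinct ys"
    using finite_distinct_list[of "residuals c - {c, SKIP}"] finite_residuals by auto
  define xs where "xs = c # SKIP # ys"
  have set_xs: "set xs = residuals c"
    using ys self_in_residuals[OF wf] SKIP_in_residuals by (auto simp: xs_def)
  have dist: "distinct xs" using ys ne by (auto simp: xs_def)
  define ix where "ix d = (SOME i. i < length xs \<and> xs ! i = d)" for d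
  have ix: "ix d < length xs" "xs ! ix d = d" if "d \<in> residuals c" for d
    using someI_ex[of "\<lambda>i. i < length xs \<and> xs ! i = d"] that set_xs
    unfolding ix_def in_set_conv_nth[symmetric] by (metis in_set_conv_nth)+
  define M where "M = \<lparr>tm_states = length xs, tm_symbols = 256,
    tm_delta = \<lambda>q a. (case cstep (xs ! q) (dec_sym a) of (d, f, m) \<Rightarrow> (ix d, enc_sym f, m))\<rparr>"
  have closed: "d \<in> residuals c" "valid_sym f"
    if "q < length xs" "cstep (xs ! q) g = (d, f, m)" "valid_sym g" for q g d f m
    using cstep_closed[OF wf _ that(3,2)] that(1) set_xs nth_mem by blast+
  have "wf_tm M"
    unfolding wf_tm_def
  proof (intro conjI allI impI)
    fix q a assume q: "q < tm_states M"
    obtain d f m where st: "cstep (xs ! q) (dec_sym a) = (d, f, m)" by (metis prod_cases3)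
    have "q < length xs" using q by (simp add: M_def)
    from closed[OF this st valid_sym_dec]
    show "fst (tm_delta M q a) < tm_states M" "fst (snd (tm_delta M q a)) < tm_symbols M"
      using st ix enc_sym_less by (auto simp: M_def)
  qed (auto simp: M_def xs_def)
  moreover have step: "represents xs (tm_step M C) (astep X)" if "represents xs C X" for C X
  proof -
    obtain q ls h rs e p T where C: "C = (q, ls, h, rs)" and X: "X = (e, p, T)"
      by (metis prod_cases3 prod_cases4)
    have r: "q < length xs" "xs ! q = e" "\<And>j. valid_sym (T j)"
        "\<And>k. cell ls h rs k = enc_sym (T (p + k))"
      using that by (auto simp: represents_def C X)
    show ?thesis
    proof (cases "q = 1")
      case True
      then have "e = SKIP" using r(2) by (simp add: xs_def)
      then show ?thesis using that True by (simp add: C X)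
    next
      case False
      have h: "dec_sym h = T p" using r(4)[of 0] r(3) dec_enc_sym by (simp add: cell_def)
      obtain d f m where st: "cstep e (T p) = (d, f, m)" by (metis prod_cases3)
      note cl = closed[OF r(1), unfolded r(2), OF st r(3)]
      obtain ls' h' rs' where mh: "move_head m ls (enc_sym f) rs = (ls', h', rs')"
        by (metis prod_cases3)
      have "cell ls' h' rs' k = enc_sym ((T(p := f)) (p + offset m + k))" for k
        unfolding cell_move_head[OF mh] using r(4)[of "k + offset m"]
        by (auto simp: cell_def algebra_simps)
      moreover have "tm_step M C = (ix d, ls', h', rs')"
        using False st mh h r(2) by (simp add: C M_def)
      moreover have "astep X = (d, p + offset m, T(p := f))"
        using st by (simp add: astep_def X)
      ultimately show ?thesis using ix[OF cl(1)] cl(2) r(3) by (auto simp: represents_def)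
    qed
  qed
  moreover have steps: "represents xs (tm_run M k C) ((astep ^^ k) X)" if "represents xs C X" for k C X
    by (induction k) (use that step in \<open>auto simp: tm_run_def\<close>)
  moreover have "\<exists>T \<le> n * (2 * (length w + n) + 2). cfg_state (tm_run M T (tm_init w)) = 1 \<and>
         cfg_output (tm_run M T (tm_init w)) = w'"
    if ex: "exec c (main_stack w) n (main_stack w')" and w: "set w \<subseteq> {1,2,3}" for w n w'
  proof -
    have v: "valid_stacks (main_stack w)" using w by (auto simp: valid_stacks_def main_stack_def)
    have v': "valid_stacks (main_stack w')" using exec_valid[OF ex v] .
    have tape: "enc_sym (tape_of (main_stack u) k) = (if k \<ge> 0 then nth0 u (nat k) else 0)" for u k
      by (auto simp: tape_of_def main_stack_def nth0_def enc_sym_def)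
    obtain ls h rs where i: "tm_init w = (0, ls, h, rs)" and lsh: "ls = []" "h = nth0 w 0"
        "\<And>k. nth0 rs k = nth0 w (Suc k)"
      by (cases w) (auto simp: tm_init_def nth0_Cons)
    have "represents xs (tm_init w) (c, 0, tape_of (main_stack w))"
      using valid_sym_tape_of[OF v] lsh
      by (auto simp: represents_def i tape cell_def) (auto simp: xs_def)
    note run = steps[OF this]
    have "length (main_stack w i) + n \<le> length w + n" for i by (simp add: main_stack_def)
    from exec_reach[OF ex v this]
    obtain k where k: "k \<le> n * (2 * (length w + n) + 2)"
        "(astep ^^ k) (c, 0, tape_of (main_stack w)) = (SKIP, 0, tape_of (main_stack w'))"
      unfolding reach_def by blast
    obtain q ls' h' rs' where f: "tm_run M k (tm_init w) = (q, ls', h', rs')"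
      by (metis prod_cases4)
    have r: "q < length xs" "xs ! q = SKIP" "\<And>k. cell ls' h' rs' k = enc_sym (tape_of (main_stack w') k)"
      using run[of k] by (auto simp: k(2) f represents_def)
    have "q = 1" using r(1,2) dist nth_eq_iff_index_eq[OF dist, of q 1] by (auto simp: xs_def)
    moreover have "takeWhile (\<lambda>a. a \<noteq> 0) (h' # rs') = w'"
    proof (rule takeWhile_nth0)
      show "0 \<notin> set w'" using valid_pos_stacks[OF v'] by (auto simp: pos_stacks_def main_stack_def split: if_splits)
      show "nth0 (h' # rs') k = nth0 w' k" for k
        using r(3)[of "int k"] by (cases k) (auto simp: tape nth0_Cons cell_def nat_add_distrib)
    qed
    ultimately show ?thesis using k(1) f by (intro exI[of _ k]) (auto simp: cfg_state_def cfg_output_def)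
  qed
  ultimately show ?thesis using that by blast
qed

section \<open>Time bounds for stack programs and prefix codes of trees\<close>

definition runs :: "com \<Rightarrow> stacks \<Rightarrow> nat \<Rightarrow> stacks \<Rightarrow> bool" where
  "runs c s b s' \<longleftrightarrow> (\<exists>t\<le>b. exec c s t s')"

lemma runs_mono: "runs c s b s' \<Longrightarrow> b \<le> b' \<Longrightarrow> runs c s b' s'"
  unfolding runs_def using order_trans by blast

lemma runs_eq: "runs c s b s' \<Longrightarrow> b \<le> b' \<Longrightarrow> s' = s'' \<Longrightarrow> runs c s b' s''"
  using runs_mono by simp

lemma runs_SKIP: "runs SKIP s b s"
  unfolding runs_def using exec_SKIP by blast

lemma runs_push: "i < 4 \<Longrightarrow> a \<in> {1,2,3} \<Longrightarrow> runs (Op i a) s 1 (s(i := a # s i))"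
  unfolding runs_def using exec_push by blast

lemma runs_pop: "i < 4 \<Longrightarrow> runs (Op i 5) s 1 (s(i := tl (s i)))"
  unfolding runs_def using exec_pop by blast

lemma runs_Seq: "runs c1 s b1 s1 \<Longrightarrow> runs c2 s1 b2 s2 \<Longrightarrow> runs (Seq c1 c2) s (b1 + b2 + 1) s2"
  unfolding runs_def by (meson add_le_mono exec_Seq le_refl)

lemma runs_IF:
  assumes "P (tops s) \<Longrightarrow> runs c1 s b s'" "\<not> P (tops s) \<Longrightarrow> runs c2 s b s'"
  shows "runs (IF P c1 c2) s (b + 1) s'"
  using assms unfolding runs_def by (metis add_le_mono1 exec_IF1 exec_IF2)

lemma runs_WHILE:
  assumes "P (tops s)" "runs c s n s1" "runs (WHILE P c) s1 m s2"
  shows "runs (WHILE P c) s (n + m + 2) s2"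
  using assms unfolding runs_def by (meson add_le_mono exec_WHILE1 le_refl)

lemma runs_WHILE_end: "\<not> P (tops s) \<Longrightarrow> runs (WHILE P c) s 1 s"
  unfolding runs_def using exec_WHILE2 by blast

lemma runs_length:
  assumes "runs c s b s'"
  shows "length (s' i) \<le> length (s i) + b"
proof -
  obtain t where "t \<le> b" "exec c s t s'" using assms runs_def by auto
  then show ?thesis using exec_length[of c s t s' i] by simp
qed

lemma tops_eq: "tops s i = (case s i of [] \<Rightarrow> 0 | a # _ \<Rightarrow> a)"
  by (simp add: tops_def)

datatype tree = Leaf | Node tree tree

fun code :: "tree \<Rightarrow> nat list" where
  "code Leaf = [1]"
| "code (Node u v) = 2 # code u @ code v"

lemma code_set: "set (code v) \<subseteq> {1,2}"
  by (induction v) auto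

lemma code_prefix_free: "code u @ r = code v @ r' \<longleftrightarrow> u = v \<and> r = r'"
proof -
  have "code u @ r = code v @ r' \<Longrightarrow> u = v \<and> r = r'"
  proof (induction u arbitrary: v r r')
    case Leaf
    then show ?case by (cases v) auto
  next
    case (Node u1 u2)
    show ?case
    proof (cases v)
      case Leaf
      then show ?thesis using Node.prems by auto
    next
      case (Node v1 v2)
      then have "code u1 @ code u2 @ r = code v1 @ code v2 @ r'" using Node.prems by simp
      then have "u1 = v1" "code u2 @ r = code v2 @ r'" using Node.IH(1) by blast+
      then show ?thesis using Node.IH(2) Node by blast
    qed
  qed
  then show ?thesis by auto
qed

lemma code_inj: "code u = code v \<longleftrightarrow> u = v"
  using code_prefix_free[of u "[]" v "[]"] by simp

lemma length_code_pos: "1 \<le> length (code v)"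
  by (cases v) auto

section \<open>Moving trees between stacks\<close>

fun pushes :: "nat list \<Rightarrow> nat \<Rightarrow> com" where
  "pushes [] a = SKIP"
| "pushes (d # ds) a = Seq (Op d a) (pushes ds a)"

definition on_top :: "nat list \<Rightarrow> nat list \<Rightarrow> stacks \<Rightarrow> stacks" where
  "on_top ds w s = (\<lambda>i. if i \<in> set ds then w @ s i else s i)"

lemma runs_pushes:
  assumes "set ds \<subseteq> {1,2}" "distinct ds" "a \<in> {1,2,3}"
  shows "runs (pushes ds a) s (2 * length ds) (on_top ds [a] s)"
  using assms(1,2)
proof (induction ds arbitrary: s)
  case Nil
  then show ?case by (auto simp: on_top_def intro: runs_SKIP)
next
  case (Cons d ds)
  have 1: "runs (Op d a) s 1 (s(d := a # s d))"
    using Cons.prems assms(3) by (intro runs_push) auto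
  have 2: "runs (pushes ds a) (s(d := a # s d)) (2 * length ds) (on_top ds [a] (s(d := a # s d)))"
    using Cons by auto
  show ?case unfolding pushes.simps
    by (rule runs_eq[OF runs_Seq[OF 1 2]]) (use Cons.prems in \<open>auto simp: on_top_def fun_eq_iff\<close>)
qed

lemma wfc_pushes: "set ds \<subseteq> {1,2} \<Longrightarrow> a \<in> {1,2,3} \<Longrightarrow> wfc (pushes ds a)"
  by (induction ds) auto

text \<open>The end of a prefix code is found by counting: a node symbol trades one pending subtree
  for two, a leaf symbol discharges one. Finite control cannot hold this count, so it is kept in
  unary on stack 3.\<close>

definition walk :: "nat list \<Rightarrow> com" where
  "walk ds = WHILE (\<lambda>f. f 3 = 1) (Seq (Op 3 5)
     (IF (\<lambda>f. f 0 = 2)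
        (Seq (Op 0 5) (Seq (pushes ds 2) (Seq (Op 3 1) (Op 3 1))))
        (Seq (Op 0 5) (pushes ds 1))))"

text \<open>Stack 3 holds one symbol for every subtree that still has to be moved.\<close>

lemma runs_walk:
  assumes ds: "set ds \<subseteq> {1,2}" "distinct ds" "length ds \<le> 2"
    and "s 0 = code v @ r" "s 3 = 1 # k"
    and "runs (walk ds) ((on_top ds (rev (code v)) s)(0 := r, 3 := k)) n s'"
  shows "runs (walk ds) s (n + 20 * length (code v)) s'"
  using assms(4-)
proof (induction v arbitrary: s r k n)
  case Leaf
  let ?s1 = "s(3 := k)"
  let ?s2 = "s(3 := k, 0 := r)"
  have 1: "runs (Op 3 5) s 1 ?s1" using runs_pop[of 3 s] Leaf.prems by simp
  have 2: "runs (Op 0 5) ?s1 1 ?s2" using runs_pop[of 0 ?s1] Leaf.prems by simp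
  have 3: "runs (pushes ds 1) ?s2 (2 * length ds) (on_top ds [1] ?s2)"
    by (rule runs_pushes) (use ds in auto)
  have 4: "runs (IF (\<lambda>f. f 0 = 2) (Seq (Op 0 5) (Seq (pushes ds 2) (Seq (Op 3 1) (Op 3 1))))
       (Seq (Op 0 5) (pushes ds 1))) ?s1 (1 + 2 * length ds + 1 + 1) (on_top ds [1] ?s2)"
    by (rule runs_IF) (use runs_Seq[OF 2 3] Leaf.prems in \<open>auto simp: tops_eq\<close>)
  have e: "on_top ds [1] ?s2 = (on_top ds (rev (code Leaf)) s)(0 := r, 3 := k)"
    using ds(1) by (auto simp: on_top_def fun_eq_iff)
  have w: "runs (walk ds) (on_top ds [1] ?s2) n s'" using Leaf.prems(3) by (simp only: e)
  have 5: "runs (walk ds) s (1 + (1 + 2 * length ds + 1 + 1) + 1 + n + 2) s'"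
    unfolding walk_def
    by (rule runs_WHILE[OF _ runs_Seq[OF 1 4]])
      (use Leaf.prems w in \<open>auto simp: tops_eq walk_def\<close>)
  show ?case by (rule runs_mono[OF 5]) (use ds(3) in simp)
next
  case (Node u v)
  let ?s1 = "s(3 := k)"
  let ?s2 = "s(3 := k, 0 := code u @ code v @ r)"
  let ?s3 = "on_top ds [2] ?s2"
  let ?s4 = "?s3(3 := 1 # k)"
  let ?s5 = "?s3(3 := 1 # 1 # k)"
  have s33: "?s3 3 = k" using ds by (auto simp: on_top_def)
  have 1: "runs (Op 3 5) s 1 ?s1" using runs_pop[of 3 s] Node.prems by simp
  have 2: "runs (Op 0 5) ?s1 1 ?s2" using runs_pop[of 0 ?s1] Node.prems by simp
  have 3: "runs (pushes ds 2) ?s2 (2 * length ds) ?s3"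
    by (rule runs_pushes) (use ds in auto)
  have 4: "runs (Op 3 1) ?s3 1 ?s4" using runs_push[of 3 1 ?s3] s33 by simp
  have 5: "runs (Op 3 1) ?s4 1 ?s5" using runs_push[of 3 1 ?s4] by simp
  note 6 = runs_Seq[OF 2 runs_Seq[OF 3 runs_Seq[OF 4 5]]]
  have 7: "runs (IF (\<lambda>f. f 0 = 2) (Seq (Op 0 5) (Seq (pushes ds 2) (Seq (Op 3 1) (Op 3 1))))
       (Seq (Op 0 5) (pushes ds 1))) ?s1 (1 + (2 * length ds + (1 + 1 + 1) + 1) + 1 + 1) ?s5"
    by (rule runs_IF) (use 6 Node.prems in \<open>auto simp: tops_eq\<close>)
  let ?s6 = "(on_top ds (rev (code u)) ?s5)(0 := code v @ r, 3 := 1 # k)"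
  have e: "(on_top ds (rev (code v)) ?s6)(0 := r, 3 := k) =
      (on_top ds (rev (code (Node u v))) s)(0 := r, 3 := k)"
    using ds(1) by (auto simp: on_top_def fun_eq_iff)
  have w: "runs (walk ds) ((on_top ds (rev (code v)) ?s6)(0 := r, 3 := k)) n s'"
    using Node.prems(3) by (simp only: e)
  \<comment> \<open>The lemma is phrased with a continuation because both subtrees are consumed by
    one and the same loop: the run for \<open>v\<close> serves as the continuation of the run for
    \<open>u\<close>.\<close>
  have 8: "runs (walk ds) ?s6 (n + 20 * length (code v)) s'"
    by (rule Node.IH(2)[OF _ _ w]) simp_all
  have 9: "runs (walk ds) ?s5 (n + 20 * length (code v) + 20 * length (code u)) s'"
    by (rule Node.IH(1)[OF _ _ 8]) (use ds in \<open>auto simp: on_top_def\<close>)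
  have 10: "runs (walk ds) s (1 + (1 + (2 * length ds + (1 + 1 + 1) + 1) + 1 + 1) + 1 +
      (n + 20 * length (code v) + 20 * length (code u)) + 2) s'"
    unfolding walk_def
    by (rule runs_WHILE[OF _ runs_Seq[OF 1 7]])
      (use Node.prems 9 in \<open>simp_all add: tops_eq walk_def\<close>)
  show ?case by (rule runs_mono[OF 10]) (use ds(3) in simp)
qed

text \<open>The 3 pushed on each target marks where the moved code will end, since codes use only 1
  and 2. The 2 on stack 3 lies under the counter and stops \<open>walk\<close> whatever is stored
  below.\<close>

definition moveto :: "nat list \<Rightarrow> com" where
  "moveto ds = Seq (pushes ds 3) (Seq (Op 3 2) (Seq (Op 3 1) (Seq (walk ds) (Op 3 5))))"

lemma wfc_moveto: "set ds \<subseteq> {1,2} \<Longrightarrow> wfc (moveto ds)"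
  by (simp add: moveto_def walk_def wfc_pushes)

lemma runs_moveto:
  assumes ds: "set ds \<subseteq> {1,2}" "distinct ds" "length ds \<le> 2" and s: "s 0 = code v @ r"
  shows "runs (moveto ds) s (40 * length (code v))
    ((on_top ds (rev (code v) @ [3]) s)(0 := r))"
proof -
  let ?s1 = "on_top ds [3] s"
  let ?s2 = "?s1(3 := 2 # s 3)"
  let ?s3 = "?s1(3 := 1 # 2 # s 3)"
  let ?s4 = "(on_top ds (rev (code v)) ?s3)(0 := r, 3 := 2 # s 3)"
  have s13: "?s1 3 = s 3" using ds by (auto simp: on_top_def)
  have 1: "runs (pushes ds 3) s (2 * length ds) ?s1"
    by (rule runs_pushes) (use ds in auto)
  have 2: "runs (Op 3 2) ?s1 1 ?s2" using runs_push[of 3 2 ?s1] s13 by simp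
  have 3: "runs (Op 3 1) ?s2 1 ?s3" using runs_push[of 3 1 ?s2] by simp
  have 4: "runs (walk ds) ?s4 1 ?s4"
    unfolding walk_def by (rule runs_WHILE_end) (simp add: tops_eq)
  have 5: "runs (walk ds) ?s3 (1 + 20 * length (code v)) ?s4"
    by (rule runs_walk[OF ds _ _ 4]) (use ds s in \<open>auto simp: on_top_def\<close>)
  have 6: "runs (Op 3 5) ?s4 1 (?s4(3 := s 3))" using runs_pop[of 3 ?s4] by simp
  show ?thesis unfolding moveto_def
    by (rule runs_eq[OF runs_Seq[OF 1 runs_Seq[OF 2 runs_Seq[OF 3 runs_Seq[OF 5 6]]]]])
      (use ds length_code_pos[of v] in \<open>auto simp: on_top_def fun_eq_iff\<close>)
qed

text \<open>Undoes the reversal caused by \<open>moveto\<close>; the loop runs down to the marker 3,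
  which is then removed.\<close>

definition unstack :: "nat \<Rightarrow> com" where
  "unstack d = Seq (WHILE (\<lambda>f. f d \<noteq> 3) (Seq (IF (\<lambda>f. f d = 1) (Op 0 1) (Op 0 2)) (Op d 5))) (Op d 5)"

lemma wfc_unstack: "d < 4 \<Longrightarrow> wfc (unstack d)"
  by (simp add: unstack_def)

lemma runs_unstack:
  assumes "s d = w @ 3 # r" "set w \<subseteq> {1,2}" "d < 4" "d \<noteq> 0"
  shows "runs (unstack d) s (10 * length w + 3) (s(0 := rev w @ s 0, d := r))"
proof -
  have "runs (WHILE (\<lambda>f. f d \<noteq> 3) (Seq (IF (\<lambda>f. f d = 1) (Op 0 1) (Op 0 2)) (Op d 5))) s
      (10 * length w + 1) (s(0 := rev w @ s 0, d := 3 # r))"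
    using assms
  proof (induction w arbitrary: s)
    case Nil
    then show ?case
      by (intro runs_eq[OF runs_WHILE_end]) (auto simp: tops_eq)
  next
    case (Cons a w)
    let ?s1 = "s(0 := a # s 0)"
    let ?s2 = "?s1(d := w @ 3 # r)"
    have a: "a = 1 \<or> a = 2" using Cons.prems by auto
    have 1: "runs (IF (\<lambda>f. f d = 1) (Op 0 1) (Op 0 2)) s (1 + 1) ?s1"
      by (rule runs_IF)
        (use a Cons.prems runs_push[of 0 1 s] runs_push[of 0 2 s] in \<open>auto simp: tops_eq\<close>)
    have 2: "runs (Op d 5) ?s1 1 ?s2" using runs_pop[of d ?s1] Cons.prems by simp
    have 3: "runs (WHILE (\<lambda>f. f d \<noteq> 3) (Seq (IF (\<lambda>f. f d = 1) (Op 0 1) (Op 0 2)) (Op d 5))) ?s2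
      (10 * length w + 1) (?s2(0 := rev w @ ?s2 0, d := 3 # r))"
      by (rule Cons.IH) (use Cons.prems in auto)
    show ?case
      by (rule runs_eq[OF runs_WHILE[OF _ runs_Seq[OF 1 2] 3]])
        (use Cons.prems a in \<open>auto simp: tops_eq fun_eq_iff\<close>)
  qed
  from runs_Seq[OF this runs_pop[OF \<open>d < 4\<close>]] show ?thesis
    unfolding unstack_def by (rule runs_eq) auto
qed

text \<open>Copying is possible because \<open>moveto\<close> writes each symbol to both targets in
  a single pass.\<close>

definition DUP :: com where
  "DUP = Seq (moveto [1,2]) (Seq (unstack 1) (unstack 2))"

definition SWAP :: com where
  "SWAP = Seq (moveto [1]) (Seq (moveto [2]) (Seq (unstack 1) (unstack 2)))"

definition DROP :: com where
  "DROP = moveto []"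

lemma wfc_DUP [simp]: "wfc DUP" and wfc_SWAP [simp]: "wfc SWAP" and wfc_DROP [simp]: "wfc DROP"
  by (simp_all add: DUP_def SWAP_def DROP_def wfc_moveto wfc_unstack)

lemma runs_DUP:
  assumes "s 0 = code v @ r"
  shows "runs DUP s (70 * length (code v)) (s(0 := code v @ code v @ r))"
proof -
  let ?w = "rev (code v)"
  let ?s1 = "(on_top [1,2] (?w @ [3]) s)(0 := r)"
  let ?s2 = "?s1(0 := code v @ r, 1 := s 1)"
  have w: "set ?w \<subseteq> {1,2}" using code_set by simp
  have 1: "runs (moveto [1,2]) s (40 * length (code v)) ?s1"
    by (rule runs_moveto) (use assms in auto)
  have 2: "runs (unstack 1) ?s1 (10 * length ?w + 3) ?s2"
    using runs_unstack[OF _ w, of ?s1 1 "s 1"] by (simp add: on_top_def)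
  have 3: "runs (unstack 2) ?s2 (10 * length ?w + 3) (?s2(0 := code v @ code v @ r, 2 := s 2))"
    using runs_unstack[OF _ w, of ?s2 2 "s 2"] by (simp add: on_top_def)
  show ?thesis unfolding DUP_def
    by (rule runs_eq[OF runs_Seq[OF 1 runs_Seq[OF 2 3]]])
      (use length_code_pos[of v] in \<open>auto simp: on_top_def fun_eq_iff\<close>)
qed

lemma runs_DROP:
  assumes "s 0 = code v @ r"
  shows "runs DROP s (40 * length (code v)) (s(0 := r))"
  using runs_moveto[of "[]" s v r] assms by (simp add: DROP_def on_top_def)

lemma runs_SWAP:
  assumes "s 0 = code u @ code v @ r"
  shows "runs SWAP s (60 * (length (code u) + length (code v))) (s(0 := code v @ code u @ r))"
proof -
  let ?w = "rev (code u)"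
  let ?z = "rev (code v)"
  let ?s1 = "(on_top [1] (?w @ [3]) s)(0 := code v @ r)"
  let ?s2 = "(on_top [2] (?z @ [3]) ?s1)(0 := r)"
  let ?s3 = "?s2(0 := code u @ r, 1 := s 1)"
  have w: "set ?w \<subseteq> {1,2}" and z: "set ?z \<subseteq> {1,2}" using code_set by simp_all
  have 1: "runs (moveto [1]) s (40 * length (code u)) ?s1"
    by (rule runs_moveto) (use assms in auto)
  have 2: "runs (moveto [2]) ?s1 (40 * length (code v)) ?s2"
    by (rule runs_moveto) (use assms in auto)
  have 3: "runs (unstack 1) ?s2 (10 * length ?w + 3) ?s3"
    using runs_unstack[OF _ w, of ?s2 1 "s 1"] by (simp add: on_top_def)
  have 4: "runs (unstack 2) ?s3 (10 * length ?z + 3) (?s3(0 := code v @ code u @ r, 2 := s 2))"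
    using runs_unstack[OF _ z, of ?s3 2 "s 2"] by (simp add: on_top_def)
  show ?thesis unfolding SWAP_def
    by (rule runs_eq[OF runs_Seq[OF 1 runs_Seq[OF 2 runs_Seq[OF 3 4]]]])
      (use length_code_pos[of v] length_code_pos[of u] in \<open>auto simp: on_top_def fun_eq_iff\<close>)
qed

section \<open>Encodable types and polynomial-time functions\<close>

text \<open>Injectivity is what allows equality of values to be decided by comparing codes, in
  \<open>polytime_eq\<close>.\<close>

class encodable =
  fixes to_tree :: "'a \<Rightarrow> tree"
  assumes to_tree_inj: "to_tree x = to_tree y \<Longrightarrow> x = y"

instantiation unit :: encodable
begin
definition to_tree_unit :: "unit \<Rightarrow> tree" where "to_tree_unit _ = Leaf"
instance by standard auto
end

instantiation bool :: encodable
begin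
definition to_tree_bool :: "bool \<Rightarrow> tree" where
  "to_tree_bool b = (if b then Node Leaf Leaf else Leaf)"
instance by standard (auto simp: to_tree_bool_def split: if_splits)
end

text \<open>Unary, and chosen so that \<open>n\<close>, the list of \<open>n\<close> units and, for
  successors, the pair of a unit and the predecessor share one tree. Conversions between them then
  cost nothing.\<close>

instantiation nat :: encodable
begin
primrec to_tree_nat :: "nat \<Rightarrow> tree" where
  "to_tree_nat 0 = Leaf"
| "to_tree_nat (Suc n) = Node Leaf (to_tree_nat n)"
instance
proof
  fix x y :: nat
  show "to_tree x = to_tree y \<Longrightarrow> x = y"
  proof (induction x arbitrary: y)
    case 0
    then show ?case by (cases y) auto
  next
    case (Suc x)
    then show ?case by (cases y) auto
  qed
qed
end

instantiation list :: (encodable) encodable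
begin
primrec to_tree_list :: "'a list \<Rightarrow> tree" where
  "to_tree_list [] = Leaf"
| "to_tree_list (x # xs) = Node (to_tree x) (to_tree_list xs)"
instance
proof
  fix x y :: "'a list"
  show "to_tree x = to_tree y \<Longrightarrow> x = y"
  proof (induction x arbitrary: y)
    case Nil
    then show ?case by (cases y) auto
  next
    case (Cons a x)
    then show ?case by (cases y) (auto dest: to_tree_inj)
  qed
qed
end

instantiation prod :: (encodable, encodable) encodable
begin
definition to_tree_prod :: "'a \<times> 'b \<Rightarrow> tree" where
  "to_tree_prod p = Node (to_tree (fst p)) (to_tree (snd p))"
instance by standard (auto simp: to_tree_prod_def prod_eq_iff dest: to_tree_inj)
end

definition encode :: "'a::encodable \<Rightarrow> nat list" where
  "encode x = code (to_tree x)"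

definition sz :: "'a::encodable \<Rightarrow> nat" where
  "sz x = length (encode x)"

lemma length_code_to_tree [simp]: "length (code (to_tree x)) = sz x"
  by (simp add: sz_def encode_def)

lemma sz_pos: "1 \<le> sz x"
  unfolding sz_def encode_def by (rule length_code_pos)

lemma encode_simps [simp]:
  "encode (x, y) = 2 # encode x @ encode y"
  "encode ([] :: 'a::encodable list) = [1]"
  "encode (a # xs) = 2 # encode a @ encode xs"
  "encode (0::nat) = [1]"
  "encode (Suc n) = 2 # 1 # encode n"
  "encode () = [1]"
  "encode True = [2,1,1]"
  "encode False = [1]"
  by (simp_all add: encode_def to_tree_prod_def to_tree_unit_def to_tree_bool_def)

lemma sz_simps [simp]:
  "sz (x, y) = Suc (sz x + sz y)"
  "sz ([] :: 'a::encodable list) = 1"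
  "sz (a # xs) = Suc (sz a + sz xs)"
  "sz (n::nat) = 2 * n + 1"
  "sz () = 1"
  by (induction n) (simp_all add: sz_def)

lemma encode_inj: "encode x = encode y \<longleftrightarrow> x = y"
  by (auto simp: encode_def code_inj dest: to_tree_inj)

section \<open>Polynomial bounds and closure properties of polynomial time\<close>

definition polybounded :: "('a::encodable \<Rightarrow> nat) \<Rightarrow> bool" where
  "polybounded h \<longleftrightarrow> (\<exists>c d. \<forall>x. h x \<le> c * sz x ^ d)"

lemma polybounded_mono: "polybounded h \<Longrightarrow> (\<And>x. g x \<le> h x) \<Longrightarrow> polybounded g"
  unfolding polybounded_def using order_trans by blast

lemma polybounded_const: "polybounded (\<lambda>x. k)"
  unfolding polybounded_def by (rule exI[of _ k], rule exI[of _ 0]) simp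

lemma polybounded_sz: "polybounded (\<lambda>x. sz x)"
  unfolding polybounded_def by (rule exI[of _ 1], rule exI[of _ 1]) simp

text \<open>Every size is at least 1, so both monomials can be raised to the common exponent
  \<open>d + d'\<close>.\<close>

lemma polybounded_add:
  assumes "polybounded g" "polybounded h"
  shows "polybounded (\<lambda>x. g x + h x)"
proof -
  obtain c d c' d' where g: "\<And>x. g x \<le> c * sz x ^ d" and h: "\<And>x. h x \<le> c' * sz x ^ d'"
    using assms unfolding polybounded_def by blast
  have "g x + h x \<le> (c + c') * sz x ^ (d + d')" for x
  proof -
    have "c * sz x ^ d \<le> c * sz x ^ (d + d')" "c' * sz x ^ d' \<le> c' * sz x ^ (d + d')"
      using sz_pos[of x] by (intro mult_le_mono2 power_increasing; simp)+
    then show ?thesis using g[of x] h[of x] unfolding add_mult_distrib by linarith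
  qed
  then show ?thesis unfolding polybounded_def by blast
qed

lemma polybounded_mult:
  assumes "polybounded g" "polybounded h"
  shows "polybounded (\<lambda>x. g x * h x)"
proof -
  obtain c d c' d' where g: "\<And>x. g x \<le> c * sz x ^ d" and h: "\<And>x. h x \<le> c' * sz x ^ d'"
    using assms unfolding polybounded_def by blast
  have "g x * h x \<le> (c * c') * sz x ^ (d + d')" for x
    using mult_le_mono[OF g[of x] h[of x]] by (simp add: power_add mult_ac)
  then show ?thesis unfolding polybounded_def by blast
qed

lemma polybounded_power: "polybounded g \<Longrightarrow> polybounded (\<lambda>x. g x ^ d)"
  by (induction d) (auto intro: polybounded_const polybounded_mult)

lemma polybounded_Suc: "polybounded g \<Longrightarrow> polybounded (\<lambda>x. Suc (g x))"
  using polybounded_add[OF _ polybounded_const[of 1]] by simp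

lemma polybounded_comp:
  assumes "polybounded h" "polybounded (\<lambda>x. sz (f x))"
  shows "polybounded (\<lambda>x. h (f x))"
proof -
  obtain c d where h: "\<And>x. h x \<le> c * sz x ^ d" using assms(1) unfolding polybounded_def by blast
  have "polybounded (\<lambda>x. c * sz (f x) ^ d)" by (intro polybounded_mult polybounded_const polybounded_power assms(2))
  then show ?thesis using h by (rule polybounded_mono)
qed

lemmas polybounded_intros = polybounded_const polybounded_sz polybounded_add polybounded_mult polybounded_Suc polybounded_power

definition computes :: "com \<Rightarrow> ('a::encodable \<Rightarrow> nat) \<Rightarrow> ('a \<Rightarrow> 'b::encodable) \<Rightarrow> bool" where
  "computes P h f \<longleftrightarrow> (\<forall>x s r. s 0 = encode x @ r \<longrightarrow> runs P s (h x) (s(0 := encode (f x) @ r)))"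

definition polytime :: "('a::encodable \<Rightarrow> 'b::encodable) \<Rightarrow> bool" where
  "polytime f \<longleftrightarrow> (\<exists>P h. wfc P \<and> polybounded h \<and> computes P h f)"

lemma ptI:
  assumes "wfc P" "polybounded h" "\<And>x s r. s 0 = encode x @ r \<Longrightarrow> runs P s (h x) (s(0 := encode (f x) @ r))"
  shows "polytime f"
  using assms unfolding polytime_def computes_def by blast

lemma computesD:
  "computes P h f \<Longrightarrow> s 0 = encode x @ r \<Longrightarrow> runs P s (h x) (s(0 := encode (f x) @ r))"
  unfolding computes_def by blast

lemma ptE:
  assumes "polytime f"
  obtains P h where "wfc P" "polybounded h" "computes P h f"
  using assms unfolding polytime_def by blast

named_theorems polytime_intros

text \<open>Time bounds output size: a run of cost \<open>h x\<close> lengthens stack 0 by at most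
  \<open>h x\<close>.\<close>

lemma polytime_size: "polytime f \<Longrightarrow> polybounded (\<lambda>x. sz (f x))"
proof -
  assume "polytime f"
  then obtain P h where P: "polybounded h" "computes P h f"
    unfolding polytime_def by blast
  have "sz (f x) \<le> sz x + h x" for x
    using runs_length[OF computesD[OF P(2), of "\<lambda>_. encode x" x "[]"], of 0] by (simp add: sz_def)
  with polybounded_add[OF polybounded_sz P(1)] show ?thesis by (rule polybounded_mono)
qed

lemma polybounded_sz_comp: "polybounded h \<Longrightarrow> polytime f \<Longrightarrow> polybounded (\<lambda>x. h (f x))"
  by (rule polybounded_comp[OF _ polytime_size])

text \<open>A function that only changes the type of its argument is computed by
  \<open>SKIP\<close>. This yields \<open>Cons\<close>, \<open>Suc\<close> and the passage between
  numbers and unit lists.\<close>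

lemma polytime_same_tree:
  fixes f :: "'a::encodable \<Rightarrow> 'b::encodable"
  assumes "\<And>x. to_tree (f x) = to_tree x"
  shows "polytime f"
proof (rule ptI[of SKIP "\<lambda>_. 0"])
  fix x :: 'a and s r assume "s (0::nat) = encode x @ r"
  then show "runs SKIP s 0 (s(0 := encode (f x) @ r))"
    by (intro runs_eq[OF runs_SKIP]) (auto simp: encode_def fun_eq_iff assms)
qed (auto intro: polybounded_const)

lemma polytime_id: "polytime (\<lambda>x. x)"
  by (rule polytime_same_tree) simp

lemma polytime_comp:
  fixes f :: "'a::encodable \<Rightarrow> 'b::encodable"
  assumes "polytime g" "polytime f"
  shows "polytime (\<lambda>x. g (f x))"
proof -
  obtain P h where P: "wfc P" "polybounded h"
    "computes P h f"
    by (rule ptE[OF \<open>polytime f\<close>])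
  obtain Q k where Q: "wfc Q" "polybounded k"
    "computes Q k g"
    by (rule ptE[OF \<open>polytime g\<close>])
  show ?thesis
  proof (rule ptI[of "Seq P Q" "\<lambda>x. h x + k (f x) + 1"])
    show "polybounded (\<lambda>x. h x + k (f x) + 1)" by (intro polybounded_intros P polybounded_sz_comp[OF Q(2) \<open>polytime f\<close>])
    fix x :: 'a and s r assume s: "s (0::nat) = encode x @ r"
    from runs_Seq[OF computesD[OF P(3), of s x r, OF s] computesD[OF Q(3), of _ "f x" r]]
    show "runs (Seq P Q) s (h x + k (f x) + 1) (s(0 := encode (g (f x)) @ r))" by simp
  qed (use P Q in auto)
qed

lemma polytime_pair [polytime_intros]:
  fixes f :: "'a::encodable \<Rightarrow> 'b::encodable"
  assumes "polytime f" "polytime g"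
  shows "polytime (\<lambda>x. (f x, g x))"
proof -
  obtain P h where P: "wfc P" "polybounded h"
    "computes P h f"
    by (rule ptE[OF \<open>polytime f\<close>])
  obtain Q k where Q: "wfc Q" "polybounded k"
    "computes Q k g"
    by (rule ptE[OF \<open>polytime g\<close>])
  let ?b = "\<lambda>x. 70 * sz x + (k x + (60 * (sz (g x) + sz x) + (h x + 1 + 1) + 1) + 1) + 1"
  \<comment> \<open>The second component is computed first, so that after the swap the code of
    \<open>f x\<close> ends up on top; the node symbol 2 then completes the pair.\<close>
  show ?thesis
  proof (rule ptI[of "Seq DUP (Seq Q (Seq SWAP (Seq P (Op 0 2))))" ?b])
    show "polybounded ?b" by (intro polybounded_intros P Q polytime_size assms)
    fix x :: 'a and s r assume s: "s (0::nat) = encode x @ r"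
    let ?s1 = "s(0 := encode x @ encode x @ r)"
    let ?s2 = "s(0 := encode (g x) @ encode x @ r)"
    let ?s3 = "s(0 := encode x @ encode (g x) @ r)"
    let ?s4 = "s(0 := encode (f x) @ encode (g x) @ r)"
    have 1: "runs DUP s (70 * sz x) ?s1"
      using runs_DUP[of s "to_tree x" r] s by (simp add: encode_def)
    have 2: "runs Q ?s1 (k x) ?s2" using computesD[OF Q(3), of ?s1 x "encode x @ r"] by simp
    have 3: "runs SWAP ?s2 (60 * (sz (g x) + sz x)) ?s3"
      using runs_SWAP[of ?s2 "to_tree (g x)" "to_tree x" r] by (simp add: encode_def)
    have 4: "runs P ?s3 (h x) ?s4" using computesD[OF P(3), of ?s3 x "encode (g x) @ r"] by simp
    have 5: "runs (Op 0 2) ?s4 1 (s(0 := encode (f x, g x) @ r))" using runs_push[of 0 2 ?s4] by simp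
    show "runs (Seq DUP (Seq Q (Seq SWAP (Seq P (Op 0 2))))) s (?b x) (s(0 := encode (f x, g x) @ r))"
      by (rule runs_Seq[OF 1 runs_Seq[OF 2 runs_Seq[OF 3 runs_Seq[OF 4 5]]]])
  qed (use P Q in auto)
qed

lemma polytime_fst_snd:
  "polytime (fst :: 'a::encodable \<times> 'b::encodable \<Rightarrow> 'a)" "polytime (snd :: 'a \<times> 'b \<Rightarrow> 'b)"
proof -
  let ?b = "\<lambda>p::'a \<times> 'b. 1 + (60 * (sz (fst p) + sz (snd p)) + 40 * sz (snd p) + 1) + 1"
  have le: "?b p \<le> 200 * sz p" for p using sz_pos[of p] by (cases p) auto
  show "polytime (fst :: 'a \<times> 'b \<Rightarrow> 'a)"
  proof (rule ptI[of "Seq (Op 0 5) (Seq SWAP DROP)" "\<lambda>p. 200 * sz p"])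
    fix p :: "'a \<times> 'b" and s r assume s: "s (0::nat) = encode p @ r"
    obtain x y where p: "p = (x, y)" by (cases p)
    let ?s1 = "s(0 := encode x @ encode y @ r)"
    let ?s2 = "s(0 := encode y @ encode x @ r)"
    have 1: "runs (Op 0 5) s 1 ?s1" using runs_pop[of 0 s] s by (simp add: p)
    have 2: "runs SWAP ?s1 (60 * (sz x + sz y)) ?s2"
      using runs_SWAP[of ?s1 "to_tree x" "to_tree y" r] by (simp add: encode_def)
    have 3: "runs DROP ?s2 (40 * sz y) (s(0 := encode (fst p) @ r))"
      using runs_DROP[of ?s2 "to_tree y"] by (simp add: encode_def p)
    show "runs (Seq (Op 0 5) (Seq SWAP DROP)) s (200 * sz p) (s(0 := encode (fst p) @ r))"
      by (rule runs_mono[OF runs_Seq[OF 1 runs_Seq[OF 2 3]]]) (use le[of p] p in simp)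
  qed (auto intro!: polybounded_intros)
  show "polytime (snd :: 'a \<times> 'b \<Rightarrow> 'b)"
  proof (rule ptI[of "Seq (Op 0 5) DROP" "\<lambda>p. 200 * sz p"])
    fix p :: "'a \<times> 'b" and s r assume s: "s (0::nat) = encode p @ r"
    obtain x y where p: "p = (x, y)" by (cases p)
    let ?s1 = "s(0 := encode x @ encode y @ r)"
    have 1: "runs (Op 0 5) s 1 ?s1" using runs_pop[of 0 s] s by (simp add: p)
    have 2: "runs DROP ?s1 (40 * sz x) (s(0 := encode (snd p) @ r))"
      using runs_DROP[of ?s1 "to_tree x"] by (simp add: encode_def p)
    show "runs (Seq (Op 0 5) DROP) s (200 * sz p) (s(0 := encode (snd p) @ r))"
      by (rule runs_mono[OF runs_Seq[OF 1 2]]) (use p sz_pos[of y] in simp)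
  qed (auto intro!: polybounded_intros)
qed

lemma polytime_fst [polytime_intros]: "polytime f \<Longrightarrow> polytime (\<lambda>x. fst (f x))"
  and polytime_snd [polytime_intros]: "polytime g \<Longrightarrow> polytime (\<lambda>x. snd (g x))"
  by (rule polytime_comp[OF polytime_fst_snd(1)], simp) (rule polytime_comp[OF polytime_fst_snd(2)], simp)

fun pushes_list :: "nat list \<Rightarrow> com" where
  "pushes_list [] = SKIP"
| "pushes_list (a # w) = Seq (pushes_list w) (Op 0 a)"

lemma runs_pushes_list:
  "set w \<subseteq> {1,2} \<Longrightarrow> runs (pushes_list w) s (2 * length w) (s(0 := w @ s 0))"
proof (induction w)
  case Nil
  show ?case by (simp add: runs_SKIP)
next
  case (Cons a w)
  have 1: "runs (pushes_list w) s (2 * length w) (s(0 := w @ s 0))"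
    by (rule Cons.IH) (use Cons.prems in simp)
  have 2: "runs (Op 0 a) (s(0 := w @ s 0)) 1 (s(0 := (a # w) @ s 0))"
    using runs_push[of 0 a "s(0 := w @ s 0)"] Cons.prems by auto
  show ?case unfolding pushes_list.simps by (rule runs_mono[OF runs_Seq[OF 1 2]]) simp
qed

lemma wfc_pushes_list: "set w \<subseteq> {1,2} \<Longrightarrow> wfc (pushes_list w)"
  by (induction w) auto

lemma polytime_const [polytime_intros]: "polytime (\<lambda>x :: 'a::encodable. c :: 'b::encodable)"
proof (rule ptI[of "Seq DROP (pushes_list (encode c))" "\<lambda>x. 40 * sz x + 2 * sz c + 1"])
  have c: "set (encode c) \<subseteq> {1,2}" unfolding encode_def by (rule code_set)
  then show "wfc (Seq DROP (pushes_list (encode c)))" by (simp add: wfc_pushes_list)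
  show "polybounded (\<lambda>x. 40 * sz x + 2 * sz c + 1)" by (intro polybounded_intros)
  fix x :: 'a and s r assume s: "s (0::nat) = encode x @ r"
  have 1: "runs DROP s (40 * sz x) (s(0 := r))"
    using runs_DROP[of s "to_tree x" r] s by (simp add: encode_def)
  show "runs (Seq DROP (pushes_list (encode c))) s (40 * sz x + 2 * sz c + 1) (s(0 := encode c @ r))"
    using runs_Seq[OF 1 runs_pushes_list[OF c]] by (simp add: sz_def)
qed

lemma polytime_if [polytime_intros]:
  fixes f :: "'a::encodable \<Rightarrow> 'b::encodable"
  assumes "polytime b" "polytime f" "polytime g"
  shows "polytime (\<lambda>x. if b x then f x else g x)"
proof -
  obtain P h where P: "wfc P" "polybounded h"
    "computes P h f"
    by (rule ptE[OF \<open>polytime f\<close>])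
  obtain Q k where Q: "wfc Q" "polybounded k"
    "computes Q k g"
    by (rule ptE[OF \<open>polytime g\<close>])
  obtain B l where B: "wfc B" "polybounded l"
    "computes B l b"
    by (rule ptE[OF \<open>polytime b\<close>])
  let ?b = "\<lambda>x. 70 * sz x + (l x + (200 + (h x + k x) + 1 + 1) + 1) + 1"
  \<comment> \<open>The codes of \<open>True\<close> and \<open>False\<close> start with 2 and 1, so
    the top symbol decides; both branches first drop the truth value.\<close>
  let ?prog = "Seq DUP (Seq B (IF (\<lambda>f. f 0 = 2) (Seq DROP P) (Seq DROP Q)))"
  show ?thesis
  proof (rule ptI[of ?prog ?b])
    show "polybounded ?b" by (intro polybounded_intros P Q B)
    fix x :: 'a and s r assume s: "s (0::nat) = encode x @ r"
    let ?s1 = "s(0 := encode x @ encode x @ r)"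
    let ?s2 = "s(0 := encode (b x) @ encode x @ r)"
    let ?s3 = "s(0 := encode x @ r)"
    have 1: "runs DUP s (70 * sz x) ?s1"
      using runs_DUP[of s "to_tree x" r] s by (simp add: encode_def)
    have 2: "runs B ?s1 (l x) ?s2" using computesD[OF B(3), of ?s1 x "encode x @ r"] by simp
    have "40 * sz (b x) \<le> 200" by (cases "b x") (auto simp: sz_def)
    then have 3: "runs DROP ?s2 200 ?s3"
      using runs_mono[OF runs_DROP[of ?s2 "to_tree (b x)" "encode x @ r"]] by (simp add: encode_def)
    have 4: "runs P ?s3 (h x + k x) (s(0 := encode (f x) @ r))"
      using runs_mono[OF computesD[OF P(3), of ?s3 x r]] by simp
    have 5: "runs Q ?s3 (h x + k x) (s(0 := encode (g x) @ r))"
      using runs_mono[OF computesD[OF Q(3), of ?s3 x r]] by simp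
    have 6: "runs (IF (\<lambda>f. f 0 = 2) (Seq DROP P) (Seq DROP Q)) ?s2 (200 + (h x + k x) + 1 + 1)
        (s(0 := encode (if b x then f x else g x) @ r))"
      by (rule runs_IF)
        (use runs_Seq[OF 3 4] runs_Seq[OF 3 5] in \<open>auto simp: tops_eq split: if_splits\<close>)
    show "runs ?prog s (?b x) (s(0 := encode (if b x then f x else g x) @ r))"
      by (rule runs_Seq[OF 1 runs_Seq[OF 2 6]])
  qed (use P Q B in auto)
qed

lemma polytime_tl [polytime_intros]: "polytime f \<Longrightarrow> polytime (\<lambda>x. tl (f x :: 'b::encodable list))"
proof -
  have "polytime (tl :: 'b list \<Rightarrow> _)"
  proof (rule ptI[of "IF (\<lambda>f. f 0 = 2) (Seq (Op 0 5) DROP) SKIP" "\<lambda>x. 50 * sz x"])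
    fix xs :: "'b list" and s r assume s: "s (0::nat) = encode xs @ r"
    \<comment> \<open>\<open>hd []\<close> is an unspecified value of unknown size, so the factor 0
      removes its contribution for the empty list.\<close>
    have "runs (IF (\<lambda>f. f 0 = 2) (Seq (Op 0 5) DROP) SKIP) s (1 + 40 * sz (hd xs) * (if xs = [] then 0 else 1) + 1 + 1) (s(0 := encode (tl xs) @ r))"
    proof (rule runs_IF)
      assume "tops s 0 = 2"
      then obtain x ys where xs: "xs = x # ys" using s by (cases xs) (auto simp: tops_eq)
      let ?s1 = "s(0 := encode x @ encode ys @ r)"
      have 1: "runs (Op 0 5) s 1 ?s1" using runs_pop[of 0 s] s by (simp add: xs)
      have 2: "runs DROP ?s1 (40 * sz x) (s(0 := encode ys @ r))"
        using runs_DROP[of ?s1 "to_tree x"] by (simp add: encode_def)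
      show "runs (Seq (Op 0 5) DROP) s (1 + 40 * sz (hd xs) * (if xs = [] then 0 else 1) + 1) (s(0 := encode (tl xs) @ r))"
        using runs_Seq[OF 1 2] by (simp add: xs)
    next
      assume "tops s 0 \<noteq> 2"
      then have "xs = []" using s by (cases xs) (auto simp: tops_eq)
      then show "runs SKIP s (1 + 40 * sz (hd xs) * (if xs = [] then 0 else 1) + 1) (s(0 := encode (tl xs) @ r))"
        using s by (intro runs_eq[OF runs_SKIP]) auto
    qed
    then show "runs (IF (\<lambda>f. f 0 = 2) (Seq (Op 0 5) DROP) SKIP) s (50 * sz xs) (s(0 := encode (tl xs) @ r))"
      by (rule runs_mono) (cases xs; simp)
  qed (auto intro!: polybounded_intros)
  from polytime_comp[OF this] show "polytime f \<Longrightarrow> polytime (\<lambda>x. tl (f x))" .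
qed

lemma polytime_Cons [polytime_intros]:
  assumes "polytime f" "polytime g"
  shows "polytime (\<lambda>x. f x # g x)"
proof -
  have "polytime (\<lambda>p::'b \<times> 'b list. fst p # snd p)"
    by (rule polytime_same_tree) (simp add: to_tree_prod_def)
  from polytime_comp[OF this polytime_pair[OF assms]] show ?thesis by simp
qed

lemma polytime_Suc [polytime_intros]:
  assumes "polytime f"
  shows "polytime (\<lambda>x. Suc (f x))"
proof -
  have "polytime (\<lambda>p::unit \<times> nat. Suc (snd p))"
    by (rule polytime_same_tree) (simp add: to_tree_prod_def to_tree_unit_def)
  from polytime_comp[OF this polytime_pair[OF polytime_const[of "()"] assms]] show ?thesis by simp
qed

lemma to_tree_replicate: "to_tree (replicate n ()) = to_tree n"
  by (induction n) (auto simp: to_tree_unit_def)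

lemma polytime_replicate [polytime_intros]: "polytime f \<Longrightarrow> polytime (\<lambda>x. replicate (f x) ())"
  by (rule polytime_comp[of "\<lambda>n. replicate n ()", OF polytime_same_tree]) (rule to_tree_replicate)

text \<open>On unary lists the predecessor is \<open>tl\<close>, and \<open>tl [] = []\<close>
  agrees with \<open>0 - 1 = 0\<close>.\<close>

lemma polytime_pred [polytime_intros]: "polytime f \<Longrightarrow> polytime (\<lambda>x. f x - (1::nat))"
proof -
  assume f: "polytime f"
  have "to_tree (length xs) = to_tree xs" for xs :: "unit list"
    by (induction xs) (auto simp: to_tree_unit_def simp del: One_nat_def)
  then have "polytime (length :: unit list \<Rightarrow> nat)" by (rule polytime_same_tree)
  from polytime_comp[OF this polytime_tl[OF polytime_replicate[OF f]]]
  show ?thesis by (simp only: length_tl length_replicate)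
qed

definition clear :: "nat \<Rightarrow> com" where
  "clear d = Seq (WHILE (\<lambda>f. f d \<noteq> 3) (Op d 5)) (Op d 5)"

lemma runs_clear:
  assumes "s d = w @ 3 # r" "set w \<subseteq> {1,2}" "d < 4"
  shows "runs (clear d) s (3 * length w + 3) (s(d := r))"
proof -
  have "runs (WHILE (\<lambda>f. f d \<noteq> 3) (Op d 5)) s (3 * length w + 1) (s(d := 3 # r))"
    using assms
  proof (induction w arbitrary: s)
    case Nil
    then show ?case by (intro runs_eq[OF runs_WHILE_end]) (auto simp: tops_eq)
  next
    case (Cons a w)
    have 1: "runs (Op d 5) s 1 (s(d := w @ 3 # r))" using runs_pop[of d s] Cons.prems by simp
    have 2: "runs (WHILE (\<lambda>f. f d \<noteq> 3) (Op d 5)) (s(d := w @ 3 # r)) (3 * length w + 1)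
        ((s(d := w @ 3 # r))(d := 3 # r))"
      by (rule Cons.IH) (use Cons.prems in auto)
    show ?case
      by (rule runs_eq[OF runs_WHILE[OF _ 1 2]]) (use Cons.prems in \<open>auto simp: tops_eq\<close>)
  qed
  from runs_Seq[OF this runs_pop[OF \<open>d < 4\<close>]] show ?thesis
    unfolding clear_def by (rule runs_eq) auto
qed

definition strip :: com where
  "strip = WHILE (\<lambda>f. f 1 = f 2 \<and> f 1 \<noteq> 3) (Seq (Op 1 5) (Op 2 5))"

text \<open>The loop removes the longest common prefix. It stops at a mismatch or with both markers
  3 on top, so equal tops afterwards mean that both words were exhausted together. What remains is
  left existential, since it is only cleared.\<close>

lemma runs_strip:
  assumes "s 1 = u @ 3 # r" "s 2 = v @ 3 # k" "set u \<subseteq> {1,2}" "set v \<subseteq> {1,2}"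
  shows "\<exists>u' v'. set u' \<subseteq> {1,2} \<and> set v' \<subseteq> {1,2} \<and> length u' \<le> length u \<and> length v' \<le> length v \<and>
    runs strip s (5 * length u + 1) (s(1 := u' @ 3 # r, 2 := v' @ 3 # k)) \<and>
    (hd (u' @ [3]) = hd (v' @ [3]) \<longleftrightarrow> u = v)"
  using assms
proof (induction u arbitrary: v s)
  case Nil
  have "runs strip s 1 s"
    unfolding strip_def by (rule runs_WHILE_end) (use Nil in \<open>auto simp: tops_eq\<close>)
  then have r: "runs strip s (5 * length ([]::nat list) + 1) (s(1 := [] @ 3 # r, 2 := v @ 3 # k))"
    by (rule runs_eq) (use Nil in \<open>auto simp: fun_eq_iff\<close>)
  have h: "hd ([] @ [3]) = hd (v @ [3]) \<longleftrightarrow> [] = v" using Nil(4) by (cases v) auto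
  show ?case by (intro exI[of _ "[]"] exI[of _ v] conjI r h) (use Nil in auto)
next
  case (Cons a u)
  show ?case
  proof (cases "v \<noteq> [] \<and> hd v = a")
    case True
    then obtain v2 where v: "v = a # v2" by (cases v) auto
    let ?s2 = "s(1 := u @ 3 # r, 2 := v2 @ 3 # k)"
    have a: "a \<noteq> 3" using Cons.prems(3) by auto
    have "\<exists>u' v'. set u' \<subseteq> {1,2} \<and> set v' \<subseteq> {1,2} \<and> length u' \<le> length u \<and> length v' \<le> length v2 \<and>
        runs strip ?s2 (5 * length u + 1) (?s2(1 := u' @ 3 # r, 2 := v' @ 3 # k)) \<and>
        (hd (u' @ [3]) = hd (v' @ [3]) \<longleftrightarrow> u = v2)"
      by (rule Cons.IH) (use Cons.prems v in auto)
    then obtain u' v' where i: "set u' \<subseteq> {1,2}" "set v' \<subseteq> {1,2}" "length u' \<le> length u" "length v' \<le> length v2"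
      "runs strip ?s2 (5 * length u + 1) (?s2(1 := u' @ 3 # r, 2 := v' @ 3 # k))"
      "hd (u' @ [3]) = hd (v' @ [3]) \<longleftrightarrow> u = v2"
      by blast
    have 1: "runs (Op 1 5) s 1 (s(1 := u @ 3 # r))" using runs_pop[of 1 s] Cons.prems by simp
    have 2: "runs (Op 2 5) (s(1 := u @ 3 # r)) 1 ?s2"
      using runs_pop[of 2 "s(1 := u @ 3 # r)"] Cons.prems v by simp
    have "runs strip s (1 + 1 + 1 + (5 * length u + 1) + 2) (?s2(1 := u' @ 3 # r, 2 := v' @ 3 # k))"
      unfolding strip_def
      by (rule runs_WHILE[OF _ runs_Seq[OF 1 2] i(5)[unfolded strip_def]])
        (use Cons.prems v a in \<open>auto simp: tops_eq\<close>)
    then have r: "runs strip s (5 * length (a # u) + 1) (s(1 := u' @ 3 # r, 2 := v' @ 3 # k))"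
      by (rule runs_eq) (auto simp: fun_eq_iff)
    show ?thesis by (intro exI[of _ u'] exI[of _ v'] conjI r) (use i v in auto)
  next
    case False
    have a: "a \<noteq> 3" using Cons.prems(3) by auto
    have "runs strip s 1 s"
      unfolding strip_def by (rule runs_WHILE_end)
        (use Cons.prems a False in \<open>cases v; auto simp: tops_eq\<close>)
    then have r: "runs strip s (5 * length (a # u) + 1) (s(1 := (a # u) @ 3 # r, 2 := v @ 3 # k))"
      by (rule runs_eq) (use Cons.prems in \<open>auto simp: fun_eq_iff\<close>)
    have h: "hd ((a # u) @ [3]) = hd (v @ [3]) \<longleftrightarrow> a # u = v" using False a by (cases v) auto
    show ?thesis by (intro exI[of _ "a # u"] exI[of _ v] conjI r h) (use Cons.prems in auto)
  qed
qed

definition EQ :: com where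
  "EQ = Seq (Op 0 5) (Seq (moveto [1]) (Seq (moveto [2]) (Seq strip (Seq
     (IF (\<lambda>f. f 1 = f 2) (pushes_list [2,1,1]) (pushes_list [1]))
     (Seq (clear 1) (clear 2))))))"

lemma polytime_eq [polytime_intros]:
  fixes f g :: "'a::encodable \<Rightarrow> 'b::encodable"
  assumes "polytime f" "polytime g"
  shows "polytime (\<lambda>x. f x = g x)"
proof -
  have "polytime (\<lambda>p :: 'b \<times> 'b. fst p = snd p)"
  proof (rule ptI[of EQ "\<lambda>p. 200 * sz p"])
    show "wfc EQ"
      by (simp add: EQ_def wfc_moveto strip_def clear_def)
    show "polybounded (\<lambda>p. 200 * sz p)" by (intro polybounded_intros)
    fix p :: "'b \<times> 'b" and s r assume s: "s (0::nat) = encode p @ r"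
    obtain x y where p: "p = (x, y)" by (cases p)
    let ?u = "rev (encode x)"
    let ?v = "rev (encode y)"
    let ?s1 = "s(0 := encode x @ encode y @ r)"
    let ?s2 = "s(0 := encode y @ r, 1 := ?u @ 3 # s 1)"
    let ?s3 = "s(0 := r, 1 := ?u @ 3 # s 1, 2 := ?v @ 3 # s 2)"
    have set: "set ?u \<subseteq> {1,2}" "set ?v \<subseteq> {1,2}" using code_set by (simp_all add: encode_def)
    have 1: "runs (Op 0 5) s 1 ?s1" using runs_pop[of 0 s] s by (simp add: p)
    have 2: "runs (moveto [1]) ?s1 (40 * sz x) ?s2"
      by (rule runs_eq[OF runs_moveto[of _ _ "to_tree x" "encode y @ r"]])
        (auto simp: encode_def fun_eq_iff on_top_def)
    have 3: "runs (moveto [2]) ?s2 (40 * sz y) ?s3"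
      by (rule runs_eq[OF runs_moveto[of _ _ "to_tree y" r]])
        (auto simp: encode_def fun_eq_iff on_top_def)
    obtain u' v' where uv: "set u' \<subseteq> {1,2}" "set v' \<subseteq> {1,2}" "length u' \<le> length ?u" "length v' \<le> length ?v"
      "runs strip ?s3 (5 * length ?u + 1) (?s3(1 := u' @ 3 # s 1, 2 := v' @ 3 # s 2))"
      "hd (u' @ [3]) = hd (v' @ [3]) \<longleftrightarrow> ?u = ?v"
      using runs_strip[of ?s3 ?u "s 1" ?v "s 2"] set by auto
    let ?s4 = "?s3(1 := u' @ 3 # s 1, 2 := v' @ 3 # s 2)"
    let ?s5 = "?s4(0 := encode (x = y) @ r)"
    have xy: "?u = ?v \<longleftrightarrow> x = y" by (simp add: encode_inj)
    have t: "tops ?s4 1 = tops ?s4 2 \<longleftrightarrow> x = y"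
      using uv(6) unfolding xy by (cases u'; cases v') (auto simp: tops_eq)
    have 4: "runs (IF (\<lambda>f. f 1 = f 2) (pushes_list [2,1,1]) (pushes_list [1])) ?s4 (6 + 1) ?s5"
    proof (rule runs_IF)
      assume "tops ?s4 1 = tops ?s4 2"
      then show "runs (pushes_list [2,1,1]) ?s4 6 ?s5"
        using runs_pushes_list[of "[2,1,1]" ?s4] t by simp
    next
      assume "\<not> tops ?s4 1 = tops ?s4 2"
      then show "runs (pushes_list [1]) ?s4 6 ?s5"
        using runs_mono[OF runs_pushes_list[of "[1]" ?s4], of 6] t by simp
    qed
    have 5: "runs (clear 1) ?s5 (3 * length u' + 3) (?s5(1 := s 1))"
      by (rule runs_clear) (use uv in auto)
    have 6: "runs (clear 2) (?s5(1 := s 1)) (3 * length v' + 3) (?s5(1 := s 1, 2 := s 2))"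
      by (rule runs_clear) (use uv in auto)
    show "runs EQ s (200 * sz p) (s(0 := encode (fst p = snd p) @ r))"
      unfolding EQ_def
      by (rule runs_eq[OF runs_Seq[OF 1 runs_Seq[OF 2 runs_Seq[OF 3 runs_Seq[OF uv(5)
           runs_Seq[OF 4 runs_Seq[OF 5 6]]]]]]])
        (use uv(3,4) sz_pos[of x] sz_pos[of y] in \<open>auto simp: fun_eq_iff p sz_def[symmetric]\<close>)
  qed
  from polytime_comp[OF this polytime_pair[OF assms]] show ?thesis by simp
qed

section \<open>Iteration over lists\<close>

lemma sz_elem: "a \<in> set xs \<Longrightarrow> sz a < sz xs"
  by (induction xs) auto

lemma length_le_sz: "length xs < sz xs"
  by (induction xs) auto

text \<open>Invariant: the code of the remaining list lies above the code of the pair of parameter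
  and accumulator. List cells and pairs share the symbol 2, so once the tail is parked on stack 2,
  pushing a 2 turns the head above \<open>(x, z)\<close> into the triple expected by
  \<open>P\<close>. The parameter \<open>x\<close> is carried along for the next iteration.\<close>

definition fold_loop :: "com \<Rightarrow> com" where
  "fold_loop P = WHILE (\<lambda>f. f 0 = 2) (Seq (Op 0 5) (Seq (moveto [1]) (Seq (moveto [2])
     (Seq (unstack 1) (Seq (Op 0 2) (Seq P (unstack 2)))))))"

lemma runs_fold_loop:
  fixes g :: "'x::encodable \<Rightarrow> 'a::encodable \<Rightarrow> 'z::encodable \<Rightarrow> 'z"
  assumes P: "computes P h (\<lambda>p. (fst (snd p), g (fst (snd p)) (fst p) (snd (snd p))))"
    and H: "\<And>n. n < length l \<Longrightarrow> h (l ! n, x, fold (g x) (take n l) z) \<le> H"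
    and L: "sz l \<le> L" and s: "s 0 = encode l @ encode (x, z) @ r"
  shows "runs (fold_loop P) s (length l * (H + 120 * L + 20) + 1) (s(0 := 1 # encode (x, fold (g x) l z) @ r))"
  using H L s
proof (induction l arbitrary: z s)
  case Nil
  then show ?case unfolding fold_loop_def
    by (intro runs_eq[OF runs_WHILE_end]) (auto simp: tops_eq fun_eq_iff)
next
  case (Cons a l)
  let ?u = "rev (encode a)"
  let ?v = "rev (encode l)"
  let ?s1 = "s(0 := encode a @ encode l @ encode (x, z) @ r)"
  let ?s2 = "s(0 := encode l @ encode (x, z) @ r, 1 := ?u @ 3 # s 1)"
  let ?s3 = "s(0 := encode (x, z) @ r, 1 := ?u @ 3 # s 1, 2 := ?v @ 3 # s 2)"
  let ?s4 = "s(0 := encode a @ encode (x, z) @ r, 2 := ?v @ 3 # s 2)"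
  let ?s5 = "s(0 := encode (a, x, z) @ r, 2 := ?v @ 3 # s 2)"
  let ?s6 = "s(0 := encode (x, g x a z) @ r, 2 := ?v @ 3 # s 2)"
  let ?s7 = "s(0 := encode l @ encode (x, g x a z) @ r)"
  have set: "set ?u \<subseteq> {1,2}" "set ?v \<subseteq> {1,2}" using code_set by (simp_all add: encode_def)
  have len: "length ?u = sz a" "length ?v = sz l" by (simp_all add: sz_def)
  have le: "sz a + sz l + 1 \<le> L" using Cons.prems(2) by simp
  have 1: "runs (Op 0 5) s 1 ?s1" using runs_pop[of 0 s] Cons.prems by simp
  have 2: "runs (moveto [1]) ?s1 (40 * sz a) ?s2"
    by (rule runs_eq[OF runs_moveto[of _ _ "to_tree a" "encode l @ encode (x, z) @ r"]])
      (auto simp: encode_def fun_eq_iff on_top_def)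
  have 3: "runs (moveto [2]) ?s2 (40 * sz l) ?s3"
    by (rule runs_eq[OF runs_moveto[of _ _ "to_tree l" "encode (x, z) @ r"]])
      (auto simp: encode_def fun_eq_iff on_top_def)
  have 4: "runs (unstack 1) ?s3 (10 * sz a + 3) ?s4"
    by (rule runs_eq[OF runs_unstack[of _ _ ?u "s 1"]]) (use set in \<open>auto simp: fun_eq_iff len[simplified]\<close>)
  have 5: "runs (Op 0 2) ?s4 1 ?s5"
    by (rule runs_eq[OF runs_push]) (auto simp: fun_eq_iff)
  have 6: "runs P ?s5 (h (a, x, z)) ?s6"
    by (rule runs_eq[OF computesD[OF P, of ?s5 "(a, x, z)" r]]) (auto simp: fun_eq_iff)
  have 7: "runs (unstack 2) ?s6 (10 * sz l + 3) ?s7"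
    by (rule runs_eq[OF runs_unstack[of _ _ ?v "s 2"]]) (use set in \<open>auto simp: fun_eq_iff len[simplified]\<close>)
  have H0: "h (a, x, z) \<le> H" using Cons.prems(1)[of 0] by simp
  have 8: "runs (fold_loop P) ?s7 (length l * (H + 120 * L + 20) + 1)
    (?s7(0 := 1 # encode (x, fold (g x) l (g x a z)) @ r))"
  proof (rule Cons.IH)
    show "h (l ! n, x, fold (g x) (take n l) (g x a z)) \<le> H" if "n < length l" for n
      using Cons.prems(1)[of "Suc n"] that by simp
  qed (use le in auto)
  show ?case unfolding fold_loop_def
    by (rule runs_eq[OF runs_WHILE[OF _ runs_Seq[OF 1 runs_Seq[OF 2 runs_Seq[OF 3 runs_Seq[OF 4
           runs_Seq[OF 5 runs_Seq[OF 6 7]]]]]] 8[unfolded fold_loop_def]]])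
      (use le H0 Cons.prems(3) in \<open>auto simp: tops_eq fun_eq_iff\<close>)
qed

lemma wfc_fold_loop: "wfc P \<Longrightarrow> wfc (fold_loop P)"
  by (simp add: fold_loop_def wfc_moveto wfc_unstack)

text \<open>The bound \<open>B\<close> on all intermediate accumulators excludes steps such as
  doubling, which are polynomial themselves but reach exponential size when iterated.\<close>

theorem polytime_fold:
  fixes g :: "'x::encodable \<Rightarrow> 'a::encodable \<Rightarrow> 'z::encodable \<Rightarrow> 'z"
  assumes g: "polytime (\<lambda>p. g (fst p) (fst (snd p)) (snd (snd p)))" and l: "polytime l" and z: "polytime z"
    and B: "polybounded B" "\<And>x n. sz (fold (g x) (take n (l x)) (z x)) \<le> B x"
  shows "polytime (\<lambda>x. fold (g x) (l x) (z x))"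
proof -
  have "polytime (\<lambda>p::'a \<times> 'x \<times> 'z. (fst (snd p), g (fst (snd p)) (fst p) (snd (snd p))))"
    using polytime_pair[OF polytime_fst[OF polytime_snd[OF polytime_id]]
      polytime_comp[OF g, of "\<lambda>p::'a \<times> 'x \<times> 'z. (fst (snd p), fst p, snd (snd p))"]]
    by (simp add: polytime_intros polytime_id)
  then obtain P h where P: "wfc P" "polybounded h"
    "computes P h (\<lambda>p::'a \<times> 'x \<times> 'z. (fst (snd p), g (fst (snd p)) (fst p) (snd (snd p))))"
    by (rule ptE)
  have "polytime (\<lambda>x. (l x, x, z x))" by (intro polytime_intros polytime_id l z)
  then obtain Q k where Q: "wfc Q" "polybounded k" "computes Q k (\<lambda>x. (l x, x, z x))" by (rule ptE)
  have "polytime (\<lambda>p::'x \<times> 'z. snd p)" by (intro polytime_intros polytime_id)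
  then obtain R j where R: "wfc R" "polybounded j" "computes R j (\<lambda>p::'x \<times> 'z. snd p)" by (rule ptE)
  \<comment> \<open>\<open>h\<close> may fail to be monotone in the size; a monomial above it turns
    a bound on the sizes of the triples into one time bound for all iterations.\<close>
  obtain c d where cd: "\<And>p. h p \<le> c * sz p ^ d" using P(2) unfolding polybounded_def by blast
  obtain c' d' where cd': "\<And>p. j p \<le> c' * sz p ^ d'" using R(2) unfolding polybounded_def by blast
  let ?prog = "Seq Q (Seq (Op 0 5) (Seq (fold_loop P) (Seq (Op 0 5) R)))"
  let ?H = "\<lambda>x. c * (sz (l x) + sz x + B x + 1) ^ d"
  let ?J = "\<lambda>x. c' * (sz x + B x + 1) ^ d'"
  let ?b = "\<lambda>x. k x + (1 + (sz (l x) * (?H x + 120 * sz (l x) + 20) + 1 + (1 + ?J x + 1) + 1) + 1) + 1"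
  show ?thesis
  proof (rule ptI[of ?prog ?b])
    show "wfc ?prog" using P Q R by (simp add: wfc_fold_loop)
    show "polybounded ?b" by (intro polybounded_intros Q B polytime_size l)
    fix x :: 'x and s r assume s: "s (0::nat) = encode x @ r"
    let ?y = "fold (g x) (l x) (z x)"
    let ?s1 = "s(0 := encode (l x, x, z x) @ r)"
    let ?s2 = "s(0 := encode (l x) @ encode (x, z x) @ r)"
    let ?s3 = "s(0 := 1 # encode (x, ?y) @ r)"
    let ?s4 = "s(0 := encode (x, ?y) @ r)"
    have H: "h (l x ! n, x, fold (g x) (take n (l x)) (z x)) \<le> ?H x" if "n < length (l x)" for n
    proof -
      have "sz (l x ! n, x, fold (g x) (take n (l x)) (z x)) \<le> sz (l x) + sz x + B x + 1"
        using sz_elem[OF nth_mem[OF that]] B(2)[of x n] by simp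
      then have "c * sz (l x ! n, x, fold (g x) (take n (l x)) (z x)) ^ d \<le> ?H x"
        by (intro mult_le_mono2 power_mono) auto
      then show ?thesis using cd order_trans by blast
    qed
    have "j (x, ?y) \<le> c' * sz (x, ?y) ^ d'" by (rule cd')
    also have "\<dots> \<le> ?J x"
      using B(2)[of x "length (l x)"] by (intro mult_le_mono2 power_mono) auto
    finally have J: "j (x, ?y) \<le> ?J x" .
    have 1: "runs Q s (k x) ?s1" by (rule computesD[OF Q(3)]) (rule s)
    have 2: "runs (Op 0 5) ?s1 1 ?s2" using runs_pop[of 0 ?s1] by simp
    have 3: "runs (fold_loop P) ?s2 (length (l x) * (?H x + 120 * sz (l x) + 20) + 1) ?s3"
      by (rule runs_eq[OF runs_fold_loop[OF P(3) H order_refl, of _ r]]) (auto simp: fun_eq_iff)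
    have 3: "runs (fold_loop P) ?s2 (sz (l x) * (?H x + 120 * sz (l x) + 20) + 1) ?s3"
      by (rule runs_mono[OF 3]) (use length_le_sz[of "l x"] in \<open>intro add_le_mono1 mult_le_mono1; simp\<close>)
    have 4: "runs (Op 0 5) ?s3 1 ?s4" using runs_pop[of 0 ?s3] by simp
    have 5: "runs R ?s4 (?J x) (s(0 := encode ?y @ r))"
      by (rule runs_eq[OF computesD[OF R(3), of ?s4 "(x, ?y)" r]]) (use J in auto)
    show "runs ?prog s (?b x) (s(0 := encode ?y @ r))"
      by (rule runs_Seq[OF 1 runs_Seq[OF 2 runs_Seq[OF 3 runs_Seq[OF 4 5]]]])
  qed
qed


lemma length_fold_bound:
  assumes "\<And>a z. a \<in> set xs \<Longrightarrow> sz (g a z) \<le> sz z + A"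
  shows "sz (fold g (take n xs) z) \<le> sz z + length xs * A"
proof -
  have "sz (fold g ys z) \<le> sz z + length ys * A" if "set ys \<subseteq> set xs" for ys
    using that
  proof (induction ys arbitrary: z)
    case (Cons a ys)
    have "sz (fold g ys (g a z)) \<le> sz (g a z) + length ys * A" using Cons by auto
    then show ?case using assms[of a z] Cons.prems by auto
  qed simp
  from this[OF set_take_subset]
  have "sz (fold g (take n xs) z) \<le> sz z + length (take n xs) * A" .
  also have "\<dots> \<le> sz z + length xs * A" by (intro add_left_mono mult_le_mono1) simp
  finally show ?thesis .
qed

text \<open>If the growth per step depends on the parameter and the list entry but not on the
  accumulator, the increments add up to at most list length times a polynomial, which supplies the
  bound \<open>B\<close>.\<close>

theorem polytime_fold_add:
  fixes g :: "'x::encodable \<Rightarrow> 'a::encodable \<Rightarrow> 'z::encodable \<Rightarrow> 'z"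
  assumes g: "polytime (\<lambda>p. g (fst p) (fst (snd p)) (snd (snd p)))" and l: "polytime l" and z: "polytime z"
    and A: "polybounded A" "\<And>x a z. sz (g x a z) \<le> sz z + A (x, a)"
  shows "polytime (\<lambda>x. fold (g x) (l x) (z x))"
proof -
  obtain c d where cd: "\<And>p. A p \<le> c * sz p ^ d" using A(1) unfolding polybounded_def by blast
  let ?A = "\<lambda>x. c * (sz x + sz (l x) + 1) ^ d"
  show ?thesis
  proof (rule polytime_fold[OF g l z])
    show "polybounded (\<lambda>x. sz (z x) + sz (l x) * ?A x)" by (intro polybounded_intros polytime_size l z)
    fix x n
    have "sz (g x a w) \<le> sz w + ?A x" if "a \<in> set (l x)" for a w
    proof -
      have "c * sz (x, a) ^ d \<le> ?A x"
        using sz_elem[OF that] by (intro mult_le_mono2 power_mono) auto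
      then show ?thesis using A(2)[of x a w] cd[of "(x, a)"] by linarith
    qed
    then have "sz (fold (g x) (take n (l x)) (z x)) \<le> sz (z x) + length (l x) * ?A x"
      by (rule length_fold_bound)
    also have "\<dots> \<le> sz (z x) + sz (l x) * ?A x"
      using length_le_sz[of "l x"] by (intro add_le_mono mult_le_mono1) auto
    finally show "sz (fold (g x) (take n (l x)) (z x)) \<le> sz (z x) + sz (l x) * ?A x" .
  qed
qed

section \<open>Derived operations\<close>

lemma polytime_rev [polytime_intros]:
  assumes "polytime f"
  shows "polytime (\<lambda>x. rev (f x))"
proof -
  have "polytime (\<lambda>x. fold (\<lambda>a z. a # z) (f x) [])"
    by (rule polytime_fold_add[where A = "\<lambda>p. sz p"]) (intro polytime_intros polytime_id assms polybounded_intros | simp)+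
  then show ?thesis by (simp add: rev_conv_fold)
qed

lemma polytime_append [polytime_intros]:
  assumes "polytime f" "polytime g"
  shows "polytime (\<lambda>x. f x @ g x)"
proof -
  have "polytime (\<lambda>x. fold (\<lambda>a z. a # z) (rev (f x)) (g x))"
    by (rule polytime_fold_add[where A = "\<lambda>p. sz p"]) (intro polytime_intros polytime_id assms polybounded_intros | simp)+
  then show ?thesis by (simp add: fold_Cons_rev)
qed

text \<open>The mapped function may mention the outer input \<open>x\<close>, as lambda bodies do;
  hence its hypothesis is stated on pairs of input and entry. The fold collects in reverse
  order.\<close>

lemma polytime_map [polytime_intros]:
  fixes g :: "'x::encodable \<Rightarrow> 'a::encodable \<Rightarrow> 'b::encodable"
  assumes "polytime (\<lambda>p. g (fst p) (snd p))" "polytime l"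
  shows "polytime (\<lambda>x. map (\<lambda>a. g x a) (l x))"
proof -
  have 1: "polytime (\<lambda>p::'x \<times> 'a \<times> 'b list. g (fst p) (fst (snd p)))"
    using polytime_comp[OF assms(1), of "\<lambda>p::'x \<times> 'a \<times> 'b list. (fst p, fst (snd p))"]
    by (simp add: polytime_intros polytime_id)
  have "polytime (\<lambda>x. fold (\<lambda>a z. g x a # z) (l x) [])"
    by (rule polytime_fold_add[where A = "\<lambda>p. Suc (sz (g (fst p) (snd p)))"])
      (intro polytime_intros polytime_id assms 1 polybounded_intros polytime_size | simp)+
  moreover have "fold (\<lambda>a z. g x a # z) xs ys = rev (map (g x) xs) @ ys" for x xs ys
    by (induction xs arbitrary: ys) auto
  ultimately have "polytime (\<lambda>x. rev (map (g x) (l x)))" by simp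
  from polytime_rev[OF this] show ?thesis by simp
qed

lemma polytime_filter [polytime_intros]:
  fixes g :: "'x::encodable \<Rightarrow> 'a::encodable \<Rightarrow> bool"
  assumes "polytime (\<lambda>p. g (fst p) (snd p))" "polytime l"
  shows "polytime (\<lambda>x. filter (\<lambda>a. g x a) (l x))"
proof -
  have 1: "polytime (\<lambda>p::'x \<times> 'a \<times> 'a list. g (fst p) (fst (snd p)))"
    using polytime_comp[OF assms(1), of "\<lambda>p::'x \<times> 'a \<times> 'a list. (fst p, fst (snd p))"]
    by (simp add: polytime_intros polytime_id)
  have "polytime (\<lambda>x. fold (\<lambda>a z. if g x a then a # z else z) (l x) [])"
    by (rule polytime_fold_add[where A = "\<lambda>p. sz p"]) (intro polytime_intros polytime_id assms 1 polybounded_intros | simp)+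
  moreover have "fold (\<lambda>a z. if g x a then a # z else z) xs ys = rev (filter (\<lambda>a. g x a) xs) @ ys" for x xs ys
    by (induction xs arbitrary: ys) auto
  ultimately have "polytime (\<lambda>x. rev (filter (\<lambda>a. g x a) (l x)))" by simp
  from polytime_rev[OF this] show ?thesis by simp
qed

lemma polytime_concat [polytime_intros]:
  assumes "polytime f"
  shows "polytime (\<lambda>x. concat (f x))"
proof -
  have sz_append: "sz (xs @ ys) \<le> sz xs + sz ys" for xs ys :: "'b list"
    by (induction xs) auto
  have "polytime (\<lambda>x. fold (\<lambda>a z. a @ z) (rev (f x)) [])"
    by (rule polytime_fold_add[where A = "\<lambda>p. sz p"])
      ((intro polytime_intros polytime_id assms polybounded_intros | simp)+, rule order_trans[OF sz_append], simp)
  moreover have "fold (\<lambda>a z. a @ z) (rev xss) [] = concat xss" for xss :: "'b list list"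
    by (simp add: foldr_conv_fold[symmetric] concat_conv_foldr)
  ultimately show ?thesis by simp
qed

lemma polytime_product [polytime_intros]:
  assumes "polytime f" "polytime g"
  shows "polytime (\<lambda>x. List.product (f x) (g x))"
proof -
  have "polytime (\<lambda>x. concat (map (\<lambda>a. map (\<lambda>b. (a, b)) (g x)) (f x)))"
    by (intro polytime_intros polytime_id assms polytime_comp[OF assms(2)])
  then show ?thesis by (simp add: product_concat_map)
qed

lemma polytime_length [polytime_intros]:
  assumes "polytime f"
  shows "polytime (\<lambda>x. length (f x))"
proof -
  have "polytime (\<lambda>x. fold (\<lambda>a z. Suc z) (f x) 0)"
    by (rule polytime_fold_add[where A = "\<lambda>p. 2"]) (intro polytime_intros polytime_id assms polybounded_intros | simp)+
  moreover have "fold (\<lambda>a z. Suc z) xs n = length xs + n" for xs :: "'b list" and n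
    by (induction xs arbitrary: n) auto
  ultimately show ?thesis by simp
qed

text \<open>\<open>m\<close> is at most \<open>n\<close> iff the truncated difference
  \<open>m - n\<close> is 0, and this difference is an iterated predecessor.\<close>

lemma polytime_le [polytime_intros]:
  fixes f g :: "'a::encodable \<Rightarrow> nat"
  assumes "polytime f" "polytime g"
  shows "polytime (\<lambda>x. f x \<le> g x)"
proof -
  have "polytime (\<lambda>x. fold (\<lambda>a z. z - 1) (replicate (g x) ()) (f x) = 0)"
    by (rule polytime_eq, rule polytime_fold_add[where A = "\<lambda>p. 0"]) (intro polytime_intros polytime_id assms polybounded_intros | simp)+
  moreover have "fold (\<lambda>a z. z - 1) (replicate n ()) m = m - n" for m n :: nat
    by (induction n arbitrary: m) auto
  ultimately show ?thesis by simp
qed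

lemma polytime_conj [polytime_intros]:
  assumes "polytime f" "polytime g"
  shows "polytime (\<lambda>x. f x \<and> g x)"
proof -
  have "(\<lambda>x. f x \<and> g x) = (\<lambda>x. if f x then g x else False)" by auto
  then show ?thesis using polytime_if[OF assms polytime_const[of False]] by (simp only:)
qed

text \<open>The index written in each step is the length of the accumulator, so the growth depends
  on it and \<open>polytime_fold_add\<close> does not apply; the prefixes are bounded explicitly
  instead.\<close>

lemma polytime_enumerate [polytime_intros]:
  assumes "polytime f"
  shows "polytime (\<lambda>x. enumerate 0 (f x :: 'b::encodable list))"
proof -
  have step: "fold (\<lambda>a z. z @ [(length z, a)]) xs [] = enumerate 0 xs" for xs :: "'b list"
    by (induction xs rule: rev_induct) (auto simp: enumerate_append_eq)
  have bound: "sz (enumerate n xs) \<le> sz xs + length xs * (2 * (n + length xs) + 3)" for n and xs :: "'b list"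
  proof (induction xs arbitrary: n)
    case (Cons a xs)
    show ?case using Cons.IH[of "Suc n"] by (simp add: algebra_simps)
  qed simp
  have mono: "sz (take n xs) \<le> sz xs" for n and xs :: "'b list"
    by (induction xs arbitrary: n) (auto simp: take_Cons split: nat.splits)
  have "polytime (\<lambda>x. fold (\<lambda>a z. z @ [(length z, a)]) (f x) [])"
  proof (rule polytime_fold[where B = "\<lambda>x. sz (f x) + sz (f x) * (2 * sz (f x) + 3)"])
    fix x n
    let ?xs = "take n (f x)"
    have "sz (enumerate 0 ?xs) \<le> sz ?xs + length ?xs * (2 * (0 + length ?xs) + 3)" by (rule bound)
    also have "\<dots> \<le> sz (f x) + sz (f x) * (2 * sz (f x) + 3)"
      using mono[of n "f x"] length_le_sz[of "?xs"]
      by (intro add_le_mono mult_le_mono) auto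
    finally show "sz (fold (\<lambda>a z. z @ [(length z, a)]) (take n (f x)) []) \<le>
        sz (f x) + sz (f x) * (2 * sz (f x) + 3)"
      by (simp only: step)
  qed (intro polytime_intros polytime_id assms polybounded_intros polytime_size)+
  then show ?thesis by (simp only: step)
qed

lemma polytime_upt [polytime_intros]: "polytime f \<Longrightarrow> polytime (\<lambda>x. [0..<f x])"
proof -
  assume "polytime f"
  then have "polytime (\<lambda>x. map (\<lambda>p. fst p) (enumerate 0 (replicate (f x) ())))"
    by (intro polytime_intros polytime_id)
  moreover have "map (\<lambda>p. fst p) (enumerate 0 (replicate n ())) = [0..<n]" for n
    by (simp add: enumerate_eq_zip)
  ultimately show ?thesis by simp
qed

section \<open>Input and output\<close>

definition transfer :: "nat \<Rightarrow> nat \<Rightarrow> com" where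
  "transfer i j = WHILE (\<lambda>f. f i \<noteq> 0)
     (Seq (IF (\<lambda>f. f i = 1) (Op j 1) (IF (\<lambda>f. f i = 2) (Op j 2) (Op j 3))) (Op i 5))"

lemma runs_transfer:
  assumes "s i = w" "set w \<subseteq> {1,2,3}" "i < 4" "j < 4" "i \<noteq> j"
  shows "runs (transfer i j) s (10 * length w + 1) (s(i := [], j := rev w @ s j))"
  using assms
proof (induction w arbitrary: s)
  case Nil
  then show ?case unfolding transfer_def
    by (intro runs_eq[OF runs_WHILE_end]) (auto simp: tops_eq)
next
  case (Cons a w)
  let ?s1 = "s(j := a # s j)"
  let ?s2 = "s(j := a # s j, i := w)"
  have a: "a = 1 \<or> a = 2 \<or> a = 3" using Cons.prems by auto
  have 1: "runs (IF (\<lambda>f. f i = 1) (Op j 1) (IF (\<lambda>f. f i = 2) (Op j 2) (Op j 3))) s (1 + 1 + 1) ?s1"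
    by (intro runs_IF)
      (use a Cons.prems runs_mono[OF runs_push[of j 1 s], of 2] runs_push[of j 2 s] runs_push[of j 3 s]
        in \<open>auto simp: tops_eq numeral_2_eq_2\<close>)
  have 2: "runs (Op i 5) ?s1 1 ?s2" using runs_pop[of i ?s1] Cons.prems by simp
  have 3: "runs (transfer i j) ?s2 (10 * length w + 1) (?s2(i := [], j := rev w @ ?s2 j))"
    by (rule Cons.IH) (use Cons.prems in auto)
  show ?case unfolding transfer_def
    by (rule runs_eq[OF runs_WHILE[OF _ runs_Seq[OF 1 2] 3[unfolded transfer_def]]])
      (use Cons.prems a in \<open>auto simp: tops_eq fun_eq_iff\<close>)
qed

definition parse_nat :: com where
  "parse_nat = WHILE (\<lambda>f. f 1 = 1) (Seq (Op 1 5) (Seq (Op 0 1) (Op 0 2)))"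

lemma runs_parse_nat:
  assumes "s 0 = encode n @ r" "s 1 = replicate v 1 @ w" "w = [] \<or> hd w \<noteq> 1"
  shows "runs parse_nat s (10 * v + 1) (s(0 := encode (v + n) @ r, 1 := w))"
  using assms
proof (induction v arbitrary: n s)
  case 0
  then show ?case unfolding parse_nat_def
    by (intro runs_eq[OF runs_WHILE_end]) (cases w; auto simp: tops_eq fun_eq_iff)+
next
  case (Suc v)
  let ?s1 = "s(1 := replicate v 1 @ w)"
  let ?s2 = "s(1 := replicate v 1 @ w, 0 := 1 # encode n @ r)"
  let ?s3 = "s(1 := replicate v 1 @ w, 0 := encode (Suc n) @ r)"
  have 1: "runs (Op 1 5) s 1 ?s1" using runs_pop[of 1 s] Suc.prems by simp
  have 2: "runs (Op 0 1) ?s1 1 ?s2" using runs_push[of 0 1 ?s1] Suc.prems by simp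
  have 3: "runs (Op 0 2) ?s2 1 ?s3" using runs_push[of 0 2 ?s2] Suc.prems by simp
  have 4: "runs parse_nat ?s3 (10 * v + 1) (?s3(0 := encode (v + Suc n) @ r, 1 := w))"
    by (rule Suc.IH) (use Suc.prems in auto)
  show ?case unfolding parse_nat_def
    by (rule runs_eq[OF runs_WHILE[OF _ runs_Seq[OF 1 runs_Seq[OF 2 3]] 4[unfolded parse_nat_def]]])
      (use Suc.prems in \<open>auto simp: tops_eq fun_eq_iff\<close>)
qed

lemma enc_list_simps [simp]:
  "enc_list [] = []"
  "enc_list (v # xs) = replicate v 1 @ 2 # enc_list xs"
  "enc_list (xs @ ys) = enc_list xs @ enc_list ys"
  by (simp_all add: enc_list_def)

definition parse_loop :: com where
  "parse_loop = WHILE (\<lambda>f. f 1 = 2) (Seq (Op 1 5) (Seq (Op 0 1) (Seq parse_nat (Op 0 2))))"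

text \<open>Trees are written in prefix order, so the input is read from its end.\<close>

lemma runs_parse_loop:
  assumes "s 0 = encode ys @ r" "s 1 = rev (enc_list xs) @ w" "w = [] \<or> hd w = 3"
  shows "runs parse_loop s (20 * length (enc_list xs) + 1) (s(0 := encode (xs @ ys) @ r, 1 := w))"
  using assms
proof (induction xs arbitrary: ys s rule: rev_induct)
  case Nil
  then show ?case unfolding parse_loop_def
    by (intro runs_eq[OF runs_WHILE_end]) (cases w; auto simp: tops_eq fun_eq_iff)+
next
  case (snoc v xs)
  let ?w = "rev (enc_list xs) @ w"
  let ?s1 = "s(1 := replicate v 1 @ ?w)"
  let ?s2 = "s(1 := replicate v 1 @ ?w, 0 := 1 # encode ys @ r)"
  let ?s3 = "s(1 := ?w, 0 := encode v @ encode ys @ r)"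
  let ?s4 = "s(1 := ?w, 0 := encode (v # ys) @ r)"
  have w: "?w = [] \<or> hd ?w \<noteq> 1" using snoc.prems(3) by (cases xs rule: rev_cases) auto
  have 1: "runs (Op 1 5) s 1 ?s1" using runs_pop[of 1 s] snoc.prems by simp
  have 2: "runs (Op 0 1) ?s1 1 ?s2" using runs_push[of 0 1 ?s1] snoc.prems by simp
  have 3: "runs parse_nat ?s2 (10 * v + 1) ?s3"
    by (rule runs_eq[OF runs_parse_nat[of ?s2 0 "encode ys @ r" v ?w]]) (use w in \<open>auto simp: fun_eq_iff\<close>)
  have 4: "runs (Op 0 2) ?s3 1 ?s4" using runs_push[of 0 2 ?s3] by simp
  have 5: "runs parse_loop ?s4 (20 * length (enc_list xs) + 1) (?s4(0 := encode (xs @ v # ys) @ r, 1 := w))"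
    by (rule snoc.IH) (use snoc.prems in auto)
  show ?case unfolding parse_loop_def
    by (rule runs_eq[OF runs_WHILE[OF _ runs_Seq[OF 1 runs_Seq[OF 2 runs_Seq[OF 3 4]]] 5[unfolded parse_loop_def]]])
      (use snoc.prems in \<open>auto simp: tops_eq fun_eq_iff\<close>)
qed

text \<open>After reversal onto stack 1 the list \<open>t\<close> comes first, as required to have
  its code below that of \<open>s\<close>. The two \<open>Op 0 1\<close> start empty lists,
  \<open>Op 1 5\<close> removes the separator 3 and the final \<open>Op 0 2\<close> forms the
  pair.\<close>

definition parse :: com where
  "parse = Seq (transfer 0 1) (Seq (Op 0 1) (Seq parse_loop (Seq (Op 1 5) (Seq (Op 0 1)
     (Seq parse_loop (Op 0 2))))))"

lemma enc_list_set: "set (enc_list xs) \<subseteq> {1,2}"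
  by (induction xs) auto

lemma enc_pair_set: "set (enc_pair s t) \<subseteq> {1,2,3}"
  using enc_list_set[of s] enc_list_set[of t] by (auto simp: enc_pair_def)

lemma runs_parse:
  "runs parse (main_stack (enc_pair s t)) (60 * length (enc_pair s t)) (main_stack (encode (s, t)))"
proof -
  let ?e = "enc_pair s t"
  let ?t0 = "main_stack ?e"
  let ?t1 = "(main_stack [])(1 := rev ?e)"
  let ?t2 = "(main_stack [1])(1 := rev ?e)"
  let ?t3 = "(main_stack (encode t))(1 := 3 # rev (enc_list s))"
  let ?t4 = "(main_stack (encode t))(1 := rev (enc_list s))"
  let ?t5 = "(main_stack (1 # encode t))(1 := rev (enc_list s))"
  let ?t6 = "main_stack (encode s @ encode t)"
  note m = main_stack_def fun_eq_iff
  have 1: "runs (transfer 0 1) ?t0 (10 * length ?e + 1) ?t1"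
    by (rule runs_eq[OF runs_transfer[OF _ enc_pair_set[of s t]]]) (auto simp: m)
  have 2: "runs (Op 0 1) ?t1 1 ?t2" by (rule runs_eq[OF runs_push]) (auto simp: m)
  have 3: "runs parse_loop ?t2 (20 * length (enc_list t) + 1) ?t3"
    by (rule runs_eq[OF runs_parse_loop[of _ "[]" "[]" t "3 # rev (enc_list s)"]])
      (auto simp: m enc_pair_def)
  have 4: "runs (Op 1 5) ?t3 1 ?t4" by (rule runs_eq[OF runs_pop]) (auto simp: m)
  have 5: "runs (Op 0 1) ?t4 1 ?t5" by (rule runs_eq[OF runs_push]) (auto simp: m)
  have 6: "runs parse_loop ?t5 (20 * length (enc_list s) + 1) ?t6"
    by (rule runs_eq[OF runs_parse_loop[of _ "[]" "encode t" s "[]"]]) (auto simp: m)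
  have 7: "runs (Op 0 2) ?t6 1 (main_stack (encode (s, t)))" by (rule runs_eq[OF runs_push]) (auto simp: m)
  show ?thesis unfolding parse_def
    by (rule runs_mono[OF runs_Seq[OF 1 runs_Seq[OF 2 runs_Seq[OF 3 runs_Seq[OF 4 runs_Seq[OF 5
            runs_Seq[OF 6 7]]]]]]]) (simp add: enc_pair_def)
qed

definition print_nat :: com where
  "print_nat = WHILE (\<lambda>f. f 0 = 2) (Seq (Op 0 5) (Seq (Op 0 5) (Op 1 1)))"

lemma runs_print_nat:
  assumes "s 0 = encode v @ r"
  shows "runs print_nat s (10 * v + 1) (s(0 := 1 # r, 1 := replicate v 1 @ s 1))"
  using assms
proof (induction v arbitrary: s)
  case 0
  then show ?case unfolding print_nat_def
    by (intro runs_eq[OF runs_WHILE_end]) (auto simp: tops_eq fun_eq_iff)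
next
  case (Suc v)
  let ?s1 = "s(0 := 1 # encode v @ r)"
  let ?s2 = "s(0 := encode v @ r)"
  let ?s3 = "s(0 := encode v @ r, 1 := 1 # s 1)"
  have 1: "runs (Op 0 5) s 1 ?s1" using runs_pop[of 0 s] Suc.prems by simp
  have 2: "runs (Op 0 5) ?s1 1 ?s2" using runs_pop[of 0 ?s1] by simp
  have 3: "runs (Op 1 1) ?s2 1 ?s3" using runs_push[of 1 1 ?s2] by simp
  have 4: "runs print_nat ?s3 (10 * v + 1) (?s3(0 := 1 # r, 1 := replicate v 1 @ ?s3 1))"
    by (rule Suc.IH) auto
  show ?case unfolding print_nat_def
    by (rule runs_eq[OF runs_WHILE[OF _ runs_Seq[OF 1 runs_Seq[OF 2 3]] 4[unfolded print_nat_def]]])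
      (use Suc.prems in \<open>auto simp: tops_eq fun_eq_iff replicate_app_Cons_same\<close>)
qed

text \<open>\<open>print_nat\<close> leaves the symbol 1, the code of 0; the second
  \<open>Op 0 5\<close> removes it before the terminator 2 is written.\<close>

definition print_loop :: com where
  "print_loop = WHILE (\<lambda>f. f 0 = 2) (Seq (Op 0 5) (Seq print_nat (Seq (Op 0 5) (Op 1 2))))"

lemma runs_print_loop:
  assumes "s 0 = encode (xs :: nat list) @ r"
  shows "runs print_loop s (20 * sz xs) (s(0 := 1 # r, 1 := rev (enc_list xs) @ s 1))"
  using assms
proof (induction xs arbitrary: s)
  case Nil
  then show ?case unfolding print_loop_def
    by (intro runs_eq[OF runs_WHILE_end]) (auto simp: tops_eq fun_eq_iff)
next
  case (Cons v xs)
  let ?s1 = "s(0 := encode v @ encode xs @ r)"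
  let ?s2 = "s(0 := 1 # encode xs @ r, 1 := replicate v 1 @ s 1)"
  let ?s3 = "s(0 := encode xs @ r, 1 := replicate v 1 @ s 1)"
  let ?s4 = "s(0 := encode xs @ r, 1 := 2 # replicate v 1 @ s 1)"
  have 1: "runs (Op 0 5) s 1 ?s1" using runs_pop[of 0 s] Cons.prems by simp
  have 2: "runs print_nat ?s1 (10 * v + 1) ?s2"
    by (rule runs_eq[OF runs_print_nat[of _ _ "encode xs @ r"]]) (auto simp: fun_eq_iff)
  have 3: "runs (Op 0 5) ?s2 1 ?s3" by (rule runs_eq[OF runs_pop]) (auto simp: fun_eq_iff)
  have 4: "runs (Op 1 2) ?s3 1 ?s4" by (rule runs_eq[OF runs_push]) (auto simp: fun_eq_iff)
  have 5: "runs print_loop ?s4 (20 * sz xs) (?s4(0 := 1 # r, 1 := rev (enc_list xs) @ ?s4 1))"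
    by (rule Cons.IH) auto
  show ?case unfolding print_loop_def
    by (rule runs_eq[OF runs_WHILE[OF _ runs_Seq[OF 1 runs_Seq[OF 2 runs_Seq[OF 3 4]]] 5[unfolded print_loop_def]]])
      (use Cons.prems in \<open>auto simp: tops_eq fun_eq_iff\<close>)
qed

definition print_list :: com where
  "print_list = Seq print_loop (Seq (Op 0 5) (transfer 1 0))"

lemma length_enc_list_le: "length (enc_list xs) < sz xs"
  by (induction xs) auto

lemma runs_print_list: "runs print_list (main_stack (encode xs)) (40 * sz xs) (main_stack (enc_list xs))"
proof -
  note m = main_stack_def fun_eq_iff
  let ?t1 = "(main_stack [1])(1 := rev (enc_list xs))"
  let ?t2 = "(main_stack [])(1 := rev (enc_list xs))"
  have 1: "runs print_loop (main_stack (encode xs)) (20 * sz xs) ?t1"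
    by (rule runs_eq[OF runs_print_loop[of _ xs "[]"]]) (auto simp: m)
  have 2: "runs (Op 0 5) ?t1 1 ?t2" by (rule runs_eq[OF runs_pop]) (auto simp: m)
  have "set (rev (enc_list xs)) \<subseteq> {1,2,3}" using enc_list_set[of xs] by auto
  then have 3: "runs (transfer 1 0) ?t2 (10 * length (rev (enc_list xs)) + 1) (main_stack (enc_list xs))"
    by (intro runs_eq[OF runs_transfer[of _ _ "rev (enc_list xs)"]]) (auto simp: m)
  show ?thesis unfolding print_list_def
    by (rule runs_mono[OF runs_Seq[OF 1 runs_Seq[OF 2 3]]])
      (use length_enc_list_le[of xs] in simp)
qed

text \<open>An entry \<open>v\<close> takes \<open>v + 1\<close> input symbols and contributes
  \<open>2 * v + 2\<close> to the tree code. This turns bounds in the size of trees into bounds in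
  the length of the input.\<close>

lemma sz_enc_list: "sz xs \<le> 2 * length (enc_list xs) + 1"
  by (induction xs) auto

theorem polytime_tm:
  fixes f :: "nat list \<times> nat list \<Rightarrow> nat list"
  assumes "polytime f"
  shows "\<exists>M c d. wf_tm M \<and>
    (\<forall>s t. \<exists>T. T \<le> c * length (enc_pair s t) ^ d + c \<and>
       cfg_state (tm_run M T (tm_init (enc_pair s t))) = 1 \<and>
       cfg_output (tm_run M T (tm_init (enc_pair s t))) = enc_list (f (s, t)))"
proof -
  obtain P h where P: "wfc P" "polybounded h" "computes P h f" by (rule ptE[OF assms])
  obtain a k where a: "\<And>x. h x \<le> a * sz x ^ k" using P(2) unfolding polybounded_def by blast
  obtain b l where b: "\<And>x. sz (f x) \<le> b * sz x ^ l" using polytime_size[OF assms] unfolding polybounded_def by blast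
  let ?prog = "Seq parse (Seq P print_list)"
  let ?n = "\<lambda>L::nat. 60 * L + (a * sz L ^ k + 40 * (b * sz L ^ l) + 1) + 1"
  have wf: "wfc ?prog"
    using P by (simp add: parse_def print_list_def transfer_def parse_loop_def parse_nat_def
        print_loop_def print_nat_def)
  obtain M where M: "wf_tm M"
    "\<And>w n w'. exec ?prog (main_stack w) n (main_stack w') \<Longrightarrow> set w \<subseteq> {1,2,3} \<Longrightarrow>
       \<exists>T \<le> n * (2 * (length w + n) + 2). cfg_state (tm_run M T (tm_init w)) = 1 \<and>
         cfg_output (tm_run M T (tm_init w)) = w'"
    by (rule compile[OF wf]) auto
  have "polybounded (\<lambda>L::nat. L)" by (rule polybounded_mono[OF polybounded_sz]) simp
  \<comment> \<open>The input length \<open>L\<close> is itself treated as an encodable number of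
    size \<open>2 * L + 1\<close>, so the closure rules of \<open>polybounded\<close> also serve for
    polynomials in \<open>L\<close>.\<close>
  then have "polybounded (\<lambda>L. ?n L * (2 * (L + ?n L) + 2))" by (intro polybounded_intros)
  then obtain c d where cd: "\<And>L. ?n L * (2 * (L + ?n L) + 2) \<le> c * sz L ^ d"
    unfolding polybounded_def by blast
  have "\<exists>T. T \<le> c * 3 ^ d * length (enc_pair s t) ^ d + c * 3 ^ d \<and>
       cfg_state (tm_run M T (tm_init (enc_pair s t))) = 1 \<and>
       cfg_output (tm_run M T (tm_init (enc_pair s t))) = enc_list (f (s, t))" for s t
  proof -
    let ?w = "enc_pair s t"
    let ?L = "length ?w"
    let ?x = "(s, t)"
    have x: "sz ?x \<le> sz ?L"
      using sz_enc_list[of s] sz_enc_list[of t] by (simp add: enc_pair_def)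
    have "h ?x \<le> a * sz ?L ^ k" using a[of ?x] x
      by (meson mult_le_mono2 order_trans power_mono zero_le)
    then have 2: "runs P (main_stack (encode ?x)) (a * sz ?L ^ k) (main_stack (encode (f ?x)))"
      by (intro runs_eq[OF computesD[OF P(3), of _ ?x "[]"]]) (auto simp: main_stack_def fun_eq_iff)
    have "sz (f ?x) \<le> b * sz ?L ^ l" using b[of ?x] x
      by (meson mult_le_mono2 order_trans power_mono zero_le)
    then have 3: "runs print_list (main_stack (encode (f ?x))) (40 * (b * sz ?L ^ l)) (main_stack (enc_list (f ?x)))"
      by (intro runs_mono[OF runs_print_list]) simp
    have "runs ?prog (main_stack ?w) (?n ?L) (main_stack (enc_list (f ?x)))"
      by (rule runs_mono[OF runs_Seq[OF runs_parse runs_Seq[OF 2 3]]]) simp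
    then obtain n where n: "n \<le> ?n ?L" "exec ?prog (main_stack ?w) n (main_stack (enc_list (f ?x)))"
      unfolding runs_def by blast
    obtain T where T: "T \<le> n * (2 * (?L + n) + 2)" "cfg_state (tm_run M T (tm_init ?w)) = 1"
      "cfg_output (tm_run M T (tm_init ?w)) = enc_list (f ?x)"
      using M(2)[OF n(2) enc_pair_set] by blast
    have "n * (2 * (?L + n) + 2) \<le> ?n ?L * (2 * (?L + ?n ?L) + 2)"
      by (intro mult_le_mono add_le_mono n(1) order_refl)
    also have "\<dots> \<le> c * sz ?L ^ d" by (rule cd)
    \<comment> \<open>The separator makes \<open>?L\<close> positive, so its size
      \<open>2 * ?L + 1\<close> is at most \<open>3 * ?L\<close>; this is the origin of the factor
      \<open>3 ^ d\<close>.\<close>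
    also have "\<dots> \<le> c * (3 * ?L) ^ d"
      by (intro mult_le_mono2 power_mono) (auto simp: enc_pair_def)
    also have "\<dots> \<le> c * 3 ^ d * ?L ^ d + c * 3 ^ d" by (simp add: power_mult_distrib)
    finally show ?thesis using T by (intro exI[of _ T]) linarith
  qed
  then show ?thesis using M(1) by blast
qed

section \<open>Separable permutations\<close>

text \<open>The first conjunct excludes 3142, the second 2413. It is stated for words, because
  factors and subsequences of a permutation are no longer permutations.\<close>

definition avoiding :: "nat list \<Rightarrow> bool" where
  "avoiding w \<longleftrightarrow> (\<forall>a b c d. a < b \<and> b < c \<and> c < d \<and> d < length w \<longrightarrow>
     \<not> (w ! b < w ! d \<and> w ! d < w ! a \<and> w ! a < w ! c) \<and>
     \<not> (w ! c < w ! a \<and> w ! a < w ! d \<and> w ! d < w ! b))"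

lemma is_patternI4:
  assumes "a < b" "b < c" "c < d" "d < length w"
    and "\<And>l m. l < 4 \<Longrightarrow> m < 4 \<Longrightarrow> p ! l < p ! m \<Longrightarrow> w ! ([a,b,c,d] ! l) < w ! ([a,b,c,d] ! m)"
    and "length p = 4"
  shows "is_pattern p w"
  unfolding is_pattern_def
proof (intro exI[of _ "\<lambda>l. [a,b,c,d] ! l"] conjI allI impI)
  fix l m assume lm: "l < m \<and> m < length p"
  then have "m = 1 \<or> m = 2 \<or> m = 3" "l = 0 \<or> l = 1 \<or> l = 2" using assms(6) by auto
  then show "[a,b,c,d] ! l < [a,b,c,d] ! m" using lm assms(1-3) by auto
next
  fix l assume "l < length p"
  then have "l = 0 \<or> l = 1 \<or> l = 2 \<or> l = 3" using assms(6) by auto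
  then show "[a,b,c,d] ! l < length w" using assms(1-4) by auto
qed (use assms(5,6) in auto)

lemma separable_avoiding:
  assumes "separable s"
  shows "avoiding s"
  unfolding avoiding_def
proof (intro allI impI conjI notI)
  fix a b c d assume i: "a < b \<and> b < c \<and> c < d \<and> d < length s"
  {
    assume p: "s ! b < s ! d \<and> s ! d < s ! a \<and> s ! a < s ! c"
    have "is_pattern [3,1,4,2] s"
      by (rule is_patternI4[of a b c d])
        (use i p in \<open>auto simp: less_Suc_eq numeral_eq_Suc\<close>)
    then show False using assms by (simp add: separable_def)
  next
    assume p: "s ! c < s ! a \<and> s ! a < s ! d \<and> s ! d < s ! b"
    have "is_pattern [2,4,1,3] s"
      by (rule is_patternI4[of a b c d])
        (use i p in \<open>auto simp: less_Suc_eq numeral_eq_Suc\<close>)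
    then show False using assms by (simp add: separable_def)
  }
qed

lemma avoiding_reindex:
  assumes "avoiding w" "\<And>l m. l < m \<Longrightarrow> m < length v \<Longrightarrow> i l < i m"
    "\<And>l. l < length v \<Longrightarrow> i l < length w \<and> v ! l = w ! i l"
  shows "avoiding v"
  unfolding avoiding_def
proof (intro allI impI)
  fix a b c d assume l: "a < b \<and> b < c \<and> c < d \<and> d < length v"
  then have "i a < i b \<and> i b < i c \<and> i c < i d \<and> i d < length w" using assms(2,3) by auto
  moreover have "v ! a = w ! i a" "v ! b = w ! i b" "v ! c = w ! i c" "v ! d = w ! i d"
    using l assms(3) by auto
  ultimately show "\<not> (v ! b < v ! d \<and> v ! d < v ! a \<and> v ! a < v ! c) \<and>
     \<not> (v ! c < v ! a \<and> v ! a < v ! d \<and> v ! d < v ! b)"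
    using assms(1) unfolding avoiding_def by metis
qed

lemma avoiding_append:
  assumes "avoiding (u @ v)"
  shows "avoiding u" "avoiding v"
  by (rule avoiding_reindex[OF assms, of _ "\<lambda>l. l"]; simp add: nth_append)
    (rule avoiding_reindex[OF assms, of _ "\<lambda>l. length u + l"]; simp)

text \<open>Take the longest prefix satisfying \<open>P\<close>. If some later entry satisfies
  \<open>P\<close> again, it forms the inversion with the first entry after the prefix.\<close>

lemma partition_or_inversion:
  obtains p q where "p < q" "q < length A" "\<not> P (A ! p)" "P (A ! q)"
  | L H where "A = L @ H" "\<forall>x\<in>set L. P x" "\<forall>x\<in>set H. \<not> P x"
proof (cases "\<forall>x\<in>set (dropWhile P A). \<not> P x")
  case True
  then show ?thesis using that(2)[of "takeWhile P A" "dropWhile P A"]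
    by (auto dest: set_takeWhileD)
next
  case False
  let ?n = "length (takeWhile P A)"
  obtain j where j: "j < length (dropWhile P A)" "P (dropWhile P A ! j)"
    using False by (auto simp: in_set_conv_nth)
  then have ne: "dropWhile P A \<noteq> []" by (metis less_nat_zero_code list.size(3))
  have d: "dropWhile P A ! k = A ! (?n + k)" for k
    by (metis nth_append_length_plus takeWhile_dropWhile_id)
  have l: "?n + length (dropWhile P A) = length A"
    by (metis length_append takeWhile_dropWhile_id)
  have "\<not> P (A ! ?n)" using hd_dropWhile[OF ne] d[of 0] ne by (simp add: hd_conv_nth)
  moreover from this have "j \<noteq> 0" using j d[of 0] by (metis add_0_right)
  ultimately show ?thesis using that(1)[of ?n "?n + j"] j l d by simp
qed

text \<open>Induction on the last letter \<open>z\<close>: it either extends the split of the rest or, unless the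
  pattern 3142 (resp. 2413) occurs, cuts the left part of that split into two.\<close>

lemma avoiding_splits:
  assumes "avoiding w" "distinct w" "2 \<le> length w"
  shows "\<exists>u v. w = u @ v \<and> u \<noteq> [] \<and> v \<noteq> [] \<and>
    ((\<forall>x\<in>set u. \<forall>y\<in>set v. x < y) \<or> (\<forall>x\<in>set u. \<forall>y\<in>set v. y < x))"
  using assms
proof (induction w rule: rev_induct)
  case (snoc z w')
  show ?case
  proof (cases "2 \<le> length w'")
    case False
    then have "length w' = Suc 0" using snoc.prems(3) by simp
    then obtain x where "w' = [x]" by (auto simp: length_Suc_conv)
    then show ?thesis using snoc.prems(2)
      by (intro exI[of _ "[x]"] exI[of _ "[z]"]) auto
  next
    case True
    obtain A B where AB: "w' = A @ B" "A \<noteq> []" "B \<noteq> []"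
      "(\<forall>x\<in>set A. \<forall>y\<in>set B. x < y) \<or> (\<forall>x\<in>set A. \<forall>y\<in>set B. y < x)"
      using snoc.IH[OF avoiding_append(1)[OF snoc.prems(1)]] snoc.prems(2) True by auto
    let ?n = "length A" and ?m = "length A + length B"
    have nth: "(w' @ [z]) ! ?n = hd B" "(w' @ [z]) ! ?m = z" "?n < ?m" "?m < length (w' @ [z])"
      "\<And>i. i < ?n \<Longrightarrow> (w' @ [z]) ! i = A ! i"
      using AB by (auto simp: nth_append hd_conv_nth)
    have hdB: "hd B \<in> set B" using AB by simp
    have zA: "x \<noteq> z" if "x \<in> set A" for x using snoc.prems(2) AB that by auto
    from AB(4) show ?thesis
    proof
      assume lt: "\<forall>x\<in>set A. \<forall>y\<in>set B. x < y"
      show ?thesis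
      proof (rule partition_or_inversion[of A "\<lambda>x. x < z"])
        fix p q assume pq: "p < q" "q < length A" "\<not> A ! p < z" "A ! q < z"
        have "A ! p \<in> set A" using pq by simp
        \<comment> \<open>The letters \<open>A ! p\<close>, \<open>A ! q\<close>,
          \<open>hd B\<close>, \<open>z\<close> form 3142.\<close>
        then have "z < A ! p" "A ! p < hd B" using zA[of "A ! p"] pq lt hdB by auto
        then show ?thesis
          using snoc.prems(1)[unfolded avoiding_def, rule_format, of p q ?n ?m] pq nth(1-4) nth(5)[of p] nth(5)[of q]
          by simp
      next
        fix L H assume LH: "A = L @ H" "\<forall>x\<in>set L. x < z" "\<forall>x\<in>set H. \<not> x < z"
        have H: "z < x" if "x \<in> set H" for x using zA[of x] LH that by auto
        show ?thesis
        proof (cases "L = []")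
          case True
          \<comment> \<open>Now \<open>z\<close> lies below every earlier letter and is split off
            alone.\<close>
          then have "\<forall>x\<in>set A. z < x" using LH H by auto
          moreover from this have "\<forall>x\<in>set B. z < x"
            using lt hd_in_set[OF AB(2)] order_less_trans by blast
          ultimately have "\<forall>x\<in>set w'. z < x" using AB(1) by auto
          moreover have "w' \<noteq> []" using AB(1,2) by simp
          ultimately show ?thesis by (intro exI[of _ w'] exI[of _ "[z]"]) simp
        next
          case False
          \<comment> \<open>Everything after \<open>L\<close> lies above \<open>L\<close>. For empty
            \<open>H\<close> this is the old split with \<open>z\<close> joined to
            \<open>B\<close>.\<close>
          have "x < y" if x: "x \<in> set L" and y: "y \<in> set (H @ B @ [z])" for x y
          proof -
            from y consider "y \<in> set H" | "y \<in> set B" | "y = z" unfolding set_append by fastforce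
            then show ?thesis
            proof cases
              case 1
              then show ?thesis using order_less_trans[of x z y] H LH(2) x by blast
            next
              case 2
              then show ?thesis using lt x LH(1) by auto
            next
              case 3
              then show ?thesis using LH(2) x by auto
            qed
          qed
          with False show ?thesis using AB(1) LH(1)
            by (intro exI[of _ L] exI[of _ "H @ B @ [z]"]) auto
        qed
      qed
    next
      assume gt: "\<forall>x\<in>set A. \<forall>y\<in>set B. y < x"
      show ?thesis
      proof (rule partition_or_inversion[of A "\<lambda>x. z < x"])
        fix p q assume pq: "p < q" "q < length A" "\<not> z < A ! p" "z < A ! q"
        have "A ! p \<in> set A" using pq by simp
        \<comment> \<open>Here the same four positions carry 2413.\<close>
        then have "A ! p < z" "hd B < A ! p" using zA[of "A ! p"] pq gt hdB by auto
        then show ?thesis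
          using snoc.prems(1)[unfolded avoiding_def, rule_format, of p q ?n ?m] pq nth(1-4) nth(5)[of p] nth(5)[of q]
          by simp
      next
        fix L H assume LH: "A = L @ H" "\<forall>x\<in>set L. z < x" "\<forall>x\<in>set H. \<not> z < x"
        have H: "x < z" if "x \<in> set H" for x using zA[of x] LH that by auto
        show ?thesis
        proof (cases "L = []")
          case True
          then have "\<forall>x\<in>set A. x < z" using LH H by auto
          moreover from this have "\<forall>x\<in>set B. x < z"
            using gt hd_in_set[OF AB(2)] order_less_trans by blast
          ultimately have "\<forall>x\<in>set w'. x < z" using AB(1) by auto
          moreover have "w' \<noteq> []" using AB(1,2) by simp
          ultimately show ?thesis by (intro exI[of _ w'] exI[of _ "[z]"]) simp
        next
          case False
          have "y < x" if x: "x \<in> set L" and y: "y \<in> set (H @ B @ [z])" for x y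
          proof -
            from y consider "y \<in> set H" | "y \<in> set B" | "y = z" unfolding set_append by fastforce
            then show ?thesis
            proof cases
              case 1
              then show ?thesis using order_less_trans[of y z x] H LH(2) x by blast
            next
              case 2
              then show ?thesis using gt x LH(1) by auto
            next
              case 3
              then show ?thesis using LH(2) x by auto
            qed
          qed
          with False show ?thesis using AB(1) LH(1)
            by (intro exI[of _ L] exI[of _ "H @ B @ [z]"]) auto
        qed
      qed
    qed
  qed
qed simp

section \<open>The dynamic program\<close>

definition le2 :: "nat \<times> nat \<Rightarrow> nat \<times> nat \<Rightarrow> bool" where
  "le2 p q \<longleftrightarrow> fst p \<le> fst q \<and> snd p \<le> snd q"

definition lt2 :: "nat \<times> nat \<Rightarrow> nat \<times> nat \<Rightarrow> bool" where
  "lt2 p q \<longleftrightarrow> fst p < fst q \<and> snd p < snd q"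

text \<open>A point is a pair (positions, values), each a pair of one coordinate for \<open>s\<close> and one for
  \<open>t\<close>. A box \<open>((P0, P1), (V0, V1))\<close> is half-open in all four coordinates.\<close>

type_synonym point = "(nat \<times> nat) \<times> (nat \<times> nat)"
type_synonym box = "((nat \<times> nat) \<times> (nat \<times> nat)) \<times> ((nat \<times> nat) \<times> (nat \<times> nat))"

text \<open>A point matches one position of \<open>s\<close> with one of \<open>t\<close>, so a
  common pattern is a list of points and not a pair of embeddings.\<close>

definition points :: "nat list \<Rightarrow> nat list \<Rightarrow> point list" where
  "points s t = map (\<lambda>e. ((fst (fst e), fst (snd e)), (snd (fst e), snd (snd e))))
     (List.product (enumerate 0 s) (enumerate 0 t))"

definition in_box :: "box \<Rightarrow> point \<Rightarrow> bool" where
  "in_box k e \<longleftrightarrow> le2 (fst (fst k)) (fst e) \<and> lt2 (fst e) (snd (fst k)) \<and>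
     le2 (fst (snd k)) (snd e) \<and> lt2 (snd e) (snd (snd k))"

definition grid :: "nat \<Rightarrow> (nat \<times> nat) list" where
  "grid n = List.product [0..<Suc n] [0..<Suc n]"

definition boxes :: "nat \<Rightarrow> box list" where
  "boxes n = List.product (List.product (grid n) (grid n)) (List.product (grid n) (grid n))"

definition cuts :: "nat \<Rightarrow> box \<Rightarrow> ((nat \<times> nat) \<times> (nat \<times> nat)) list" where
  "cuts n k = filter (\<lambda>c. (le2 (fst (fst k)) (fst c) \<and> le2 (fst c) (snd (fst k))) \<and>
       (le2 (fst (snd k)) (snd c) \<and> le2 (snd c) (snd (snd k))))
     (List.product (grid n) (grid n))"

type_synonym dptable = "(box \<times> nat list) list"

text \<open>The default \<open>[]\<close> is a common pattern for every box, so a missing key is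
  sound and the rounds can start from the empty table.\<close>

definition table_lookup :: "dptable \<Rightarrow> box \<Rightarrow> nat list" where
  "table_lookup F k = fold (\<lambda>e w. if fst e = k then snd e else w) F []"

definition longest :: "nat list list \<Rightarrow> nat list" where
  "longest ws = fold (\<lambda>w z. if length z \<le> length w then w else z) ws []"

definition candidates :: "nat list \<Rightarrow> nat list \<Rightarrow> nat \<Rightarrow> dptable \<Rightarrow> box \<Rightarrow> nat list list" where
  "candidates s t n F k =
     map (\<lambda>e. [fst (snd e)]) (filter (\<lambda>e. in_box k e) (points s t)) @
     map (\<lambda>c. table_lookup F ((fst (fst k), fst c), (fst (snd k), snd c)) @
              table_lookup F ((fst c, snd (fst k)), (snd c, snd (snd k)))) (cuts n k) @
     map (\<lambda>c. table_lookup F ((fst (fst k), fst c), (snd c, snd (snd k))) @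
              table_lookup F ((fst c, snd (fst k)), (fst (snd k), snd c))) (cuts n k)"

definition refine :: "nat list \<Rightarrow> nat list \<Rightarrow> nat \<Rightarrow> dptable \<Rightarrow> dptable" where
  "refine s t n F = map (\<lambda>k. (k, longest (candidates s t n F k))) (boxes n)"

text \<open>Strictly above all positions and values of both permutations, as upper corners of
  half-open boxes must be, and at least the length of any common pattern, as needed for the number
  of rounds.\<close>

definition bound :: "nat list \<Rightarrow> nat list \<Rightarrow> nat" where
  "bound s t = Suc (length (s @ t))"

text \<open>Iteration is written as a fold over a unary list to fit
  \<open>polytime_fold\<close>.\<close>

definition rounds :: "nat list \<Rightarrow> nat list \<Rightarrow> nat \<Rightarrow> nat \<Rightarrow> dptable" where
  "rounds s t n r = fold (\<lambda>_ F. refine s t n F) (replicate r ()) []"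

definition top_box :: "nat \<Rightarrow> box" where
  "top_box n = (((0, 0), (n, n)), ((0, 0), (n, n)))"

definition lcs_word :: "nat list \<Rightarrow> nat list \<Rightarrow> nat list" where
  "lcs_word s t = table_lookup (rounds s t (bound s t) (bound s t)) (top_box (bound s t))"

text \<open>The standardisation of a word with distinct letters. Each letter counts itself, so ranks
  start at 1.\<close>

definition ranks :: "nat list \<Rightarrow> nat list" where
  "ranks w = map (\<lambda>x. length (filter (\<lambda>y. y \<le> x) w)) w"

text \<open>The condition for two matches to occur, in this order, in one common pattern.\<close>

definition compatible :: "point \<Rightarrow> point \<Rightarrow> bool" where
  "compatible e f \<longleftrightarrow> lt2 (fst e) (fst f) \<and> (lt2 (snd e) (snd f) \<or> lt2 (snd f) (snd e))"

definition common :: "nat list \<Rightarrow> nat list \<Rightarrow> box \<Rightarrow> point list \<Rightarrow> bool" where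
  "common s t k es \<longleftrightarrow> sorted_wrt compatible es \<and> set es \<subseteq> set (points s t) \<and> (\<forall>e\<in>set es. in_box k e)"

definition word :: "point list \<Rightarrow> nat list" where
  "word es = map (\<lambda>e. fst (snd e)) es"

text \<open>The table stores only the values taken from \<open>s\<close>; the matching occurrence in
  \<open>t\<close> survives in the existential quantifier alone.\<close>

definition sound :: "nat list \<Rightarrow> nat list \<Rightarrow> box \<Rightarrow> nat list \<Rightarrow> bool" where
  "sound s t k w \<longleftrightarrow> (\<exists>es. common s t k es \<and> w = word es)"

section \<open>Soundness of the table\<close>

lemma in_points:
  "((i, j), (x, y)) \<in> set (points s t) \<longleftrightarrow> i < length s \<and> j < length t \<and> x = s ! i \<and> y = t ! j"
proof
  assume "((i, j), (x, y)) \<in> set (points s t)"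
  then obtain e f where "e \<in> set (enumerate 0 s)" "f \<in> set (enumerate 0 t)"
    "((i, j), (x, y)) = ((fst e, fst f), (snd e, snd f))"
    unfolding points_def by auto
  then show "i < length s \<and> j < length t \<and> x = s ! i \<and> y = t ! j"
    by (simp add: in_set_enumerate_eq)
next
  assume "i < length s \<and> j < length t \<and> x = s ! i \<and> y = t ! j"
  then have "((i, x), (j, y)) \<in> set (List.product (enumerate 0 s) (enumerate 0 t))"
    by (simp add: in_set_enumerate_eq)
  then show "((i, j), (x, y)) \<in> set (points s t)" unfolding points_def by force
qed

lemma sound_Nil: "sound s t k []"
  unfolding sound_def common_def word_def by (intro exI[of _ "[]"]) auto

text \<open>Lower bounds of boxes are weak and upper bounds strict, so a point of the first quadrant
  is strictly below one of the second in all four coordinates. The \<open>le2\<close> hypotheses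
  place both quadrants inside the large box.\<close>

lemma sound_direct:
  assumes "sound s t ((P0, C), (V0, D)) u" "sound s t ((C, P1), (D, V1)) v"
    "le2 P0 C" "le2 C P1" "le2 V0 D" "le2 D V1"
  shows "sound s t ((P0, P1), (V0, V1)) (u @ v)"
proof -
  obtain es fs where "common s t ((P0, C), (V0, D)) es" "u = word es"
    "common s t ((C, P1), (D, V1)) fs" "v = word fs"
    using assms(1,2) unfolding sound_def by blast
  then have "common s t ((P0, P1), (V0, V1)) (es @ fs)" "u @ v = word (es @ fs)"
    using assms(3-) by (auto 0 4 simp: common_def sorted_wrt_append in_box_def compatible_def
        le2_def lt2_def word_def)
  then show ?thesis unfolding sound_def by blast
qed

lemma sound_skew:
  assumes "sound s t ((P0, C), (D, V1)) u" "sound s t ((C, P1), (V0, D)) v"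
    "le2 P0 C" "le2 C P1" "le2 V0 D" "le2 D V1"
  shows "sound s t ((P0, P1), (V0, V1)) (u @ v)"
proof -
  obtain es fs where "common s t ((P0, C), (D, V1)) es" "u = word es"
    "common s t ((C, P1), (V0, D)) fs" "v = word fs"
    using assms(1,2) unfolding sound_def by blast
  then have "common s t ((P0, P1), (V0, V1)) (es @ fs)" "u @ v = word (es @ fs)"
    using assms(3-) by (auto 0 4 simp: common_def sorted_wrt_append in_box_def compatible_def
        le2_def lt2_def word_def)
  then show ?thesis unfolding sound_def by blast
qed

lemma longest_cases: "longest ws = [] \<or> longest ws \<in> set ws"
  and length_le_longest: "w \<in> set ws \<Longrightarrow> length w \<le> length (longest ws)"
proof -
  let ?f = "\<lambda>w z. if length z \<le> length w then w else (z :: nat list)"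
  have "(fold ?f ws z = z \<or> fold ?f ws z \<in> set ws) \<and>
      (\<forall>w\<in>insert z (set ws). length w \<le> length (fold ?f ws z))" for z
  proof (induction ws arbitrary: z)
    case (Cons a ws)
    show ?case using Cons[of "?f a z"] by (auto split: if_splits)
  qed simp
  then show "longest ws = [] \<or> longest ws \<in> set ws"
    "w \<in> set ws \<Longrightarrow> length w \<le> length (longest ws)"
    unfolding longest_def by blast+
qed

lemma table_lookup_cases: "table_lookup F k = [] \<or> (k, table_lookup F k) \<in> set F"
proof -
  have "fold (\<lambda>e w. if fst e = k then snd e else w) F z = z \<or>
      (k, fold (\<lambda>e w. if fst e = k then snd e else w) F z) \<in> set F" for z
  proof (induction F arbitrary: z)
    case (Cons e F)
    show ?case using Cons[of "if fst e = k then snd e else z"] by (cases e) auto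
  qed simp
  then show ?thesis unfolding table_lookup_def by blast
qed

lemma table_lookup_map: "k \<in> set ks \<Longrightarrow> table_lookup (map (\<lambda>k. (k, f k)) ks) k = f k"
proof -
  let ?g = "\<lambda>e w. if fst e = k then snd e else w"
  have "k \<in> set ks \<or> z = f k \<Longrightarrow> fold ?g (map (\<lambda>k. (k, f k)) ks) z = f k" for z
    by (induction ks arbitrary: z) auto
  then show "k \<in> set ks \<Longrightarrow> ?thesis" unfolding table_lookup_def by blast
qed

lemma sound_candidates:
  assumes F: "\<And>k. sound s t k (table_lookup F k)" and w: "w \<in> set (candidates s t n F k)"
  shows "sound s t k w"
proof -
  obtain P0 P1 V0 V1 where k: "k = ((P0, P1), (V0, V1))" by (metis prod.exhaust)
  consider e where "e \<in> set (points s t)" "in_box k e" "w = [fst (snd e)]"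
    | c where "c \<in> set (cuts n k)" "w = table_lookup F ((P0, fst c), (V0, snd c)) @
              table_lookup F ((fst c, P1), (snd c, V1))"
    | c where "c \<in> set (cuts n k)" "w = table_lookup F ((P0, fst c), (snd c, V1)) @
              table_lookup F ((fst c, P1), (V0, snd c))"
    using w unfolding candidates_def k by auto
  then show ?thesis
  proof cases
    case 1
    then have "common s t k [e]" by (simp add: common_def)
    then show ?thesis using 1 unfolding sound_def word_def by (intro exI[of _ "[e]"]) simp
  next
    case 2
    then show ?thesis unfolding k by (auto simp: cuts_def intro!: sound_direct F)
  next
    case 3
    then show ?thesis unfolding k by (auto simp: cuts_def intro!: sound_skew F)
  qed
qed

lemma sound_refine:
  assumes "\<And>k. sound s t k (table_lookup F k)"
  shows "\<forall>e\<in>set (refine s t n F). sound s t (fst e) (snd e)"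
proof -
  have "sound s t k (longest (candidates s t n F k))" for k
    using sound_candidates[OF assms] longest_cases[of "candidates s t n F k"] sound_Nil[of s t k]
    by (elim disjE) simp_all
  then show ?thesis by (simp add: refine_def)
qed

lemma rounds_0: "rounds s t n 0 = []"
  and rounds_Suc: "rounds s t n (Suc r) = refine s t n (rounds s t n r)"
proof -
  show "rounds s t n 0 = []" by (simp add: rounds_def)
  have "fold (\<lambda>_ F. refine s t n F) (replicate r ()) (refine s t n F) =
      refine s t n (fold (\<lambda>_ F. refine s t n F) (replicate r ()) F)" for F
    by (induction r arbitrary: F) auto
  then show "rounds s t n (Suc r) = refine s t n (rounds s t n r)" by (simp add: rounds_def)
qed

lemma sound_rounds: "\<forall>e\<in>set (rounds s t n r). sound s t (fst e) (snd e)"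
proof (induction r)
  case (Suc r)
  have "sound s t k (table_lookup (rounds s t n r) k)" for k
    using table_lookup_cases[of "rounds s t n r" k]
  proof
    assume "(k, table_lookup (rounds s t n r) k) \<in> set (rounds s t n r)"
    from bspec[OF Suc this] show ?thesis by simp
  qed (simp add: sound_Nil)
  then show ?case unfolding rounds_Suc by (rule sound_refine)
qed (simp add: rounds_0)

lemma sound_lookup: "sound s t k (table_lookup (rounds s t n r) k)"
  using table_lookup_cases[of "rounds s t n r" k]
proof
  assume "(k, table_lookup (rounds s t n r) k) \<in> set (rounds s t n r)"
  from bspec[OF sound_rounds this] show ?thesis by simp
qed (simp add: sound_Nil)

lemma common_length:
  assumes "common s t k es"
  shows "length es \<le> length s"
proof -
  have "sorted_wrt (<) (map (\<lambda>e. fst (fst e)) es)"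
    using assms unfolding common_def sorted_wrt_map
    by (elim conjE, elim sorted_wrt_mono_rel[rotated]) (simp add: compatible_def lt2_def)
  then have "distinct (map (\<lambda>e. fst (fst e)) es)" by (simp add: strict_sorted_iff)
  then have "card (set (map (\<lambda>e. fst (fst e)) es)) = length es" by (simp only: distinct_card length_map)
  moreover have "set (map (\<lambda>e. fst (fst e)) es) \<subseteq> {..<length s}"
    using assms unfolding common_def by (auto dest!: subsetD simp: in_points)
  then have "card (set (map (\<lambda>e. fst (fst e)) es)) \<le> card {..<length s}"
    by (rule card_mono[OF finite_lessThan])
  ultimately show ?thesis by simp
qed

text \<open>Bounds every stored word independently of the number of rounds; the size estimate
  \<open>sz_rounds\<close> rests on this.\<close>

lemma sound_word:
  assumes "sound s t k w"
  shows "length w \<le> length s" "set w \<subseteq> set s"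
proof -
  obtain es where es: "common s t k es" "w = word es" using assms sound_def by blast
  then show "length w \<le> length s" using common_length by (simp add: word_def)
  show "set w \<subseteq> set s"
    using es unfolding common_def word_def by (auto dest!: subsetD simp: in_points)
qed

section \<open>Completeness of the table\<close>

lemma in_grid: "p \<in> set (grid n) \<longleftrightarrow> le2 p (n, n)"
  by (cases p) (simp add: grid_def le2_def less_Suc_eq_le del: upt_Suc)

lemma in_boxes: "k \<in> set (boxes n) \<longleftrightarrow> le2 (fst (fst k)) (n, n) \<and> le2 (snd (fst k)) (n, n) \<and>
    le2 (fst (snd k)) (n, n) \<and> le2 (snd (snd k)) (n, n)"
  by (simp add: boxes_def in_grid mem_Times_iff)

lemma in_cuts: "c \<in> set (cuts n k) \<longleftrightarrow> le2 (fst c) (n, n) \<and> le2 (snd c) (n, n) \<and>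
    le2 (fst (fst k)) (fst c) \<and> le2 (fst c) (snd (fst k)) \<and>
    le2 (fst (snd k)) (snd c) \<and> le2 (snd c) (snd (snd k))"
  by (simp add: cuts_def in_grid mem_Times_iff conj_ac)

text \<open>The value cut, chosen separately in \<open>s\<close> and \<open>t\<close>: the least
  value of the upper part. With half-open boxes the upper part starts at the cut and the lower part
  stays strictly below it.\<close>

definition low :: "point list \<Rightarrow> nat \<times> nat" where
  "low es = (Min ((\<lambda>e. fst (snd e)) ` set es), Min ((\<lambda>e. snd (snd e)) ` set es))"

lemma low_le: "e \<in> set es \<Longrightarrow> le2 (low es) (snd e)"
  unfolding low_def le2_def fst_conv snd_conv by (intro conjI Min_le finite_imageI finite_set imageI)

lemma lt_low: "es \<noteq> [] \<Longrightarrow> (\<And>e. e \<in> set es \<Longrightarrow> lt2 v (snd e)) \<Longrightarrow> lt2 v (low es)"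
  by (simp add: low_def lt2_def)

lemma sorted_wrt_neq_distinct: "sorted_wrt (\<noteq>) xs \<Longrightarrow> distinct xs"
  by (induction xs) auto

text \<open>Only lengths are compared, since the table may hold another word than
  \<open>word es\<close>. The two parts of \<open>es\<close> can therefore be replaced independently
  by the words stored for their boxes.\<close>

lemma complete_rounds:
  assumes "common s t k es" "avoiding (word es)" "k \<in> set (boxes n)" "length es \<le> r"
  shows "length es \<le> length (table_lookup (rounds s t n r) k)"
  using assms
proof (induction r arbitrary: k es)
  case (Suc r)
  obtain P0 P1 V0 V1 where k: "k = ((P0, P1), (V0, V1))" by (metis prod.exhaust)
  let ?F = "rounds s t n r"
  have eq: "table_lookup (rounds s t n (Suc r)) k = longest (candidates s t n ?F k)"
    unfolding rounds_Suc refine_def by (rule table_lookup_map[OF Suc.prems(3)])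
  have ex: "\<exists>w\<in>set (candidates s t n ?F k). length es \<le> length w" if ne: "es \<noteq> []"
  proof (cases "length es = 1")
    case True
    then obtain e where "es = [e]" by (auto simp: length_Suc_conv)
    then have "[fst (snd e)] \<in> set (candidates s t n ?F k)"
      using Suc.prems(1) by (auto simp: candidates_def common_def)
    then show ?thesis using True by force
  next
    case False
    have srt: "sorted_wrt compatible es" using Suc.prems(1) by (simp add: common_def)
    have "sorted_wrt (\<noteq>) (word es)"
      using srt unfolding word_def sorted_wrt_map
      by (elim sorted_wrt_mono_rel[rotated]) (auto simp: compatible_def lt2_def)
    then have d: "distinct (word es)" by (rule sorted_wrt_neq_distinct)
    have l: "2 \<le> length (word es)" using False ne by (cases es) (auto simp: word_def Suc_le_eq)
    obtain u v where uv: "word es = u @ v" "u \<noteq> []" "v \<noteq> []"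
      "(\<forall>x\<in>set u. \<forall>y\<in>set v. x < y) \<or> (\<forall>x\<in>set u. \<forall>y\<in>set v. y < x)"
      using avoiding_splits[OF Suc.prems(2) d l] by (elim exE conjE)
    obtain as bs where ab: "es = as @ bs" "word as = u" "word bs = v"
      using uv(1) unfolding word_def map_eq_append_conv by blast
    have nonempty: "as \<noteq> []" "bs \<noteq> []" using ab(2,3) uv(2,3) by (auto simp: word_def)
    have av: "avoiding (word as)" "avoiding (word bs)"
      using avoiding_append[OF Suc.prems(2)[unfolded uv(1)]] by (simp_all add: ab)
    \<comment> \<open>Both parts are nonempty, so each is shorter than \<open>es\<close> and falls
      under the previous round.\<close>
    have len: "length as \<le> r" "length bs \<le> r"
      using Suc.prems(4) length_greater_0_conv[of as] length_greater_0_conv[of bs] nonempty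
      unfolding ab(1) length_append by linarith+
    have sub: "set as \<subseteq> set (points s t)" "set bs \<subseteq> set (points s t)"
      and box: "\<And>e. e \<in> set as \<Longrightarrow> in_box k e" "\<And>e. e \<in> set bs \<Longrightarrow> in_box k e"
      using Suc.prems(1) unfolding common_def ab(1) set_append by blast+
    have sab: "sorted_wrt compatible as" "sorted_wrt compatible bs"
      "\<And>e f. e \<in> set as \<Longrightarrow> f \<in> set bs \<Longrightarrow> compatible e f"
      using srt unfolding ab(1) sorted_wrt_append by blast+
    \<comment> \<open>The position cut is the first match of the second part; positions increase in
      \<open>s\<close> and \<open>t\<close> simultaneously, so it separates the parts in
      both.\<close>
    define C where "C = fst (hd bs)"
    have hd_bs: "hd bs \<in> set bs" and hd_as: "hd as \<in> set as" using nonempty by auto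
    have C1: "lt2 (fst e) C" if "e \<in> set as" for e
      using sab(3)[OF that hd_bs] by (simp add: C_def compatible_def)
    have C2: "le2 C (fst f)" if "f \<in> set bs" for f
      using sab(2) that by (cases bs) (auto simp: C_def compatible_def le2_def lt2_def)
    have n: "le2 P1 (n, n)" "le2 V1 (n, n)" "le2 P0 (n, n)" "le2 V0 (n, n)"
      using Suc.prems(3) by (auto simp: in_boxes k)
    have PC: "le2 P0 C" "le2 C P1"
      using C1[OF hd_as] box(1)[OF hd_as] box(2)[OF hd_bs]
      by (auto simp: in_box_def k le2_def lt2_def C_def)
    from uv(4) show ?thesis
    proof
      assume lt: "\<forall>x\<in>set u. \<forall>y\<in>set v. x < y"
      define D where "D = low bs"
      have D1: "lt2 (snd e) D" if e: "e \<in> set as" for e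
        unfolding D_def
      proof (rule lt_low[OF nonempty(2)])
        fix f assume f: "f \<in> set bs"
        have "fst (snd e) < fst (snd f)" using lt e f by (auto simp: ab(2,3)[symmetric] word_def)
        \<comment> \<open>The split only orders the values in \<open>s\<close>; compatibility
          carries the order over to \<open>t\<close>.\<close>
        then show "lt2 (snd e) (snd f)" using sab(3)[OF e f] by (auto simp: compatible_def lt2_def)
      qed
      have D2: "le2 D (snd f)" if "f \<in> set bs" for f using low_le[OF that] by (simp add: D_def)
      have VD: "le2 V0 D" "le2 D V1"
        using D1[OF hd_as] D2[OF hd_bs] box(1)[OF hd_as] box(2)[OF hd_bs]
        by (auto simp: in_box_def k le2_def lt2_def)
      have cut: "(C, D) \<in> set (cuts n k)" using PC VD n by (auto simp: in_cuts k le2_def)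
      have "common s t ((P0, C), (V0, D)) as"
        using sab(1) sub(1) box(1) C1 D1 by (auto simp: common_def in_box_def k)
      moreover have "((P0, C), (V0, D)) \<in> set (boxes n)" using PC VD n by (auto simp: in_boxes le2_def)
      ultimately have 1: "length as \<le> length (table_lookup ?F ((P0, C), (V0, D)))"
        using Suc.IH av(1) len(1) by blast
      have "common s t ((C, P1), (D, V1)) bs"
        using sab(2) sub(2) box(2) C2 D2 by (auto simp: common_def in_box_def k)
      moreover have "((C, P1), (D, V1)) \<in> set (boxes n)" using PC VD n by (auto simp: in_boxes le2_def)
      ultimately have 2: "length bs \<le> length (table_lookup ?F ((C, P1), (D, V1)))"
        using Suc.IH av(2) len(2) by blast
      have "table_lookup ?F ((P0, C), (V0, D)) @ table_lookup ?F ((C, P1), (D, V1))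
          \<in> set (candidates s t n ?F k)"
        unfolding candidates_def using cut by (force simp: k)
      moreover have "length es \<le> length (table_lookup ?F ((P0, C), (V0, D)) @ table_lookup ?F ((C, P1), (D, V1)))"
        using 1 2 ab(1) by simp
      ultimately show ?thesis by (rule bexI[rotated])
    next
      assume gt: "\<forall>x\<in>set u. \<forall>y\<in>set v. y < x"
      \<comment> \<open>In the skew case the earlier part is the upper one, so its minimum is the
        cut.\<close>
      define D where "D = low as"
      have D1: "lt2 (snd f) D" if f: "f \<in> set bs" for f
        unfolding D_def
      proof (rule lt_low[OF nonempty(1)])
        fix e assume e: "e \<in> set as"
        have "fst (snd f) < fst (snd e)" using gt e f by (auto simp: ab(2,3)[symmetric] word_def)
        then show "lt2 (snd f) (snd e)" using sab(3)[OF e f] by (auto simp: compatible_def lt2_def)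
      qed
      have D2: "le2 D (snd e)" if "e \<in> set as" for e using low_le[OF that] by (simp add: D_def)
      have VD: "le2 V0 D" "le2 D V1"
        using D1[OF hd_bs] D2[OF hd_as] box(1)[OF hd_as] box(2)[OF hd_bs]
        by (auto simp: in_box_def k le2_def lt2_def)
      have cut: "(C, D) \<in> set (cuts n k)" using PC VD n by (auto simp: in_cuts k le2_def)
      have "common s t ((P0, C), (D, V1)) as"
        using sab(1) sub(1) box(1) C1 D2 by (auto simp: common_def in_box_def k)
      moreover have "((P0, C), (D, V1)) \<in> set (boxes n)" using PC VD n by (auto simp: in_boxes le2_def)
      ultimately have 1: "length as \<le> length (table_lookup ?F ((P0, C), (D, V1)))"
        using Suc.IH av(1) len(1) by blast
      have "common s t ((C, P1), (V0, D)) bs"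
        using sab(2) sub(2) box(2) C2 D1 by (auto simp: common_def in_box_def k)
      moreover have "((C, P1), (V0, D)) \<in> set (boxes n)" using PC VD n by (auto simp: in_boxes le2_def)
      ultimately have 2: "length bs \<le> length (table_lookup ?F ((C, P1), (V0, D)))"
        using Suc.IH av(2) len(2) by blast
      have "table_lookup ?F ((P0, C), (D, V1)) @ table_lookup ?F ((C, P1), (V0, D))
          \<in> set (candidates s t n ?F k)"
        unfolding candidates_def using cut by (force simp: k)
      moreover have "length es \<le> length (table_lookup ?F ((P0, C), (D, V1)) @ table_lookup ?F ((C, P1), (V0, D)))"
        using 1 2 ab(1) by simp
      ultimately show ?thesis by (rule bexI[rotated])
    qed
  qed
  show ?case
  proof (cases "es = []")
    case False
    then obtain w where "w \<in> set (candidates s t n ?F k)" "length es \<le> length w" using ex by blast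
    then show ?thesis unfolding eq using length_le_longest[of w] by fastforce
  qed simp
qed simp

section \<open>From stored words to longest common patterns\<close>

lemma is_perm_ranks:
  assumes "distinct w"
  shows "is_perm (ranks w)"
proof -
  let ?r = "\<lambda>x. length (filter (\<lambda>y. y \<le> x) w)"
  have r: "?r x = card {y \<in> set w. y \<le> x}" for x
    using distinct_card[OF distinct_filter[OF assms]] by simp
  have less: "?r x < ?r y" if "x \<in> set w" "y \<in> set w" "x < y" for x y
  proof -
    have "y \<in> {z \<in> set w. z \<le> y} - {z \<in> set w. z \<le> x}" using that by simp
    then have "{z \<in> set w. z \<le> x} \<subset> {z \<in> set w. z \<le> y}" using that(3) by fastforce
    then show ?thesis unfolding r by (intro psubset_card_mono) auto
  qed
  have inj: "inj_on ?r (set w)"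
  proof (rule inj_onI)
    fix x y assume "x \<in> set w" "y \<in> set w" "?r x = ?r y"
    then show "x = y" using less[of x y] less[of y x] by (cases x y rule: linorder_cases) auto
  qed
  have d: "distinct (ranks w)" using assms inj by (simp add: ranks_def distinct_map)
  have "?r x \<in> {1..length w}" if "x \<in> set w" for x
  proof -
    have "x \<in> set (filter (\<lambda>y. y \<le> x) w)" using that by simp
    then have "0 < ?r x" by (rule length_pos_if_in_set)
    then show ?thesis using length_filter_le[of "\<lambda>y. y \<le> x" w]
      by (simp add: Suc_le_eq del: length_greater_0_conv)
  qed
  then have sub: "set (ranks w) \<subseteq> {1..length w}" by (auto simp: ranks_def)
  \<comment> \<open>Distinct ranks within an interval of the same cardinality exhaust it.\<close>
  have "set (ranks w) = {1..length w}"
    by (rule card_subset_eq[OF _ sub]) (use distinct_card[OF d] in \<open>simp_all add: ranks_def\<close>)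
  then show ?thesis using d by (simp add: is_perm_def ranks_def)
qed

lemma ranks_less:
  assumes "l < length w" "m < length w" "ranks w ! l < ranks w ! m"
  shows "w ! l < w ! m"
proof (rule ccontr)
  assume "\<not> w ! l < w ! m"
  have "length (filter (\<lambda>y. y \<le> w ! m) w) = length (filter (\<lambda>y. y \<le> w ! m) (filter (\<lambda>y. y \<le> w ! l) w))"
    using \<open>\<not> w ! l < w ! m\<close> by (auto intro!: arg_cong[of _ _ length] filter_cong)
  also have "\<dots> \<le> length (filter (\<lambda>y. y \<le> w ! l) w)" by (rule length_filter_le)
  finally show False using assms by (simp add: ranks_def)
qed

lemma sound_is_pattern:
  assumes "sound s t k w"
  shows "is_perm (ranks w)" "is_pattern (ranks w) s" "is_pattern (ranks w) t"
proof -
  obtain es where es: "common s t k es" "w = word es" using assms sound_def by blast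
  have srt: "sorted_wrt compatible es" using es(1) by (simp add: common_def)
  have comp: "compatible (es ! l) (es ! m)" if "l < m" "m < length es" for l m
    using sorted_wrt_nth_less[OF srt that] .
  have pos: "fst (fst (es ! l)) < length s \<and> snd (fst (es ! l)) < length t \<and>
      fst (snd (es ! l)) = s ! fst (fst (es ! l)) \<and> snd (snd (es ! l)) = t ! snd (fst (es ! l))"
    if "l < length es" for l
  proof -
    have "es ! l \<in> set (points s t)" using es(1) that by (auto simp: common_def)
    then show ?thesis using in_points[of "fst (fst (es ! l))" "snd (fst (es ! l))"
        "fst (snd (es ! l))" "snd (snd (es ! l))" s t] by simp
  qed
  have len: "length (ranks w) = length es" "length w = length es"
    using es(2) by (simp_all add: ranks_def word_def)
  have w: "w ! l = fst (snd (es ! l))" if "l < length es" for l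
    using that by (simp add: es(2) word_def)
  have val: "fst (snd (es ! l)) < fst (snd (es ! m)) \<and> snd (snd (es ! l)) < snd (snd (es ! m))"
    if "l < length es" "m < length es" "ranks w ! l < ranks w ! m" for l m
  proof -
    have lt: "fst (snd (es ! l)) < fst (snd (es ! m))"
      using ranks_less[of l w m] that w len by simp
    then have "l \<noteq> m" by auto
    \<comment> \<open>Ranks compare the values in \<open>s\<close> alone; compatibility of the two
      matches, in whichever order they stand, gives the inequality in \<open>t\<close>.\<close>
    then show ?thesis using lt comp[of l m] comp[of m l] that(1,2)
      by (cases l m rule: linorder_cases) (auto simp: compatible_def lt2_def)
  qed
  show "is_pattern (ranks w) s"
    unfolding is_pattern_def len
    by (intro exI[of _ "\<lambda>l. fst (fst (es ! l))"] conjI allI impI)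
      (use pos val comp in \<open>auto simp: compatible_def lt2_def\<close>)
  show "is_pattern (ranks w) t"
    unfolding is_pattern_def len
    by (intro exI[of _ "\<lambda>l. snd (fst (es ! l))"] conjI allI impI)
      (use pos val comp in \<open>auto simp: compatible_def lt2_def\<close>)
  have "sorted_wrt (\<noteq>) w"
    using srt unfolding es(2) word_def sorted_wrt_map
    by (elim sorted_wrt_mono_rel[rotated]) (auto simp: compatible_def lt2_def)
  then show "is_perm (ranks w)" by (intro is_perm_ranks sorted_wrt_neq_distinct)
qed

theorem lcs_word_is_lcp:
  assumes s: "separable s" and t: "is_perm t"
  shows "is_lcp (ranks (lcs_word s t)) s t"
proof -
  let ?n = "bound s t"
  have snd: "sound s t (top_box ?n) (lcs_word s t)"
    unfolding lcs_word_def by (rule sound_lookup)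
  have perm_less: "xs ! i < ?n" if "is_perm xs" "i < length xs" "xs = s \<or> xs = t" for xs i
  proof -
    have "xs ! i \<in> {1..length xs}" using that(1,2) nth_mem[of i xs] by (simp add: is_perm_def)
    then show ?thesis using that(3) by (auto simp: bound_def)
  qed
  have "length q \<le> length (ranks (lcs_word s t))"
    if q: "is_perm q" and qs: "is_pattern q s" and qt: "is_pattern q t" for q
  proof -
    obtain i where i: "\<And>l m. l < m \<Longrightarrow> m < length q \<Longrightarrow> i l < i m" "\<And>l. l < length q \<Longrightarrow> i l < length s"
      "\<And>l m. l < length q \<Longrightarrow> m < length q \<Longrightarrow> q ! l < q ! m \<Longrightarrow> s ! i l < s ! i m"
      using qs unfolding is_pattern_def by blast
    obtain j where j: "\<And>l m. l < m \<Longrightarrow> m < length q \<Longrightarrow> j l < j m" "\<And>l. l < length q \<Longrightarrow> j l < length t"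
      "\<And>l m. l < length q \<Longrightarrow> m < length q \<Longrightarrow> q ! l < q ! m \<Longrightarrow> t ! j l < t ! j m"
      using qt unfolding is_pattern_def by blast
    \<comment> \<open>Each letter of \<open>q\<close> is matched through its images under both
      embeddings.\<close>
    define es where "es = map (\<lambda>l. ((i l, j l), (s ! i l, t ! j l))) [0..<length q]"
    have len: "length es = length q" by (simp add: es_def)
    have comp: "compatible (es ! l) (es ! m)" if "l < m" "m < length q" for l m
    proof -
      \<comment> \<open>Pattern embeddings transfer strict inequalities only; distinctness of
        \<open>q\<close> ensures that one of the two holds for each pair.\<close>
      have "q ! l \<noteq> q ! m"
        using q that nth_eq_iff_index_eq[of q l m] by (simp add: is_perm_def)
      then have "q ! l < q ! m \<or> q ! m < q ! l" by auto
      then show ?thesis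
        using i(1)[OF that] j(1)[OF that] i(3)[of l m] j(3)[of l m] i(3)[of m l] j(3)[of m l] that
        by (auto simp: es_def compatible_def lt2_def)
    qed
    have "sorted_wrt compatible es"
      unfolding sorted_wrt_iff_nth_less len using comp by blast
    moreover have "set es \<subseteq> set (points s t)"
      using i(2) j(2) by (auto simp: es_def in_points)
    moreover have "in_box (top_box ?n) e" if "e \<in> set es" for e
    proof -
      obtain l where l: "l < length q" "e = ((i l, j l), (s ! i l, t ! j l))"
        using \<open>e \<in> set es\<close> by (auto simp: es_def)
      have "is_perm s" using s by (simp add: separable_def)
      then show ?thesis
        using perm_less[of s "i l"] perm_less[of t "j l"] t i(2)[OF l(1)] j(2)[OF l(1)]
        by (auto simp: l(2) in_box_def top_box_def le2_def lt2_def bound_def)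
    qed
    ultimately have c: "common s t (top_box ?n) es" by (simp add: common_def)
    \<comment> \<open>\<open>word es\<close> is the subsequence of \<open>s\<close> selected by
      \<open>i\<close>; this is where separability of \<open>s\<close> enters.\<close>
    have av: "avoiding (word es)"
      by (rule avoiding_reindex[OF separable_avoiding[OF s], of _ i])
        (use i in \<open>auto simp: word_def es_def\<close>)
    have "length es \<le> length (lcs_word s t)"
      unfolding lcs_word_def
    proof (rule complete_rounds[OF c av])
      show "top_box ?n \<in> set (boxes ?n)" by (simp add: in_boxes top_box_def le2_def)
      show "length es \<le> ?n" using common_length[OF c] by (simp add: bound_def)
    qed
    then show ?thesis by (simp add: len ranks_def)
  qed
  then show ?thesis unfolding is_lcp_def using sound_is_pattern[OF snd] by blast
qed

section \<open>The dynamic program runs in polynomial time\<close>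

text \<open>Reduces an operation on arbitrary \<open>f x\<close> and \<open>g x\<close> to the case
  of projections. This matters when a lambda body refers to the arguments, because the input is then
  itself a component of a pair and \<open>f\<close> and \<open>g\<close> would appear composed with
  projections.\<close>

lemma polytime_comp2:
  assumes "polytime (\<lambda>p. h (fst p) (snd p))" "polytime f" "polytime g"
  shows "polytime (\<lambda>x. h (f x) (g x))"
  using polytime_comp[OF assms(1) polytime_pair[OF assms(2,3)]] by simp

lemma polytime_le2 [polytime_intros]: "polytime f \<Longrightarrow> polytime g \<Longrightarrow> polytime (\<lambda>x. le2 (f x) (g x))"
  unfolding le2_def by (intro polytime_intros)

lemma polytime_lt2 [polytime_intros]: "polytime f \<Longrightarrow> polytime g \<Longrightarrow> polytime (\<lambda>x. lt2 (f x) (g x))"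
  unfolding lt2_def Suc_le_eq[symmetric] by (intro polytime_intros)

lemma polytime_in_box [polytime_intros]: "polytime f \<Longrightarrow> polytime g \<Longrightarrow> polytime (\<lambda>x. in_box (f x) (g x))"
  unfolding in_box_def by (intro polytime_intros)

lemma polytime_points [polytime_intros]: "polytime f \<Longrightarrow> polytime g \<Longrightarrow> polytime (\<lambda>x. points (f x) (g x))"
  unfolding points_def by (intro polytime_intros polytime_id)

lemma polytime_grid [polytime_intros]: "polytime f \<Longrightarrow> polytime (\<lambda>x. grid (f x))"
  unfolding grid_def by (intro polytime_intros)

lemma polytime_boxes [polytime_intros]: "polytime f \<Longrightarrow> polytime (\<lambda>x. boxes (f x))"
  unfolding boxes_def by (intro polytime_intros)

lemma polytime_cuts [polytime_intros]: "polytime f \<Longrightarrow> polytime g \<Longrightarrow> polytime (\<lambda>x. cuts (f x) (g x))"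
proof (rule polytime_comp2[of cuts])
  show "polytime (\<lambda>p. cuts (fst p) (snd p))" unfolding cuts_def by (intro polytime_intros polytime_id)
qed

lemma polytime_table_lookup [polytime_intros]: "polytime f \<Longrightarrow> polytime g \<Longrightarrow> polytime (\<lambda>x. table_lookup (f x) (g x))"
proof (rule polytime_comp2[of table_lookup])
  show "polytime (\<lambda>p. table_lookup (fst p) (snd p))"
    unfolding table_lookup_def
  proof (rule polytime_fold_add[where A = "\<lambda>p. sz p"])
    show "sz (if fst e = snd p then snd e else w) \<le> sz w + sz (p, e)" for p :: "dptable \<times> box" and e w
      by (cases e) simp
  qed (intro polytime_intros polytime_id polybounded_intros)+
qed

lemma polytime_longest [polytime_intros]: "polytime f \<Longrightarrow> polytime (\<lambda>x. longest (f x))"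
  unfolding longest_def
  by (rule polytime_fold_add[where A = "\<lambda>p. sz p"]) (intro polytime_intros polytime_id polybounded_intros | simp)+

lemma polytime_refine:
  "polytime (\<lambda>x. refine (fst (fst x)) (snd (fst x)) (fst (snd x)) (snd (snd x)))"
  unfolding refine_def candidates_def by (intro polytime_intros polytime_id)

lemma polytime_bound [polytime_intros]: "polytime f \<Longrightarrow> polytime g \<Longrightarrow> polytime (\<lambda>x. bound (f x) (g x))"
  unfolding bound_def by (intro polytime_intros)

lemma polytime_ranks [polytime_intros]: "polytime f \<Longrightarrow> polytime (\<lambda>x. ranks (f x))"
proof (rule polytime_comp[of ranks])
  show "polytime ranks" unfolding ranks_def by (intro polytime_intros polytime_id)
qed

lemma sz_list_le: "(\<And>a. a \<in> set xs \<Longrightarrow> sz a \<le> m) \<Longrightarrow> sz xs \<le> 1 + length xs * (1 + m)"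
proof (induction xs)
  case (Cons a xs)
  have "sz a \<le> m" "sz xs \<le> 1 + length xs * (1 + m)" using Cons by simp_all
  then show ?case by simp
qed simp

lemma length_boxes: "length (boxes n) = (n + 1) ^ 8"
proof -
  have "length (grid n) = (n + 1) ^ 2" by (simp add: grid_def power2_eq_square del: upt_Suc)
  then have "length (boxes n) = ((n + 1) ^ 2) ^ 4"
    by (simp only: boxes_def length_product power4_eq_xxxx mult.assoc)
  then show ?thesis by (simp only: power_mult[symmetric]) simp
qed

text \<open>The bound does not depend on \<open>r\<close>: the number of keys is fixed by
  \<open>n\<close>, and soundness limits the words. This is what keeps iterated concatenation from
  growing exponentially.\<close>

lemma sz_rounds:
  "sz (rounds s t n r) \<le> 1 + (n + 1) ^ 8 * (1 + (16 * n + 17 + sz s * (1 + sz s)))"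
proof -
  have "sz e \<le> 16 * n + 17 + sz s * (1 + sz s)" if e: "e \<in> set (rounds s t n r)" for e
  proof -
    obtain k w where kw: "e = (k, w)" by (cases e)
    have snd: "sound s t k w" using sound_rounds[of s t n r] e kw by auto
    have "sz w \<le> 1 + length w * (1 + sz s)"
      by (rule sz_list_le) (use sound_word(2)[OF snd] sz_elem[of _ s] in fastforce)
    also have "\<dots> \<le> 1 + sz s * (1 + sz s)"
      using sound_word(1)[OF snd] length_le_sz[of s] by (intro add_left_mono mult_le_mono1) simp
    finally have w: "sz w \<le> 1 + sz s * (1 + sz s)" .
    have "k \<in> set (boxes n)"
      using e by (cases r) (auto simp: kw rounds_0 rounds_Suc refine_def)
    moreover obtain a b c d a' b' c' d' where "k = (((a, b), (c, d)), ((a', b'), (c', d')))"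
      by (metis prod.exhaust)
    \<comment> \<open>Eight numbers of size at most \<open>2 * n + 1\<close> each, and seven pair
      symbols.\<close>
    ultimately have "sz k \<le> 16 * n + 15" by (simp add: in_boxes le2_def)
    then show ?thesis using w by (simp add: kw)
  qed
  then have "sz (rounds s t n r) \<le> 1 + length (rounds s t n r) * (1 + (16 * n + 17 + sz s * (1 + sz s)))"
    by (rule sz_list_le)
  moreover have "length (rounds s t n r) \<le> (n + 1) ^ 8"
    by (cases r) (simp_all add: rounds_0 rounds_Suc refine_def length_boxes)
  then have "length (rounds s t n r) * (1 + (16 * n + 17 + sz s * (1 + sz s))) \<le>
      (n + 1) ^ 8 * (1 + (16 * n + 17 + sz s * (1 + sz s)))"
    by (rule mult_le_mono1)
  ultimately show ?thesis by linarith
qed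

lemma polytime_lcp: "polytime (\<lambda>x. ranks (lcs_word (fst x) (snd x)))"
proof -
  let ?n = "\<lambda>x. bound (fst x) (snd x)"
  have n: "polytime ?n" by (intro polytime_intros polytime_id)
  have "polybounded (\<lambda>x. sz (?n x))" by (rule polytime_size[OF n])
  then have pbn: "polybounded ?n" by (rule polybounded_mono) simp
  have "polytime (\<lambda>x. rounds (fst x) (snd x) (?n x) (?n x))"
    unfolding rounds_def
  proof (rule polytime_fold)
    let ?B = "\<lambda>x. 1 + (?n x + 1) ^ 8 * (1 + (16 * ?n x + 17 + sz (fst x) * (1 + sz (fst x))))"
    show "polytime (\<lambda>p. refine (fst (fst p)) (snd (fst p)) (bound (fst (fst p)) (snd (fst p))) (snd (snd p)))"
      using polytime_comp[OF polytime_refine, of "\<lambda>p. ((fst (fst p), snd (fst p)), (bound (fst (fst p)) (snd (fst p)), snd (snd p)))"]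
      by (simp add: polytime_intros polytime_id)
    show "polytime (\<lambda>x. replicate (?n x) ())" by (intro polytime_intros polytime_id)
    show "polybounded ?B" by (intro polybounded_intros pbn polytime_size polytime_intros polytime_id)
    \<comment> \<open>A prefix of the unary list yields the table after \<open>min m (?n x)\<close>
      rounds, and \<open>sz_rounds\<close> covers every number of rounds.\<close>
    show "sz (fold (\<lambda>_ F. refine (fst x) (snd x) (?n x) F) (take m (replicate (?n x) ())) []) \<le> ?B x" for x m
      using sz_rounds[of "fst x" "snd x" "?n x" "min m (?n x)"] by (simp add: rounds_def min.commute)
  qed (intro polytime_intros)
  then show ?thesis unfolding lcs_word_def top_box_def by (intro polytime_intros polytime_id n)
qed

theorem theorem1:
  shows "\<exists>M c d. wf_tm M \<and>
    (\<forall>s t. separable s \<and> is_perm t \<longrightarrow>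
       (\<exists>T p. T \<le> c * length (enc_pair s t) ^ d + c \<and>
            cfg_state (tm_run M T (tm_init (enc_pair s t))) = 1 \<and>
            cfg_output (tm_run M T (tm_init (enc_pair s t))) = enc_list p \<and>
            is_lcp p s t))"
proof -
  obtain M c d where M: "wf_tm M"
    "\<forall>s t. \<exists>T. T \<le> c * length (enc_pair s t) ^ d + c \<and>
       cfg_state (tm_run M T (tm_init (enc_pair s t))) = 1 \<and>
       cfg_output (tm_run M T (tm_init (enc_pair s t))) = enc_list (ranks (lcs_word s t))"
    using polytime_tm[OF polytime_lcp, unfolded fst_conv snd_conv] by blast
  then show ?thesis using lcs_word_is_lcp by blast
qed

end
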